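(* Let $\omega\in(0,1)$ be fixed, let $\mathbf a=\{a_k\}_{k\ge1}$ and $\mathbf b=\{b_k\}_{k\ge1}$ be real sequences with $0<a_1\le a_2\le\dots\le a_k\le\dots$, $b_k>0$ for all $k$, and $b_*:=\inf_{k\ge1}b_k>0$. Consider the approximation problem $I=\{I_d\}_{d\in\mathbb N}$, $I_d:C([0,1]^d)\to L_2([0,1]^d)$, $I_df=f$, in the average case setting with respect to the zero-mean Gaussian measure $\mu_d$ on $C([0,1]^d)$ with covariance kernel the analytic Korobov kernel $K_{d,\mathbf a,\mathbf b}$. Then: (i) For ABS or NOR (i.e. for each of the two error criteria), if $s>0$ and $t>1$, then EC-$(s,t)$-WT always holds. (ii) For ABS or NOR, for every $s\ge1$: EC-$(s,1)$-WT holds if and only if EC-WT holds, if and only if $$\lim_{j\to\infty}a_j=\infty.$$ (iii) For ABS, for every $t$ with $0<t<1$: EC-$(1,t)$-WT holds if and only if $$\lim_{j\to\infty}\frac{\ln j}{a_j}=0.$$ (iv) For ABS or NOR, for every $s$ with $0<s<1$ and every $t$ with $0<t\le1$: EC-$(s,t)$-WT holds if and only if $$\lim_{j\to\infty}\frac{j^{(1-s)/s}}{a_j}=0.$$ (v) For ABS or NOR, for every $s>1$ and every $t$ with $0<t<1$: EC-$(s,t)$-WT holds if and only if $$\lim_{j\to\infty}j^{1-t}a_j\,\omega^{a_j}=0.$$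
   Context: $\mathbb N=\{1,2,\dots\}$. Analytic Korobov kernel: for $\mathbf h=(h_1,\dots,h_d)\in\mathbb Z^d$ put $\omega_{\mathbf h}=\omega^{\sum_{k=1}^d a_k|h_k|^{b_k}}$ (with $|0|^{b_k}=0$), and $$K_{d,\mathbf a,\mathbf b}(\mathbf x,\mathbf y)=\sum_{\mathbf h\in\mathbb Z^d}\omega_{\mathbf h}\exp(2\pi i\,\mathbf h\cdot(\mathbf x-\mathbf y)),\qquad \mathbf x,\mathbf y\in[0,1]^d,$$ where $\mathbf x\cdot\mathbf y=\sum_{k=1}^d x_ky_k$ and $i=\sqrt{-1}$. Equivalently $K_{d,\mathbf a,\mathbf b}(\mathbf x,\mathbf y)=\prod_{k=1}^dK_{1,a_k,b_k}(x_k,y_k)$ with $K_{1,a,b}(x,y)=\sum_{h\in\mathbb Z}\omega^{a|h|^b}\exp(2\pi i h(x-y))$. This kernel is real-valued. $C([0,1]^d)$ is the space of continuous real functions on $[0,1]^d$, equipped with the zero-mean Gaussian measure $\mu_d$ whose covariance kernel is $K_{d,\mathbf a,\mathbf b}$, i.e. $\int_{C([0,1]^d)}f(\mathbf x)f(\mathbf y)\,\mu_d(df)=K_{d,\mathbf a,\mathbf b}(\mathbf x,\mathbf y)$. Algorithms and average case errors: for $n\ge1$, an algorithm is a map of the form $A_{n,d}f=\phi_{n,d}(L_1(f),\dots,L_n(f))$, where $L_1,\dots,L_n$ are continuous linear functionals on $C([0,1]^d)$ and $\phi_{n,d}:\mathbb R^n\to L_2([0,1]^d)$ is an arbitrary measurable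 mapping; for $n=0$, $A_{0,d}=0$. The average case error is $$e^{\rm avg}(A_{n,d})=\Big[\int_{C([0,1]^d)}\|I_df-A_{n,d}f\|_{L_2([0,1]^d)}^2\,\mu_d(df)\Big]^{1/2},$$ and, for $n\ge1$, $e^{\rm avg}(n,d)=\inf_{A_{n,d}}e^{\rm avg}(A_{n,d})$, the infimum being over all algorithms of the form $A_{n,d}f=\phi_{n,d}(L_1(f),\dots,L_n(f))$ with $L_1,\dots,L_n$ continuous linear functionals on $C([0,1]^d)$ and $\phi_{n,d}:\mathbb R^n\to L_2([0,1]^d)$ measurable; $e^{\rm avg}(0,d)=e^{\rm avg}(A_{0,d})$ is the initial error. Information complexity: for $X\in\{\mathrm{ABS},\mathrm{NOR}\}$ (absolute, respectively normalized, error criterion), $\varepsilon\in(0,1)$ and $d\in\mathbb N$, $$n^{{\rm avg},X}(\varepsilon,d)=\min\{n\ge0:\ e^{\rm avg}(n,d)\le\varepsilon\, CRI_d\},$$ where $CRI_d=1$ for $X=\mathrm{ABS}$ and $CRI_d=e^{\rm avg}(0,d)$ for $X=\mathrm{NOR}$. EC-$(s,t)$-WT (exponential convergent $(s,t)$-weak tractability) under criterion $X$, for $s,t>0$, means $$\lim_{\varepsilon^{-1}+d\to\infty}\frac{\ln n^{{\rm avg},X}(\varepsilon,d)}{(\ln\varepsilon^{-1})^s+d^t}=0,$$ where the limit is over pairs $(\varepsilon,d)\in(0,1)\times\mathbb N$. EC-WT means EC-$(1,1)$-WT. In every item, a statement "for ABS or NOR" is asserted for each of the two criteria separately, with the same criterion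 used throughout the item. *)

theory Defs
  imports "HOL-Probability.Probability"
begin

text \<open>
  Points of \<open>[0,1]\<^sup>d\<close> are extensional functions on \<open>{1..d}\<close>, so that \<open>d\<close> can vary inside
  a statement. Sequences such as \<open>a\<close> and \<open>b\<close> are used at indices \<open>k \<ge> 1\<close> only.
\<close>

definition cube :: "nat \<Rightarrow> (nat \<Rightarrow> real) set" where
  "cube d = {1..d} \<rightarrow>\<^sub>E {0..1}"

definition cube_lebesgue :: "nat \<Rightarrow> (nat \<Rightarrow> real) measure" where
  "cube_lebesgue d = Pi\<^sub>M {1..d} (\<lambda>_. restrict_space lborel {0..1})"


section \<open>The analytic Korobov kernel\<close>

definition korobov_weight ::
  "real \<Rightarrow> (nat \<Rightarrow> real) \<Rightarrow> (nat \<Rightarrow> real) \<Rightarrow> nat \<Rightarrow> (nat \<Rightarrow> int) \<Rightarrow> real" where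
  "korobov_weight \<omega> a b d h = \<omega> powr (\<Sum>k=1..d. a k * \<bar>real_of_int (h k)\<bar> powr b k)"

definition korobov_kernel ::
  "real \<Rightarrow> (nat \<Rightarrow> real) \<Rightarrow> (nat \<Rightarrow> real) \<Rightarrow> nat \<Rightarrow> (nat \<Rightarrow> real) \<Rightarrow> (nat \<Rightarrow> real) \<Rightarrow> complex" where
  "korobov_kernel \<omega> a b d x y =
     (\<Sum>\<^sub>\<infinity>h \<in> {1..d} \<rightarrow>\<^sub>E (UNIV :: int set).
        complex_of_real (korobov_weight \<omega> a b d h) *
        exp (2 * complex_of_real pi * \<i> *
             complex_of_real (\<Sum>k=1..d. real_of_int (h k) * (x k - y k))))"


section \<open>The space \<open>C([0,1]\<^sup>d)\<close> and Gaussian measures on it\<close>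

text \<open>
  Elements are extensional functions on the cube; the metric is the supremum distance.
\<close>
definition C_cube :: "nat \<Rightarrow> ((nat \<Rightarrow> real) \<Rightarrow> real) metric" where
  "C_cube d = cfunspace (product_topology (\<lambda>_. top_of_set {0..1}) {1..d}) euclidean_metric"

definition C_borel :: "nat \<Rightarrow> ((nat \<Rightarrow> real) \<Rightarrow> real) measure" where
  "C_borel d = sigma (mspace (C_cube d)) {U. openin (mtopology_of (C_cube d)) U}"

definition cont_linear_functional :: "nat \<Rightarrow> (((nat \<Rightarrow> real) \<Rightarrow> real) \<Rightarrow> real) \<Rightarrow> bool" where
  "cont_linear_functional d L \<longleftrightarrow>
     continuous_map (mtopology_of (C_cube d)) euclidean L \<and>
     (\<forall>f\<in>mspace (C_cube d). \<forall>g\<in>mspace (C_cube d).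
        L (\<lambda>x\<in>cube d. f x + g x) = L f + L g) \<and>
     (\<forall>c. \<forall>f\<in>mspace (C_cube d). L (\<lambda>x\<in>cube d. c * f x) = c * L f)"

text \<open>The case \<open>\<sigma> = 0\<close> is the point mass at \<open>0\<close>.\<close>
definition centered_normal :: "real \<Rightarrow> real measure" where
  "centered_normal \<sigma> =
     (if \<sigma> = 0 then return borel 0 else density lborel (\<lambda>x. ennreal (normal_density 0 \<sigma> x)))"

definition centered_gaussian_measure ::
  "nat \<Rightarrow> ((nat \<Rightarrow> real) \<Rightarrow> real) measure \<Rightarrow> bool" where
  "centered_gaussian_measure d M \<longleftrightarrow>
     prob_space M \<and> sets M = sets (C_borel d) \<and>
     (\<forall>L. cont_linear_functional d L \<longrightarrow> (\<exists>\<sigma>\<ge>0. distr M borel L = centered_normal \<sigma>))"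

definition has_covariance_kernel ::
  "nat \<Rightarrow> ((nat \<Rightarrow> real) \<Rightarrow> real) measure \<Rightarrow>
   ((nat \<Rightarrow> real) \<Rightarrow> (nat \<Rightarrow> real) \<Rightarrow> complex) \<Rightarrow> bool" where
  "has_covariance_kernel d M K \<longleftrightarrow>
     (\<forall>x\<in>cube d. \<forall>y\<in>cube d. complex_of_real (\<integral>f. f x * f y \<partial>M) = K x y)"


section \<open>The space \<open>L\<^sub>2([0,1]\<^sup>d)\<close>\<close>

text \<open>
  Elements are square integrable functions, not classes modulo null sets. As \<open>L2_norm\<close> does not
  separate functions equal almost everywhere, every open set of the seminorm topology is a union
  of such classes: measurability of a map into \<open>L2_borel d\<close> is exactly Borel measurability
  of the induced map into the quotient.
\<close>

definition L2 :: "nat \<Rightarrow> ((nat \<Rightarrow> real) \<Rightarrow> real) set" where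
  "L2 d = {g \<in> borel_measurable (cube_lebesgue d). integrable (cube_lebesgue d) (\<lambda>x. (g x)\<^sup>2)}"

definition L2_norm :: "nat \<Rightarrow> ((nat \<Rightarrow> real) \<Rightarrow> real) \<Rightarrow> real" where
  "L2_norm d g = sqrt (\<integral>x. (g x)\<^sup>2 \<partial>cube_lebesgue d)"

definition L2_borel :: "nat \<Rightarrow> ((nat \<Rightarrow> real) \<Rightarrow> real) measure" where
  "L2_borel d = sigma (L2 d)
     {U. U \<subseteq> L2 d \<and> (\<forall>g\<in>U. \<exists>r>0. \<forall>h\<in>L2 d. L2_norm d (\<lambda>x. h x - g x) < r \<longrightarrow> h \<in> U)}"


section \<open>Algorithms and average case errors\<close>

definition algorithms ::
  "nat \<Rightarrow> nat \<Rightarrow> (((nat \<Rightarrow> real) \<Rightarrow> real) \<Rightarrow> ((nat \<Rightarrow> real) \<Rightarrow> real)) set" where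
  "algorithms n d =
     {A. \<exists>L \<phi>. (\<forall>i\<in>{1..n}. cont_linear_functional d (L i)) \<and>
               \<phi> \<in> measurable (Pi\<^sub>M {1..n} (\<lambda>_. borel :: real measure)) (L2_borel d) \<and>
               A = (\<lambda>f. \<phi> (\<lambda>i\<in>{1..n}. L i f))}"

definition ennreal_sqrt :: "ennreal \<Rightarrow> ennreal" where
  "ennreal_sqrt z = (if z = top then top else ennreal (sqrt (enn2real z)))"

text \<open>The error of an algorithm may be infinite, hence the extended values.\<close>
definition avg_error ::
  "nat \<Rightarrow> ((nat \<Rightarrow> real) \<Rightarrow> real) measure \<Rightarrow>
   (((nat \<Rightarrow> real) \<Rightarrow> real) \<Rightarrow> ((nat \<Rightarrow> real) \<Rightarrow> real)) \<Rightarrow> ennreal" where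
  "avg_error d M A =
     ennreal_sqrt (\<integral>\<^sup>+f. ennreal ((L2_norm d (\<lambda>x. f x - A f x))\<^sup>2) \<partial>M)"

definition min_avg_error ::
  "(nat \<Rightarrow> ((nat \<Rightarrow> real) \<Rightarrow> real) measure) \<Rightarrow> nat \<Rightarrow> nat \<Rightarrow> ennreal" where
  "min_avg_error \<mu> n d =
     (if n = 0 then avg_error d (\<mu> d) (\<lambda>f x. 0)
      else (INF A\<in>algorithms n d. avg_error d (\<mu> d) A))"


section \<open>Information complexity and tractability\<close>

datatype criterion = ABS | NOR

definition CRI ::
  "criterion \<Rightarrow> (nat \<Rightarrow> ((nat \<Rightarrow> real) \<Rightarrow> real) measure) \<Rightarrow> nat \<Rightarrow> ennreal" where
  "CRI X \<mu> d = (case X of ABS \<Rightarrow> 1 | NOR \<Rightarrow> min_avg_error \<mu> 0 d)"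

definition info_complexity ::
  "criterion \<Rightarrow> (nat \<Rightarrow> ((nat \<Rightarrow> real) \<Rightarrow> real) measure) \<Rightarrow> real \<Rightarrow> nat \<Rightarrow> nat" where
  "info_complexity X \<mu> \<epsilon> d = (LEAST n. min_avg_error \<mu> n d \<le> ennreal \<epsilon> * CRI X \<mu> d)"

text \<open>The filter \<open>\<epsilon>\<^sup>-\<^sup>1 + d \<rightarrow> \<infinity>\<close> over pairs \<open>(\<epsilon>, d)\<close> with \<open>0 < \<epsilon> < 1\<close> and \<open>d \<ge> 1\<close>.\<close>
definition eps_dim_filter :: "(real \<times> nat) filter" where
  "eps_dim_filter =
     inf (filtercomap (\<lambda>(\<epsilon>, d). 1 / \<epsilon> + real d) at_top) (principal ({0<..<1} \<times> {1..}))"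

definition EC_st_WT ::
  "criterion \<Rightarrow> (nat \<Rightarrow> ((nat \<Rightarrow> real) \<Rightarrow> real) measure) \<Rightarrow> real \<Rightarrow> real \<Rightarrow> bool" where
  "EC_st_WT X \<mu> s t \<longleftrightarrow>
     ((\<lambda>(\<epsilon>, d). ln (real (info_complexity X \<mu> \<epsilon> d)) / (ln (1 / \<epsilon>) powr s + real d powr t))
        \<longlongrightarrow> 0) eps_dim_filter"

definition EC_WT ::
  "criterion \<Rightarrow> (nat \<Rightarrow> ((nat \<Rightarrow> real) \<Rightarrow> real) measure) \<Rightarrow> bool" where
  "EC_WT X \<mu> \<longleftrightarrow> EC_st_WT X \<mu> 1 1"

end

theory Submission
  imports Defs "HOL-Real_Asymp.Real_Asymp"
begin

text \<open>
  The proof has a probabilistic half, which turns the average case errors into tail sums of the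
  weights \<open>\<omega>\<^sub>h\<close>, and an analytic half, which estimates those tail sums.

  The covariance operator of \<open>\<mu>\<^sub>d\<close> on \<open>L\<^sub>2\<close> is diagonal in the real orthonormal basis
  \<open>cos (2\<pi> h\<cdot>x) + sin (2\<pi> h\<cdot>x)\<close>, \<open>h \<in> \<int>\<^sup>d\<close>, with eigenvalues \<open>\<omega>\<^sub>h\<close> (\<open>hartley_orthonormal\<close>,
  \<open>hartley_expansion\<close>). Computing the coefficients of \<open>f\<close> for a finite set \<open>H\<close> of frequencies gives an
  algorithm whose squared error is the sum of the \<open>\<omega>\<^sub>h\<close> outside \<open>H\<close> (\<open>projection_error\<close>).
  Conversely, no \<open>n\<close> functionals do better than the \<open>n\<close> largest eigenvalues. In a Gaussian space a
  variable that is uncorrelated with the information is uncorrelated with every function of it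
  (\<open>uncorrelated_function\<close>), so an arbitrary reconstruction is no better than the linear projection
  (\<open>best_approximation\<close>), and Bessel's inequality in \<open>L\<^sub>2(\<mu>\<^sub>d)\<close> limits what \<open>n\<close> linear functionals
  can capture. The convenient form is \<open>algorithm_error_ge\<close>: for every \<open>c > 0\<close> the squared error is at
  least \<open>(\<Sum>h\<in>H. min \<omega>\<^sub>h c) - c n\<close>.

  Write \<open>\<alpha>\<^sub>k = a\<^sub>k ln (1/\<omega>)\<close>, \<open>x = ln (1/\<epsilon>)\<close>, and let \<open>Z d \<tau>\<close> be the sum of \<open>\<omega>\<^sub>h\<^sup>\<tau>\<close> over all \<open>h\<close>, a product
  of one-dimensional sums. Cutting the spectrum at a threshold yields, for every \<open>0 < \<tau> < 1\<close>,
  \<open>ln n \<le> (ln (Z d \<tau>) + 2 \<tau> x) / (1 - \<tau>)\<close> (\<open>ln_info_complexity_upper\<close>). Every sufficient condition is an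
  instance with a suitable \<open>\<tau>\<close>: small and constant when \<open>s \<ge> 1 = t\<close> or \<open>s = 1 > t\<close>; a negative power of \<open>x\<close>
  (up to constants) when \<open>s < 1\<close> or \<open>t > 1\<close>; equal to \<open>1 - 1 / ln d\<close> when \<open>s > 1 > t\<close>. Both criteria are
  treated at once: the factor of \<open>\<epsilon>\<close> lies between \<open>1\<close> and the square root of the trace \<open>Z d 1\<close>.

  For the necessary conditions, a failing limit provides infinitely many \<open>j\<close> with \<open>\<alpha>\<^sub>j\<close> too small, and
  by monotonicity all of \<open>\<alpha>\<^sub>1, \<dots>, \<alpha>\<^sub>j\<close> are too small. In dimension \<open>d = j\<close> there are then many large
  eigenvalues. Bounded \<open>\<alpha>\<close>: the trace grows exponentially while no eigenvalue exceeds \<open>1\<close>. For \<open>s = 1\<close>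
  one counts the indicators of the \<open>m\<close>-subsets of \<open>{1..j}\<close> with \<open>m\<close> slightly larger than \<open>j\<^sup>t\<close>; for \<open>s < 1\<close>
  the indicators of all subsets. For \<open>s > 1\<close> and \<open>t < 1\<close> the accuracy is kept at \<open>1/2\<close>: a random
  frequency drawn with probabilities proportional to \<open>\<omega>\<^sub>h\<close> has about \<open>j exp (-\<alpha>\<^sub>j)\<close> nonzero coordinates,
  each of which contributes about \<open>\<alpha>\<^sub>j\<close> to \<open>- ln \<omega>\<^sub>h\<close>, and a Chernoff bound with exponent \<open>1/\<alpha>\<^sub>j\<close> makes
  \<open>ln n\<close> at least a constant times \<open>j \<alpha>\<^sub>j exp (-\<alpha>\<^sub>j)\<close> (\<open>ln_N_ge_entropy\<close>).
\<close>

section \<open>Continuous functions and functionals on the cube\<close>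

abbreviation cube_top :: "nat \<Rightarrow> (nat \<Rightarrow> real) topology" where
  "cube_top d \<equiv> product_topology (\<lambda>_. top_of_set {0..1}) {1..d}"

lemma topspace_cube_top: "topspace (cube_top d) = cube d"
  by (simp add: cube_def)

lemma cube_nonempty: "cube d \<noteq> {}"
  by (simp add: cube_def PiE_eq_empty_iff)

lemma C_cube_iff:
  "f \<in> mspace (C_cube d) \<longleftrightarrow> f \<in> extensional (cube d) \<and> continuous_map (cube_top d) euclidean f"
proof -
  have "compactin (cube_top d) (topspace (cube_top d))"
    unfolding compact_space_def[symmetric] by (simp add: compact_space_product_topology compact_space_subtopology)
  note eq = compactin_mspace_cfunspace[OF this, of euclidean_metric]
  show ?thesis
    unfolding C_cube_def eq topspace_cube_top by simp
qed

lemma C_cube_abs_diff_le: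
  assumes "f \<in> mspace (C_cube d)" "g \<in> mspace (C_cube d)" "x \<in> cube d"
  shows "\<bar>f x - g x\<bar> \<le> mdist (C_cube d) f g"
  using mdist_cfunspace_imp_mdist_le[of f "cube_top d" euclidean_metric g _ x] assms
  by (auto simp: C_cube_def topspace_cube_top dist_real_def cube_def simp del: mspace_cfunspace)

lemma cont_linear_functional_if_bounded:
  assumes bound: "\<And>f g. f \<in> mspace (C_cube d) \<Longrightarrow> g \<in> mspace (C_cube d) \<Longrightarrow>
                    \<bar>L f - L g\<bar> \<le> B * mdist (C_cube d) f g"
    and add: "\<And>f g. f \<in> mspace (C_cube d) \<Longrightarrow> g \<in> mspace (C_cube d) \<Longrightarrow>
                L (\<lambda>x\<in>cube d. f x + g x) = L f + L g"
    and scale: "\<And>c f. f \<in> mspace (C_cube d) \<Longrightarrow> L (\<lambda>x\<in>cube d. c * f x) = c * L f"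
  shows "cont_linear_functional d L"
proof -
  have "Lipschitz_continuous_map (C_cube d) euclidean_metric L"
    unfolding Lipschitz_continuous_map_def using bound by (auto simp: dist_real_def)
  then have "continuous_map (mtopology_of (C_cube d)) (mtopology_of euclidean_metric) L"
    by (rule Lipschitz_continuous_imp_continuous_map)
  then show ?thesis using add scale unfolding cont_linear_functional_def by simp
qed

lemma space_C_borel: "space (C_borel d) = mspace (C_cube d)"
  by (auto simp: C_borel_def space_measure_of_conv)

lemma sets_C_borel: "sets (C_borel d) = sigma_sets (mspace (C_cube d)) {U. openin (mtopology_of (C_cube d)) U}"
  unfolding C_borel_def by (rule sets_measure_of) (use openin_subset in fastforce)

lemma cont_linear_functional_measurable:
  assumes "cont_linear_functional d L"
  shows "L \<in> borel_measurable (C_borel d)"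
proof (rule borel_measurableI)
  fix S :: "real set" assume "open S"
  have "openin (mtopology_of (C_cube d)) {f \<in> mspace (C_cube d). L f \<in> S}"
    using openin_continuous_map_preimage[of "mtopology_of (C_cube d)" euclidean L S] assms \<open>open S\<close>
    unfolding cont_linear_functional_def by simp
  moreover have "L -` S \<inter> space (C_borel d) = {f \<in> mspace (C_cube d). L f \<in> S}"
    by (auto simp: space_C_borel)
  ultimately show "L -` S \<inter> space (C_borel d) \<in> sets (C_borel d)"
    by (auto simp: sets_C_borel)
qed

lemma cont_linear_functional_zero: "cont_linear_functional d (\<lambda>f. 0)"
  by (rule cont_linear_functional_if_bounded[where B=0]) auto

lemma cont_linear_functional_add:
  assumes "cont_linear_functional d L" "cont_linear_functional d L'"
  shows "cont_linear_functional d (\<lambda>f. L f + L' f)"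
  using assms unfolding cont_linear_functional_def
  by (auto intro!: continuous_map_add simp: algebra_simps)

lemma cont_linear_functional_scale:
  assumes "cont_linear_functional d L"
  shows "cont_linear_functional d (\<lambda>f. c * L f)"
  using assms unfolding cont_linear_functional_def
  by (auto intro!: continuous_map_real_mult_left simp: algebra_simps)

lemma cont_linear_functional_eval:
  assumes "x \<in> cube d"
  shows "cont_linear_functional d (\<lambda>f. f x)"
  by (rule cont_linear_functional_if_bounded[where B=1])
     (use assms in \<open>auto simp: C_cube_abs_diff_le\<close>)

section \<open>Lebesgue measure on the cube\<close>

abbreviation unit_lebesgue :: "real measure" where
  "unit_lebesgue \<equiv> restrict_space lborel {0..1}"

interpretation unit_lebesgue: prob_space unit_lebesgue
  by (rule prob_spaceI) (simp add: emeasure_restrict_space space_restrict_space)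

interpretation cube_lebesgue: product_prob_space "\<lambda>_::nat. unit_lebesgue" I for I
  by unfold_locales

lemma prob_space_cube_lebesgue: "prob_space (cube_lebesgue d)"
  unfolding cube_lebesgue_def by (rule prob_space_PiM) (rule unit_lebesgue.prob_space_axioms)

lemma space_cube_lebesgue: "space (cube_lebesgue d) = cube d"
  by (simp add: cube_lebesgue_def cube_def space_PiM space_restrict_space)

lemma cube_coordinate_measurable:
  assumes "k \<in> {1..d}"
  shows "(\<lambda>x. x k) \<in> borel_measurable (cube_lebesgue d)"
proof -
  have "(\<lambda>x. x k) \<in> measurable (cube_lebesgue d) unit_lebesgue"
    unfolding cube_lebesgue_def using assms by (rule measurable_component_singleton)
  moreover have "(\<lambda>x. x) \<in> borel_measurable unit_lebesgue"
    by (rule measurable_restrict_space1) simp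
  ultimately show ?thesis by (rule measurable_compose)
qed

text \<open>
  Rounding a point down to the grid of mesh \<open>1/m\<close> makes point evaluation a limit of functions
  with countably many values in the point; this is what makes it jointly measurable.
\<close>
definition grid_round :: "nat \<Rightarrow> nat \<Rightarrow> (nat \<Rightarrow> real) \<Rightarrow> (nat \<Rightarrow> real)" where
  "grid_round d m x = (\<lambda>k\<in>{1..d}. real_of_int \<lfloor>real (Suc m) * x k\<rfloor> / real (Suc m))"

lemma grid_round_in_cube:
  assumes "x \<in> cube d" shows "grid_round d m x \<in> cube d"
proof -
  have "real_of_int \<lfloor>real (Suc m) * x k\<rfloor> / real (Suc m) \<in> {0..1}" if "k \<in> {1..d}" for k
  proof -
    have x: "0 \<le> x k" "x k \<le> 1" using assms that by (auto simp: cube_def PiE_iff)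
    have "real_of_int \<lfloor>real (Suc m) * x k\<rfloor> \<le> real (Suc m) * x k" by linarith
    also have "\<dots> \<le> real (Suc m)" using x by (simp add: mult_left_le)
    finally show ?thesis using x by (auto simp: divide_simps simp del: of_nat_Suc)
  qed
  then show ?thesis by (auto simp: cube_def grid_round_def)
qed

lemma grid_round_limit:
  assumes "x \<in> cube d" "k \<in> {1..d}"
  shows "(\<lambda>m. grid_round d m x k) \<longlonglongrightarrow> x k"
proof -
  have "(\<lambda>m. grid_round d m x k - x k) \<longlonglongrightarrow> 0"
  proof (rule LIMSEQ_norm_0)
    fix m
    have "\<bar>real_of_int \<lfloor>real (Suc m) * x k\<rfloor> - real (Suc m) * x k\<bar> < 1" by linarith
    then have "\<bar>real_of_int \<lfloor>real (Suc m) * x k\<rfloor> - real (Suc m) * x k\<bar> / real (Suc m) < 1 / real (Suc m)"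
      by (intro divide_strict_right_mono) auto
    also have "\<bar>real_of_int \<lfloor>real (Suc m) * x k\<rfloor> - real (Suc m) * x k\<bar> / real (Suc m)
       = \<bar>(real_of_int \<lfloor>real (Suc m) * x k\<rfloor> - real (Suc m) * x k) / real (Suc m)\<bar>"
      by (simp del: of_nat_Suc)
    also have "(real_of_int \<lfloor>real (Suc m) * x k\<rfloor> - real (Suc m) * x k) / real (Suc m) = grid_round d m x k - x k"
      using assms(2) by (simp add: grid_round_def diff_divide_distrib del: of_nat_Suc)
    finally show "norm (grid_round d m x k - x k) < 1 / real (Suc m)" by simp
  qed
  then show ?thesis by (simp add: LIM_zero_iff)
qed

lemma C_cube_grid_round_limit:
  assumes f: "f \<in> mspace (C_cube d)" and x: "x \<in> cube d"
  shows "(\<lambda>m. f (grid_round d m x)) \<longlonglongrightarrow> f x"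
proof -
  have "limitin (cube_top d) (\<lambda>m. grid_round d m x) x sequentially"
    unfolding limitin_componentwise
    using x grid_round_in_cube[OF x] grid_round_limit[OF x]
    by (auto simp: cube_def PiE_iff limitin_subtopology limitin_canonical_iff)
  then have "limitin euclidean (f \<circ> (\<lambda>m. grid_round d m x)) (f x) sequentially"
    using f by (intro continuous_map_limit) (auto simp: C_cube_iff)
  then show ?thesis by (simp add: o_def)
qed

lemma grid_round_measurable:
  "grid_round d m \<in> measurable (cube_lebesgue d) (count_space (grid_round d m ` cube d))"
  and grid_countable: "countable (grid_round d m ` cube d)"
proof -
  define G where "G = ({1..d} \<rightarrow>\<^sub>E (UNIV :: int set))"
  define r where "r z = (\<lambda>k\<in>{1..d}. real_of_int (z k) / real (Suc m))" for z :: "nat \<Rightarrow> int"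
  define q where "q x = (\<lambda>k\<in>{1..d}. \<lfloor>real (Suc m) * x k\<rfloor>)" for x :: "nat \<Rightarrow> real"
  have G: "countable G" unfolding G_def by (rule countable_PiE) auto
  have rq: "grid_round d m x = r (q x)" for x by (auto simp: grid_round_def r_def q_def fun_eq_iff)
  have qG: "q x \<in> G" for x by (simp add: q_def G_def)
  show c: "countable (grid_round d m ` cube d)"
    by (rule countable_subset[OF _ countable_image[OF G, of r]]) (auto simp: rq qG)
  have qm: "{x \<in> space (cube_lebesgue d). q x = z} \<in> sets (cube_lebesgue d)" if "z \<in> G" for z
  proof -
    have "{x \<in> space (cube_lebesgue d). q x = z}
       = {x \<in> space (cube_lebesgue d). \<forall>k\<in>{1..d}. \<lfloor>real (Suc m) * x k\<rfloor> = z k}"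
      using that by (auto simp: q_def G_def PiE_iff extensional_def fun_eq_iff)
    also have "\<dots> \<in> sets (cube_lebesgue d)"
    proof (rule sets.sets_Collect_finite_All)
      fix k assume k: "k \<in> {1..d}"
      note [measurable] = cube_coordinate_measurable[OF k]
      show "{x \<in> space (cube_lebesgue d). \<lfloor>real (Suc m) * x k\<rfloor> = z k} \<in> sets (cube_lebesgue d)"
        by measurable
    qed auto
    finally show ?thesis .
  qed
  have qm': "q \<in> measurable (cube_lebesgue d) (count_space G)"
  proof (subst measurable_count_space_eq_countable[OF G], safe)
    fix x show "q x \<in> G" by (rule qG)
  next
    fix z assume "z \<in> G"
    have "q -` {z} \<inter> space (cube_lebesgue d) = {x \<in> space (cube_lebesgue d). q x = z}" by auto
    with qm[OF \<open>z \<in> G\<close>] show "q -` {z} \<inter> space (cube_lebesgue d) \<in> sets (cube_lebesgue d)" by simp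
  qed
  have "(\<lambda>x. r (q x)) \<in> measurable (cube_lebesgue d) (count_space UNIV)"
    by (rule measurable_compose[OF qm']) simp
  then have "grid_round d m \<in> measurable (cube_lebesgue d) (count_space UNIV)"
    by (simp add: rq[symmetric])
  then show "grid_round d m \<in> measurable (cube_lebesgue d) (count_space (grid_round d m ` cube d))"
    by (subst measurable_count_space_eq_countable[OF c])
       (auto simp: space_cube_lebesgue dest: measurable_sets[of _ _ _ "{_}"])
qed

lemma eval_measurable_pair:
  "(\<lambda>p. fst p (snd p)) \<in> borel_measurable (C_borel d \<Otimes>\<^sub>M cube_lebesgue d)"
proof (rule borel_measurable_LIMSEQ_real)
  fix p assume "p \<in> space (C_borel d \<Otimes>\<^sub>M cube_lebesgue d)"
  then show "(\<lambda>m. fst p (grid_round d m (snd p))) \<longlonglongrightarrow> fst p (snd p)"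
    by (intro C_cube_grid_round_limit) (auto simp: space_pair_measure space_C_borel space_cube_lebesgue)
next
  fix m
  show "(\<lambda>p. fst p (grid_round d m (snd p))) \<in> borel_measurable (C_borel d \<Otimes>\<^sub>M cube_lebesgue d)"
  proof (rule measurable_compose_countable'[where I="grid_round d m ` cube d"
        and f="\<lambda>y p. fst p y" and g="\<lambda>p. grid_round d m (snd p)"])
    fix y assume "y \<in> grid_round d m ` cube d"
    then have "y \<in> cube d" using grid_round_in_cube by auto
    from cont_linear_functional_measurable[OF cont_linear_functional_eval[OF this]]
    show "(\<lambda>p. fst p y) \<in> borel_measurable (C_borel d \<Otimes>\<^sub>M cube_lebesgue d)"
      by (rule measurable_compose[OF measurable_fst])
  next
    show "(\<lambda>p. grid_round d m (snd p)) \<in> measurable (C_borel d \<Otimes>\<^sub>M cube_lebesgue d) (count_space (grid_round d m ` cube d))"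
      by (rule measurable_compose[OF measurable_snd grid_round_measurable])
  qed (rule grid_countable)
qed

lemma C_cube_measurable:
  assumes "f \<in> mspace (C_cube d)"
  shows "f \<in> borel_measurable (cube_lebesgue d)"
proof -
  have "Pair f \<in> measurable (cube_lebesgue d) (C_borel d \<Otimes>\<^sub>M cube_lebesgue d)"
    using assms by (intro measurable_Pair1') (simp add: space_C_borel)
  from measurable_compose[OF this eval_measurable_pair] show ?thesis by simp
qed

lemma C_cube_bounded:
  assumes "f \<in> mspace (C_cube d)"
  obtains B where "\<And>x. x \<in> cube d \<Longrightarrow> \<bar>f x\<bar> \<le> B"
proof -
  have 0: "(\<lambda>x\<in>cube d. 0) \<in> mspace (C_cube d)"
    unfolding C_cube_iff using topspace_cube_top[of d]
    by (auto intro!: continuous_map_eq[OF continuous_map_const[THEN iffD2]])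
  show ?thesis
    using that[of "mdist (C_cube d) f (\<lambda>x\<in>cube d. 0)"] C_cube_abs_diff_le[OF assms 0] by auto
qed

lemma bounded_integrable_cube:
  fixes g :: "(nat \<Rightarrow> real) \<Rightarrow> real"
  assumes "g \<in> borel_measurable (cube_lebesgue d)" "\<And>x. x \<in> cube d \<Longrightarrow> \<bar>g x\<bar> \<le> B"
  shows "integrable (cube_lebesgue d) g"
proof -
  interpret prob_space "cube_lebesgue d" by (rule prob_space_cube_lebesgue)
  show ?thesis using assms by (intro integrable_const_bound[where B=B]) (auto simp: space_cube_lebesgue)
qed

lemma C_cube_mult_integrable:
  assumes "f \<in> mspace (C_cube d)"
    and "g \<in> borel_measurable (cube_lebesgue d)" "\<And>x. x \<in> cube d \<Longrightarrow> \<bar>g x\<bar> \<le> B"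
  shows "integrable (cube_lebesgue d) (\<lambda>x. f x * g x)"
proof -
  obtain B' where "\<And>x. x \<in> cube d \<Longrightarrow> \<bar>f x\<bar> \<le> B'"
    using C_cube_bounded[OF assms(1)] by blast
  then show ?thesis
    using assms C_cube_measurable[OF assms(1)]
    by (intro bounded_integrable_cube[where B="B' * B"]) (auto simp: abs_mult intro!: mult_mono' order_trans[OF abs_ge_zero])
qed

lemma cont_linear_functional_integral:
  assumes g: "g \<in> borel_measurable (cube_lebesgue d)" "\<And>x. x \<in> cube d \<Longrightarrow> \<bar>g x\<bar> \<le> B"
  shows "cont_linear_functional d (\<lambda>f. \<integral>x. f x * g x \<partial>cube_lebesgue d)"
proof -
  interpret prob_space "cube_lebesgue d" by (rule prob_space_cube_lebesgue)
  have sp: "(\<integral>x. (\<lambda>x\<in>cube d. F x) x * g x \<partial>cube_lebesgue d) = (\<integral>x. F x * g x \<partial>cube_lebesgue d)" for F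
    by (intro Bochner_Integration.integral_cong) (auto simp: space_cube_lebesgue)
  show ?thesis
  proof (rule cont_linear_functional_if_bounded[where B="B"], goal_cases)
    case (1 u v)
    have "(\<integral>x. u x * g x \<partial>cube_lebesgue d) - (\<integral>x. v x * g x \<partial>cube_lebesgue d)
        = (\<integral>x. u x * g x - v x * g x \<partial>cube_lebesgue d)"
      using 1 C_cube_mult_integrable[OF _ g] by simp
    also have "\<bar>\<dots>\<bar> \<le> (\<integral>x. \<bar>u x * g x - v x * g x\<bar> \<partial>cube_lebesgue d)" by (rule integral_abs_bound)
    also have "\<dots> \<le> (\<integral>x. B * mdist (C_cube d) u v \<partial>cube_lebesgue d)"
    proof (intro integral_mono)
      fix x assume x: "x \<in> space (cube_lebesgue d)"
      have "\<bar>u x * g x - v x * g x\<bar> = \<bar>g x\<bar> * \<bar>u x - v x\<bar>"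
        by (simp add: abs_mult[symmetric] algebra_simps)
      also have "\<dots> \<le> B * mdist (C_cube d) u v"
        using x 1 g(2)[of x] C_cube_abs_diff_le[of u d v x]
        by (intro mult_mono) (auto simp: space_cube_lebesgue intro: order_trans[OF abs_ge_zero])
      finally show "\<bar>u x * g x - v x * g x\<bar> \<le> B * mdist (C_cube d) u v" .
    qed (use 1 C_cube_mult_integrable[OF _ g] in auto)
    finally show ?case using prob_space by simp
  next
    case (2 u v)
    have "(\<integral>x. (u x + v x) * g x \<partial>cube_lebesgue d) = (\<integral>x. u x * g x + v x * g x \<partial>cube_lebesgue d)"
      by (simp add: algebra_simps)
    then show ?case unfolding sp using 2 C_cube_mult_integrable[OF _ g] by simp
  next
    case (3 c u)
    show ?case unfolding sp by (simp add: mult.assoc)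
  qed
qed

section \<open>Orthonormal systems\<close>

abbreviation ip :: "'x measure \<Rightarrow> ('x \<Rightarrow> real) \<Rightarrow> ('x \<Rightarrow> real) \<Rightarrow> real" where
  "ip N u v \<equiv> (\<integral>w. u w * v w \<partial>N)"

lemma square_integrable_mult:
  fixes U V :: "'x \<Rightarrow> real"
  assumes [measurable]: "U \<in> borel_measurable N" "V \<in> borel_measurable N"
    and "integrable N (\<lambda>w. (U w)\<^sup>2)" "integrable N (\<lambda>w. (V w)\<^sup>2)"
  shows "integrable N (\<lambda>w. U w * V w)"
proof (rule Bochner_Integration.integrable_bound)
  show "integrable N (\<lambda>w. (U w)\<^sup>2 + (V w)\<^sup>2)" using assms by simp
  have "\<bar>U w * V w\<bar> \<le> (U w)\<^sup>2 + (V w)\<^sup>2" for w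
    using sum_squares_bound[of "U w" "V w"] sum_squares_bound[of "U w" "- V w"]
      zero_le_power2[of "U w"] zero_le_power2[of "V w"] by (auto simp: abs_if)
  then show "AE w in N. norm (U w * V w) \<le> norm ((U w)\<^sup>2 + (V w)\<^sup>2)" by auto
qed simp

lemma
  fixes u :: "'x \<Rightarrow> real" and e :: "'j \<Rightarrow> 'x \<Rightarrow> real"
  assumes J: "finite J"
    and um[measurable]: "u \<in> borel_measurable N" and ui: "integrable N (\<lambda>w. (u w)\<^sup>2)"
    and em: "\<And>j. j \<in> J \<Longrightarrow> e j \<in> borel_measurable N"
    and ei: "\<And>j. j \<in> J \<Longrightarrow> integrable N (\<lambda>w. (e j w)\<^sup>2)"
    and on: "\<And>i j. i \<in> J \<Longrightarrow> j \<in> J \<Longrightarrow> ip N (e i) (e j) = (if i = j then 1 else 0)"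
  shows orthonormal_residual:
      "(\<integral>w. (u w - (\<Sum>j\<in>J. ip N u (e j) * e j w))\<^sup>2 \<partial>N)
         = (\<integral>w. (u w)\<^sup>2 \<partial>N) - (\<Sum>j\<in>J. (ip N u (e j))\<^sup>2)"
    and Bessel_inequality:
      "(\<Sum>j\<in>J. (ip N u (e j))\<^sup>2) \<le> (\<integral>w. (u w)\<^sup>2 \<partial>N)"
proof -
  define c where "c j = ip N u (e j)" for j
  define P where "P w = (\<Sum>j\<in>J. c j * e j w)" for w
  have ue: "integrable N (\<lambda>w. u w * e j w)" if "j \<in> J" for j
    using square_integrable_mult[OF um em[OF that] ui ei[OF that]] .
  have ee: "integrable N (\<lambda>w. e i w * e j w)" if "i \<in> J" "j \<in> J" for i j
    using square_integrable_mult[OF em[OF that(1)] em[OF that(2)] ei[OF that(1)] ei[OF that(2)]] .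
  have uP: "integrable N (\<lambda>w. u w * P w)" "ip N u P = (\<Sum>j\<in>J. (c j)\<^sup>2)"
  proof -
    have eq: "u w * P w = (\<Sum>j\<in>J. c j * (u w * e j w))" for w
      by (simp add: P_def sum_distrib_left algebra_simps)
    show "integrable N (\<lambda>w. u w * P w)" unfolding eq using ue by auto
    have "ip N u P = (\<Sum>j\<in>J. c j * c j)"
      unfolding eq using ue by (subst Bochner_Integration.integral_sum) (auto simp: c_def)
    then show "ip N u P = (\<Sum>j\<in>J. (c j)\<^sup>2)" by (simp add: power2_eq_square)
  qed
  have PP: "integrable N (\<lambda>w. P w * P w)" "ip N P P = (\<Sum>j\<in>J. (c j)\<^sup>2)"
  proof -
    have eq: "P w * P w = (\<Sum>i\<in>J. \<Sum>j\<in>J. c i * c j * (e i w * e j w))" for w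
      by (simp add: P_def sum_product algebra_simps)
    show "integrable N (\<lambda>w. P w * P w)" unfolding eq using ee by auto
    have "ip N P P = (\<Sum>i\<in>J. \<Sum>j\<in>J. c i * c j * ip N (e i) (e j))"
      unfolding eq using ee
      by (subst Bochner_Integration.integral_sum; (intro sum.cong refl)?)
         (auto intro!: Bochner_Integration.integrable_sum simp: Bochner_Integration.integral_sum)
    also have "\<dots> = (\<Sum>i\<in>J. \<Sum>j\<in>J. if i = j then c i * c j else 0)"
      using on by (intro sum.cong refl) auto
    finally show "ip N P P = (\<Sum>j\<in>J. (c j)\<^sup>2)"
      using J by (simp add: power2_eq_square)
  qed
  have "(\<integral>w. (u w - P w)\<^sup>2 \<partial>N) = (\<integral>w. (u w)\<^sup>2 - 2 * (u w * P w) + P w * P w \<partial>N)"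
    by (intro Bochner_Integration.integral_cong) (auto simp: power2_eq_square algebra_simps)
  also have "\<dots> = (\<integral>w. (u w)\<^sup>2 \<partial>N) - (\<Sum>j\<in>J. (c j)\<^sup>2)"
    using ui uP PP by simp
  finally have eq: "(\<integral>w. (u w - P w)\<^sup>2 \<partial>N) = (\<integral>w. (u w)\<^sup>2 \<partial>N) - (\<Sum>j\<in>J. (c j)\<^sup>2)" .
  then show "(\<integral>w. (u w - (\<Sum>j\<in>J. ip N u (e j) * e j w))\<^sup>2 \<partial>N)
         = (\<integral>w. (u w)\<^sup>2 \<partial>N) - (\<Sum>j\<in>J. (ip N u (e j))\<^sup>2)"
    by (simp add: P_def c_def)
  have "0 \<le> (\<integral>w. (u w - P w)\<^sup>2 \<partial>N)" by simp
  then show "(\<Sum>j\<in>J. (ip N u (e j))\<^sup>2) \<le> (\<integral>w. (u w)\<^sup>2 \<partial>N)"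
    unfolding eq by (simp add: c_def)
qed

section \<open>Gaussian spaces: uncorrelated means independent\<close>

text \<open>
  After normalisation, the positive and the negative part of \<open>Z\<close> are densities under which \<open>X\<close> has
  the same characteristic function, hence the same law by Levy's uniqueness theorem.
\<close>
lemma (in prob_space) Fourier_zero_imp_zero_real:
  fixes Z X :: "'a \<Rightarrow> real"
  assumes Z: "integrable M Z" and X[measurable]: "X \<in> borel_measurable M"
    and zero: "\<And>t. (\<integral>w. complex_of_real (Z w) * iexp (t * X w) \<partial>M) = 0"
    and B: "B \<in> sets borel"
  shows "(\<integral>w. Z w * indicator B (X w) \<partial>M) = 0"
proof -
  have [measurable]: "Z \<in> borel_measurable M" using Z by auto
  define P where "P w = max 0 (Z w)" for w
  define N where "N w = max 0 (- Z w)" for w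
  have ZPN: "Z w = P w - N w" for w by (auto simp: P_def N_def)
  have [simp]: "0 \<le> P w" "0 \<le> N w" for w by (auto simp: P_def N_def)
  have iP: "integrable M P" and iN: "integrable M N"
    unfolding P_def N_def using Z by auto
  have [measurable]: "P \<in> borel_measurable M" "N \<in> borel_measurable M" using iP iN by auto
  have ci: "integrable M (\<lambda>w. complex_of_real (V w) * iexp (t * X w))"
    if "integrable M V" for V t
    using that by (intro Bochner_Integration.integrable_bound[OF that]) (auto simp: norm_mult)
  have eqt: "(\<integral>w. complex_of_real (P w) * iexp (t * X w) \<partial>M) = (\<integral>w. complex_of_real (N w) * iexp (t * X w) \<partial>M)" for t
    using zero[of t] ci[OF iP, of t] ci[OF iN, of t] by (simp add: ZPN left_diff_distrib)
  define c where "c = (\<integral>w. P w \<partial>M)"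
  have cN: "c = (\<integral>w. N w \<partial>M)"
    using eqt[of 0] unfolding c_def by simp
  have Bi: "integrable M (\<lambda>w. V w * indicator B (X w))" if "integrable M V" for V :: "'a \<Rightarrow> real"
    using that B by (intro Bochner_Integration.integrable_bound[OF that]) (auto simp: indicator_def)
  show ?thesis
  proof (cases "c = 0")
    case True
    then have "AE w in M. P w = 0" "AE w in M. N w = 0"
      using integral_nonneg_eq_0_iff_AE[OF iP] integral_nonneg_eq_0_iff_AE[OF iN] cN
      by (auto simp: c_def)
    then have "AE w in M. Z w * indicator B (X w) = 0" by eventually_elim (simp add: ZPN)
    then have "(\<integral>w. Z w * indicator B (X w) \<partial>M) = (\<integral>w. 0 \<partial>M)"
      using B by (intro integral_cong_AE) auto
    then show ?thesis by simp
  next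
    case False
    then have c: "c > 0" unfolding c_def using Bochner_Integration.integral_nonneg[where f=P and M=M] by (simp add: less_le)
    define D where "D V = distr (density M (\<lambda>w. ennreal (V w / c))) borel X" for V
    have rd: "real_distribution (D V)" and ch: "char (D V) t = (\<integral>w. complex_of_real (V w) * iexp (t * X w) \<partial>M) / c"
      and me: "measure (D V) B = (\<integral>w. V w * indicator B (X w) \<partial>M) / c"
      if V: "integrable M V" "\<And>w. 0 \<le> V w" "c = (\<integral>w. V w \<partial>M)" for V t
    proof -
      have [measurable]: "V \<in> borel_measurable M" using V by auto
      have "emeasure (density M (\<lambda>w. ennreal (V w / c))) (space M) = (\<integral>\<^sup>+w. ennreal (V w / c) \<partial>M)"
        by (subst emeasure_density) (auto intro!: nn_integral_cong)
      also have "\<dots> = ennreal (\<integral>w. V w / c \<partial>M)"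
        using V c by (intro nn_integral_eq_integral) auto
      finally have ps: "prob_space (density M (\<lambda>w. ennreal (V w / c)))"
        using V c by (intro prob_spaceI) simp
      then show "real_distribution (D V)"
        unfolding D_def by (intro prob_space.real_distribution_distr) auto
      show "char (D V) t = (\<integral>w. complex_of_real (V w) * iexp (t * X w) \<partial>M) / c"
        unfolding char_def D_def using V c
        by (subst integral_distr; (subst integral_density)?) (auto simp: scaleR_conv_of_real)
      have "emeasure (D V) B = (\<integral>\<^sup>+w. ennreal (V w / c) * indicator (X -` B \<inter> space M) w \<partial>M)"
        unfolding D_def using B by (simp add: emeasure_distr emeasure_density measurable_sets)
      also have "\<dots> = (\<integral>\<^sup>+w. ennreal (V w * indicator B (X w) / c) \<partial>M)"
        by (intro nn_integral_cong) (auto simp: indicator_def)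
      also have "\<dots> = ennreal (\<integral>w. V w * indicator B (X w) / c \<partial>M)"
        using V c Bi[OF V(1)] by (intro nn_integral_eq_integral) auto
      finally show "measure (D V) B = (\<integral>w. V w * indicator B (X w) \<partial>M) / c"
        using V c by (simp add: measure_def Bochner_Integration.integral_nonneg)
    qed
    have "D P = D N"
      using rd[OF iP] rd[OF iN] ch[OF iP] ch[OF iN] eqt cN
      by (intro Levy_uniqueness) (auto simp: c_def)
    then have "(\<integral>w. P w * indicator B (X w) \<partial>M) = (\<integral>w. N w * indicator B (X w) \<partial>M)"
      using me[OF iP] me[OF iN] cN c by (simp add: c_def)
    then show ?thesis using Bi[OF iP] Bi[OF iN] by (simp add: ZPN left_diff_distrib)
  qed
qed

lemma (in prob_space) Fourier_zero_imp_zero: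
  fixes Z :: "'a \<Rightarrow> complex" and X :: "'a \<Rightarrow> real"
  assumes Z: "integrable M Z" and X[measurable]: "X \<in> borel_measurable M"
    and zero: "\<And>t. (\<integral>w. Z w * iexp (t * X w) \<partial>M) = 0"
    and B: "B \<in> sets borel"
  shows "(\<integral>w. Z w * indicator B (X w) \<partial>M) = 0"
proof -
  have [measurable]: "Z \<in> borel_measurable M" using Z by auto
  have ci: "integrable M (\<lambda>w. V w * iexp (t * X w))"
    if "integrable M V" for V :: "'a \<Rightarrow> complex" and t
    using that by (intro Bochner_Integration.integrable_bound[OF that]) (auto simp: norm_mult)
  have ic: "integrable M (\<lambda>w. cnj (Z w))" using Z by simp
  have cz: "(\<integral>w. cnj (Z w) * iexp (t * X w) \<partial>M) = 0" for t
  proof -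
    have "cnj (\<integral>w. Z w * iexp (- t * X w) \<partial>M) = (\<integral>w. cnj (Z w * iexp (- t * X w)) \<partial>M)"
      by (rule Bochner_Integration.integral_cnj[symmetric])
    also have "\<dots> = (\<integral>w. cnj (Z w) * iexp (t * X w) \<partial>M)"
      by (intro Bochner_Integration.integral_cong) (auto simp: exp_cnj)
    finally have "(\<integral>w. cnj (Z w) * iexp (t * X w) \<partial>M) = cnj (\<integral>w. Z w * iexp (- t * X w) \<partial>M)" ..
    then show ?thesis using zero[of "-t"] by simp
  qed
  have "(\<integral>w. complex_of_real (Re (Z w)) * iexp (t * X w) \<partial>M) = 0" for t
  proof -
    have "complex_of_real (Re (Z w)) = (Z w + cnj (Z w)) / 2" for w
      by (simp add: complex_add_cnj)
    then show ?thesis using zero[of t] cz[of t] ci[OF Z, of t] ci[OF ic, of t]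
      by (simp add: add_divide_distrib distrib_right)
  qed
  then have re: "(\<integral>w. Re (Z w) * indicator B (X w) \<partial>M) = 0"
    using Z B by (intro Fourier_zero_imp_zero_real) auto
  have "(\<integral>w. complex_of_real (Im (Z w)) * iexp (t * X w) \<partial>M) = 0" for t
  proof -
    have im_eq: "complex_of_real (Im (Z w)) = (Z w - cnj (Z w)) * (- \<i> / 2)" for w
      by (simp add: complex_eq_iff)
    have "(\<integral>w. complex_of_real (Im (Z w)) * iexp (t * X w) \<partial>M)
       = (\<integral>w. (Z w * iexp (t * X w) - cnj (Z w) * iexp (t * X w)) * (- \<i> / 2) \<partial>M)"
      unfolding im_eq by (intro Bochner_Integration.integral_cong refl) (simp add: algebra_simps)
    also have "\<dots> = 0"
      using zero[of t] cz[of t] ci[OF Z, of t] ci[OF ic, of t] by simp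
    finally show ?thesis .
  qed
  then have im: "(\<integral>w. Im (Z w) * indicator B (X w) \<partial>M) = 0"
    using Z B by (intro Fourier_zero_imp_zero_real) auto
  have int: "integrable M (\<lambda>w. Z w * indicator B (X w))"
    using Z B by (intro Bochner_Integration.integrable_bound[OF Z]) (auto simp: indicator_def)
  show ?thesis
  proof (rule complex_eqI)
    have "Re (Z w * indicator B (X w)) = Re (Z w) * indicator B (X w)" for w by (simp add: indicator_def)
    then show "Re (\<integral>w. Z w * indicator B (X w) \<partial>M) = Re 0"
      using re integral_Re[OF int] by simp
    have "Im (Z w * indicator B (X w)) = Im (Z w) * indicator B (X w)" for w by (simp add: indicator_def)
    then show "Im (\<integral>w. Z w * indicator B (X w) \<partial>M) = Im 0"
      using im integral_Im[OF int] by simp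
  qed
qed

text \<open>
  A linear space of square integrable variables in which every member is centred normal. Normality
  enters only through the value of the characteristic function at \<open>1\<close>; closure under scaling supplies
  the other arguments.
\<close>
locale gaussian_space = prob_space M for M :: "'a measure" +
  fixes G :: "('a \<Rightarrow> real) set"
  assumes add_closed: "X \<in> G \<Longrightarrow> Y \<in> G \<Longrightarrow> (\<lambda>w. X w + Y w) \<in> G"
    and scale_closed: "X \<in> G \<Longrightarrow> (\<lambda>w. c * X w) \<in> G"
    and zero_mem: "(\<lambda>w. 0) \<in> G"
    and meas: "X \<in> G \<Longrightarrow> X \<in> borel_measurable M"
    and square_integrable: "X \<in> G \<Longrightarrow> integrable M (\<lambda>w. (X w)\<^sup>2)"
    and characteristic: "X \<in> G \<Longrightarrow> (\<integral>w. iexp (X w) \<partial>M) = complex_of_real (exp (- (\<integral>w. (X w)\<^sup>2 \<partial>M) / 2))"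
begin

lemma sum_closed: "(\<And>i. i \<in> I \<Longrightarrow> X i \<in> G) \<Longrightarrow> (\<lambda>w. \<Sum>i\<in>I. c i * X i w) \<in> G"
  by (induction I rule: infinite_finite_induct) (auto intro!: add_closed scale_closed zero_mem)

lemma diff_closed: "X \<in> G \<Longrightarrow> Y \<in> G \<Longrightarrow> (\<lambda>w. X w - Y w) \<in> G"
  using add_closed[OF _ scale_closed[of Y "-1"], of X] by simp

lemma mult_integrable: "X \<in> G \<Longrightarrow> Y \<in> G \<Longrightarrow> integrable M (\<lambda>w. X w * Y w)"
  by (intro square_integrable_mult meas square_integrable)

lemma ip_sum_right:
  assumes S: "S \<in> G" and X: "\<And>i. i \<in> I \<Longrightarrow> X i \<in> G"
  shows "ip M S (\<lambda>w. \<Sum>i\<in>I. c i * X i w) = (\<Sum>i\<in>I. c i * ip M S (X i))"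
proof -
  have "ip M S (\<lambda>w. \<Sum>i\<in>I. c i * X i w) = (\<integral>w. (\<Sum>i\<in>I. c i * (S w * X i w)) \<partial>M)"
    by (intro Bochner_Integration.integral_cong) (auto simp: sum_distrib_left algebra_simps)
  also have "\<dots> = (\<Sum>i\<in>I. c i * ip M S (X i))"
    using mult_integrable[OF S X] by (subst Bochner_Integration.integral_sum) auto
  finally show ?thesis .
qed

lemma integrable: "X \<in> G \<Longrightarrow> integrable M X"
  using square_integrable_mult[of X M "\<lambda>_. 1"] meas square_integrable by simp

text \<open>Perturb the characteristic function of \<open>X\<close> by \<open>s R\<close> and compare the terms linear in \<open>s\<close>.\<close>
lemma uncorrelated_iexp:
  assumes R: "R \<in> G" and X: "X \<in> G" and uncorr: "ip M R X = 0"
  shows "(\<integral>w. complex_of_real (R w) * iexp (X w) \<partial>M) = 0"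
proof -
  note [measurable] = meas[OF R] meas[OF X]
  define v where "v = (\<integral>w. (R w)\<^sup>2 \<partial>M)"
  define u where "u = (\<integral>w. (X w)\<^sup>2 \<partial>M)"
  define I where "I = (\<integral>w. complex_of_real (R w) * iexp (X w) \<partial>M)"
  have v0: "v \<ge> 0" and u0: "u \<ge> 0" by (auto simp: v_def u_def)
  have intI: "integrable M (\<lambda>w. complex_of_real (R w) * iexp (X w))"
    by (intro Bochner_Integration.integrable_bound[OF integrable[OF R]]) (auto simp: norm_mult)
  have le: "\<bar>s\<bar> * norm I \<le> s\<^sup>2 * v" for s
  proof -
    have mem: "(\<lambda>w. X w + s * R w) \<in> G" using R X by (intro add_closed scale_closed)
    have "(\<integral>w. (X w + s * R w)\<^sup>2 \<partial>M) = (\<integral>w. (X w)\<^sup>2 + 2 * s * (R w * X w) + s\<^sup>2 * (R w)\<^sup>2 \<partial>M)"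
      by (intro Bochner_Integration.integral_cong) (auto simp: power2_eq_square algebra_simps)
    also have "\<dots> = u + s\<^sup>2 * v"
      using square_integrable[OF X] square_integrable[OF R] mult_integrable[OF R X] uncorr
      by (simp add: u_def v_def)
    finally have ch: "(\<integral>w. iexp (X w + s * R w) \<partial>M) = complex_of_real (exp (- (u + s\<^sup>2 * v) / 2))"
      using characteristic[OF mem] by simp
    have chX: "(\<integral>w. iexp (X w) \<partial>M) = complex_of_real (exp (- u / 2))"
      using characteristic[OF X] by (simp add: u_def)
    have i1: "integrable M (\<lambda>w. iexp (Y w))" if [measurable]: "Y \<in> borel_measurable M" for Y
      by (intro integrable_const_bound[where B=1]) auto
    have eq: "(\<integral>w. iexp (X w) * (iexp (s * R w) - (1 + \<i> * (s * R w))) \<partial>M)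
        = complex_of_real (exp (- (u + s\<^sup>2 * v) / 2)) - complex_of_real (exp (- u / 2)) - \<i> * s * I"
    proof -
      have "(\<integral>w. iexp (X w) * (iexp (s * R w) - (1 + \<i> * (s * R w))) \<partial>M)
        = (\<integral>w. iexp (X w + s * R w) - iexp (X w) - \<i> * s * (complex_of_real (R w) * iexp (X w)) \<partial>M)"
        by (intro Bochner_Integration.integral_cong) (auto simp: algebra_simps exp_add)
      also have "\<dots> = (\<integral>w. iexp (X w + s * R w) \<partial>M) - (\<integral>w. iexp (X w) \<partial>M)
          - \<i> * s * (\<integral>w. complex_of_real (R w) * iexp (X w) \<partial>M)"
        using intI i1[of "\<lambda>w. X w + s * R w"] i1[of X] by simp
      finally show ?thesis using ch chX by (simp add: I_def)
    qed
    have pw: "norm (iexp (X w) * (iexp (s * R w) - (1 + \<i> * (s * R w)))) \<le> (s\<^sup>2 / 2) * (R w)\<^sup>2" for w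
    proof -
      have "norm (iexp (s * R w) - (1 + \<i> * (s * R w))) \<le> (s\<^sup>2 / 2) * (R w)\<^sup>2"
        using iexp_approx1[of "s * R w" 1]
        by (simp add: fact_numeral power2_eq_square abs_mult algebra_simps)
      then show ?thesis by (simp only: norm_mult norm_exp_i_times mult_1)
    qed
    have iR: "integrable M (\<lambda>w. (s\<^sup>2 / 2) * (R w)\<^sup>2)" using square_integrable[OF R] by simp
    have iD: "integrable M (\<lambda>w. iexp (X w) * (iexp (s * R w) - (1 + \<i> * (s * R w))))"
      by (rule Bochner_Integration.integrable_bound[OF iR]) (use pw in auto)
    have "norm (\<integral>w. iexp (X w) * (iexp (s * R w) - (1 + \<i> * (s * R w))) \<partial>M)
        \<le> (\<integral>w. norm (iexp (X w) * (iexp (s * R w) - (1 + \<i> * (s * R w)))) \<partial>M)"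
      by (rule integral_norm_bound)
    also have "\<dots> \<le> (\<integral>w. (s\<^sup>2 / 2) * (R w)\<^sup>2 \<partial>M)"
      using iD by (intro integral_mono iR pw integrable_norm)
    also have "\<dots> = s\<^sup>2 / 2 * v" by (simp add: v_def)
    finally have 1: "norm (complex_of_real (exp (- (u + s\<^sup>2 * v) / 2)) - complex_of_real (exp (- u / 2)) - \<i> * s * I) \<le> s\<^sup>2 / 2 * v"
      unfolding eq .
    have 2: "norm (complex_of_real (exp (- (u + s\<^sup>2 * v) / 2)) - complex_of_real (exp (- u / 2))) \<le> s\<^sup>2 / 2 * v"
    proof -
      have "exp (- (u + s\<^sup>2 * v) / 2) = exp (- u / 2) * exp (- (s\<^sup>2 / 2 * v))"
        by (simp add: exp_add[symmetric] add_divide_distrib diff_divide_distrib)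
      then have "exp (- u / 2) - exp (- (u + s\<^sup>2 * v) / 2) = exp (- u / 2) * (1 - exp (- (s\<^sup>2 / 2 * v)))"
        by (simp add: algebra_simps)
      also have "\<dots> \<le> 1 * (s\<^sup>2 / 2 * v)"
        using u0 v0 exp_ge_add_one_self[of "- (s\<^sup>2 / 2 * v)"] by (intro mult_mono) auto
      finally have "exp (- u / 2) - exp (- (u + s\<^sup>2 * v) / 2) \<le> s\<^sup>2 / 2 * v" by simp
      moreover have "exp (- (u + s\<^sup>2 * v) / 2) \<le> exp (- u / 2)" using v0 by simp
      ultimately show ?thesis by (simp only: of_real_diff[symmetric] norm_of_real)
    qed
    have "norm (\<i> * s * I) \<le> norm (complex_of_real (exp (- (u + s\<^sup>2 * v) / 2)) - complex_of_real (exp (- u / 2)))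
       + norm (complex_of_real (exp (- (u + s\<^sup>2 * v) / 2)) - complex_of_real (exp (- u / 2)) - \<i> * s * I)"
      using norm_triangle_ineq4[of "complex_of_real (exp (- (u + s\<^sup>2 * v) / 2)) - complex_of_real (exp (- u / 2))"
          "complex_of_real (exp (- (u + s\<^sup>2 * v) / 2)) - complex_of_real (exp (- u / 2)) - \<i> * s * I"] by simp
    then show ?thesis using 1 2 by (simp add: norm_mult)
  qed
  have "norm I \<le> 0"
  proof (rule field_le_epsilon)
    fix e :: real assume e: "e > 0"
    define s where "s = e / (v + 1)"
    have s: "s > 0" using e v0 by (simp add: s_def)
    from le[of s] have "s * norm I \<le> s * (s * v)" using s by (simp add: power2_eq_square mult.assoc)
    then have "norm I \<le> s * v" using s by simp
    also have "\<dots> \<le> e" using e v0 by (simp add: s_def field_simps)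
    finally show "norm I \<le> 0 + e" by simp
  qed
  then show ?thesis by (simp add: I_def)
qed

text \<open>
  A multivariate uniqueness theorem for characteristic functions, proved one coordinate at a time: the
  one-dimensional theorem turns the exponentials into indicators.
\<close>
lemma uncorrelated_box:
  assumes "finite S" and I: "finite I" "S \<subseteq> I" and R: "R \<in> G" and X: "\<And>i. i \<in> I \<Longrightarrow> X i \<in> G"
    and uncorr: "\<And>i. i \<in> I \<Longrightarrow> ip M R (X i) = 0"
    and B: "\<And>i. i \<in> I \<Longrightarrow> B i \<in> sets borel"
  shows "(\<integral>w. complex_of_real (R w) * (\<Prod>i\<in>S. indicator (B i) (X i w)) * iexp (\<Sum>i\<in>I - S. t i * X i w) \<partial>M) = 0"
  using assms(1,3)
proof (induction S arbitrary: t)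
  case empty
  have "ip M R (\<lambda>w. \<Sum>i\<in>I. t i * X i w) = 0" using ip_sum_right[OF R X, of I] uncorr by simp
  then show ?case using uncorrelated_iexp[OF R sum_closed[of I X t]] X by simp
next
  case (insert j S)
  then have j: "j \<in> I" and S: "S \<subseteq> I" by auto
  have Xm[measurable]: "X i \<in> borel_measurable M" if "i \<in> I" for i using meas[OF X[OF that]] .
  note [measurable] = meas[OF R]
  have Bm[measurable]: "(\<lambda>w. indicator (B i) (X i w) :: complex) \<in> borel_measurable M" if "i \<in> I" for i
    using B[OF that] Xm[OF that] by measurable
  define Z where "Z w = complex_of_real (R w) * (\<Prod>i\<in>S. indicator (B i) (X i w)) * iexp (\<Sum>i\<in>I - insert j S. t i * X i w)" for w
  have Zm: "Z \<in> borel_measurable M"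
    unfolding Z_def using S by (intro borel_measurable_times borel_measurable_prod borel_measurable_exp
        borel_measurable_of_real borel_measurable_sum borel_measurable_const Bm Xm meas[OF R]) auto
  have Zi: "integrable M Z"
  proof (rule Bochner_Integration.integrable_bound[OF integrable[OF R] Zm])
    have "norm (\<Prod>i\<in>S. indicator (B i) (X i w) :: complex) \<le> 1" for w
      unfolding prod_norm[symmetric] by (intro prod_le_1) (auto simp: indicator_def)
    then show "AE w in M. norm (Z w) \<le> norm (R w)"
      by (auto simp: Z_def norm_mult intro!: mult_left_le)
  qed
  have "(\<integral>w. Z w * iexp (s * X j w) \<partial>M) = 0" for s
  proof -
    have fin: "finite (I - insert j S)" and eqI: "I - S = insert j (I - insert j S)" using I j insert.hyps by auto
    have "(\<Sum>i\<in>I - S. (t(j := s)) i * X i w) = s * X j w + (\<Sum>i\<in>I - insert j S. t i * X i w)" for w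
      unfolding eqI using fin by (subst sum.insert) (auto intro!: sum.cong)
    then have "Z w * iexp (s * X j w) = complex_of_real (R w) * (\<Prod>i\<in>S. indicator (B i) (X i w))
         * iexp (\<Sum>i\<in>I - S. (t(j := s)) i * X i w)" for w
      by (simp add: Z_def distrib_left exp_add)
    then show ?thesis using insert.IH[of "t(j := s)"] S by simp
  qed
  then have "(\<integral>w. Z w * indicator (B j) (X j w) \<partial>M) = 0"
    by (intro Fourier_zero_imp_zero Zi Xm j B)
  moreover have "Z w * indicator (B j) (X j w) = complex_of_real (R w) * (\<Prod>i\<in>insert j S. indicator (B i) (X i w))
         * iexp (\<Sum>i\<in>I - insert j S. t i * X i w)" for w
    using insert.hyps by (simp add: Z_def)
  ultimately show ?case by simp
qed

text \<open>
  This is \<open>E[R | X] = 0\<close>. The positive and the negative part of \<open>R\<close>, taken as densities, push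
  forward to measures on the space of the vectors \<open>X\<close> that agree on boxes by \<open>uncorrelated_box\<close>.
\<close>
lemma uncorrelated_function:
  assumes I: "finite I" and R: "R \<in> G" and X: "\<And>i. i \<in> I \<Longrightarrow> X i \<in> G"
    and uncorr: "\<And>i. i \<in> I \<Longrightarrow> ip M R (X i) = 0"
    and g: "g \<in> borel_measurable (Pi\<^sub>M I (\<lambda>_. borel))"
    and gi: "integrable M (\<lambda>w. (g (\<lambda>i\<in>I. X i w))\<^sup>2)"
  shows "(\<integral>w. R w * g (\<lambda>i\<in>I. X i w) \<partial>M) = 0"
proof -
  have Xm: "X i \<in> borel_measurable M" if "i \<in> I" for i using meas[OF X[OF that]] .
  have XM[measurable]: "(\<lambda>w. \<lambda>i\<in>I. X i w) \<in> measurable M (Pi\<^sub>M I (\<lambda>_. borel))"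
    by (rule measurable_restrict) (rule Xm)
  note [measurable] = meas[OF R] g
  define P where "P w = max 0 (R w)" for w
  define N where "N w = max 0 (- R w)" for w
  have RPN: "R w = P w - N w" for w by (auto simp: P_def N_def)
  have [simp]: "0 \<le> P w" "0 \<le> N w" for w by (auto simp: P_def N_def)
  have iP: "integrable M P" and iN: "integrable M N"
    unfolding P_def N_def using integrable[OF R] by auto
  have [measurable]: "P \<in> borel_measurable M" "N \<in> borel_measurable M" using iP iN by auto
  define D where "D V = distr (density M (\<lambda>w. ennreal (V w))) (Pi\<^sub>M I (\<lambda>_. borel :: real measure)) (\<lambda>w. \<lambda>i\<in>I. X i w)" for V
  have box: "emeasure (D V) (Pi\<^sub>E I A) = ennreal (\<integral>w. V w * (\<Prod>i\<in>I. indicator (A i) (X i w)) \<partial>M)"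
    and boxi: "integrable M (\<lambda>w. V w * (\<Prod>i\<in>I. indicator (A i) (X i w)))"
    if V: "integrable M V" "\<And>w. 0 \<le> V w" and A: "\<And>i. i \<in> I \<Longrightarrow> A i \<in> sets borel" for V A
  proof -
    have [measurable]: "V \<in> borel_measurable M" using V by auto
    have Am: "(\<lambda>w. indicator (A i) (X i w) :: real) \<in> borel_measurable M" if "i \<in> I" for i
      using A[OF that] Xm[OF that] by measurable
    have pm: "(\<lambda>w. \<Prod>i\<in>I. indicator (A i) (X i w) :: real) \<in> borel_measurable M"
      by (intro borel_measurable_prod Am)
    have p1: "0 \<le> (\<Prod>i\<in>I. indicator (A i) (X i w) :: real)" "(\<Prod>i\<in>I. indicator (A i) (X i w) :: real) \<le> 1" for w
      by (auto intro!: prod_nonneg prod_le_1 simp: indicator_def)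
    show int: "integrable M (\<lambda>w. V w * (\<Prod>i\<in>I. indicator (A i) (X i w)))"
      using V pm p1 by (intro Bochner_Integration.integrable_bound[OF V(1)]) (auto simp: abs_mult intro!: mult_left_le)
    have PA: "Pi\<^sub>E I A \<in> sets (Pi\<^sub>M I (\<lambda>_. borel))" using A I by (intro sets_PiM_I_finite) auto
    have ind: "indicator ((\<lambda>w. \<lambda>i\<in>I. X i w) -` Pi\<^sub>E I A \<inter> space M) w = ennreal (\<Prod>i\<in>I. indicator (A i) (X i w))"
      if "w \<in> space M" for w
      using that I by (auto simp: indicator_def PiE_iff prod_ennreal[symmetric] intro!: prod_zero)
    have "emeasure (D V) (Pi\<^sub>E I A)
       = (\<integral>\<^sup>+w. ennreal (V w) * indicator ((\<lambda>w. \<lambda>i\<in>I. X i w) -` Pi\<^sub>E I A \<inter> space M) w \<partial>M)"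
      unfolding D_def using PA XM by (simp add: emeasure_distr emeasure_density measurable_sets)
    also have "\<dots> = (\<integral>\<^sup>+w. ennreal (V w * (\<Prod>i\<in>I. indicator (A i) (X i w))) \<partial>M)"
      using V p1 by (intro nn_integral_cong) (simp add: ind ennreal_mult)
    also have "\<dots> = ennreal (\<integral>w. V w * (\<Prod>i\<in>I. indicator (A i) (X i w)) \<partial>M)"
      using V p1 int by (intro nn_integral_eq_integral) auto
    finally show "emeasure (D V) (Pi\<^sub>E I A) = ennreal (\<integral>w. V w * (\<Prod>i\<in>I. indicator (A i) (X i w)) \<partial>M)" .
  qed
  have DD: "D P = D N"
  proof (rule measure_eqI_PiM_finite[OF I, of _ "\<lambda>_. borel :: real measure" _ "\<lambda>_::nat. Pi\<^sub>E I (\<lambda>_. UNIV)"])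
    fix A :: "_ \<Rightarrow> real set" assume A: "\<And>i. i \<in> I \<Longrightarrow> A i \<in> sets borel"
    have "complex_of_real (\<integral>w. R w * (\<Prod>i\<in>I. indicator (A i) (X i w)) \<partial>M) = 0"
      using uncorrelated_box[OF I I subset_refl R X uncorr A]
      by (simp add: of_real_prod of_real_indicator flip: integral_complex_of_real)
    then have "(\<integral>w. R w * (\<Prod>i\<in>I. indicator (A i) (X i w)) \<partial>M) = 0" by simp
    then have "(\<integral>w. P w * (\<Prod>i\<in>I. indicator (A i) (X i w)) \<partial>M) = (\<integral>w. N w * (\<Prod>i\<in>I. indicator (A i) (X i w)) \<partial>M)"
      using boxi[OF iP _ A] boxi[OF iN _ A] by (simp add: RPN left_diff_distrib)
    then show "emeasure (D P) (Pi\<^sub>E I A) = emeasure (D N) (Pi\<^sub>E I A)"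
      using box[OF iP _ A] box[OF iN _ A] by simp
  next
    show "emeasure (D P) (Pi\<^sub>E I (\<lambda>_. UNIV)) \<noteq> \<infinity>" using box[OF iP, of "\<lambda>_. UNIV"] by simp
  qed (use I in \<open>auto simp: D_def space_PiM intro!: prod_algebraI_finite\<close>)
  have gR: "integrable M (\<lambda>w. R w * g (\<lambda>i\<in>I. X i w))"
    using square_integrable[OF R] gi by (intro square_integrable_mult) auto
  have intD: "(\<integral>y. g y \<partial>D V) = (\<integral>w. V w * g (\<lambda>i\<in>I. X i w) \<partial>M)"
    if [measurable]: "V \<in> borel_measurable M" and "\<And>w. 0 \<le> V w" for V
    unfolding D_def using that by (subst integral_distr; (subst integral_density)?) auto
  have eq: "(\<integral>w. P w * g (\<lambda>i\<in>I. X i w) \<partial>M) = (\<integral>w. N w * g (\<lambda>i\<in>I. X i w) \<partial>M)"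
    using intD[of P] intD[of N] DD by simp
  have "integrable M (\<lambda>w. P w * g (\<lambda>i\<in>I. X i w))" "integrable M (\<lambda>w. N w * g (\<lambda>i\<in>I. X i w))"
    by (rule Bochner_Integration.integrable_bound[OF gR]; auto simp: P_def N_def abs_mult intro!: mult_right_mono)+
  then show ?thesis using eq by (simp add: RPN left_diff_distrib)
qed

text \<open>Gram--Schmidt in \<open>L\<^sub>2(M)\<close>: the last clause says that \<open>Q\<close> spans all \<open>X i\<close> up to null sets.\<close>
lemma orthonormal_basis:
  assumes "finite I" "\<And>i. i \<in> I \<Longrightarrow> X i \<in> G"
  shows "\<exists>Q. finite Q \<and> Q \<subseteq> G \<and> card Q \<le> card I \<and>
           (\<forall>p\<in>Q. \<forall>q\<in>Q. ip M p q = (if p = q then 1 else 0)) \<and>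
           (\<forall>R\<in>G. (\<forall>q\<in>Q. ip M R q = 0) \<longrightarrow> (\<forall>i\<in>I. ip M R (X i) = 0))"
  using assms
proof (induction I)
  case empty
  show ?case by (intro exI[of _ "{}"]) auto
next
  case (insert i I)
  then obtain Q where Q: "finite Q" "Q \<subseteq> G" "card Q \<le> card I"
      and on: "\<And>p q. p \<in> Q \<Longrightarrow> q \<in> Q \<Longrightarrow> ip M p q = (if p = q then 1 else 0)"
      and sp: "\<And>R i. R \<in> G \<Longrightarrow> (\<And>q. q \<in> Q \<Longrightarrow> ip M R q = 0) \<Longrightarrow> i \<in> I \<Longrightarrow> ip M R (X i) = 0"
    by (auto 0 3)
  define c where "c q = ip M (X i) q" for q
  define r where "r w = X i w - (\<Sum>q\<in>Q. c q * q w)" for w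
  have Xi: "X i \<in> G" using insert by auto
  have sG: "(\<lambda>w. \<Sum>q\<in>Q. c q * q w) \<in> G" using Q by (intro sum_closed) auto
  have rG: "r \<in> G" unfolding r_def using Xi sG by (intro diff_closed)
  have dist: "(\<integral>w. R w * (\<Sum>q\<in>Q. c q * q w) \<partial>M) = (\<Sum>q\<in>Q. c q * ip M R q)" if "R \<in> G" for R
    using ip_sum_right[OF that, of Q "\<lambda>q. q" c] Q by auto
  have rorth: "ip M p r = 0" if "p \<in> Q" for p
  proof -
    have pG: "p \<in> G" using that Q by auto
    have "ip M p r = ip M p (X i) - (\<integral>w. p w * (\<Sum>q\<in>Q. c q * q w) \<partial>M)"
      unfolding r_def using mult_integrable[OF pG Xi] mult_integrable[OF pG sG] by (simp add: right_diff_distrib)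
    also have "(\<integral>w. p w * (\<Sum>q\<in>Q. c q * q w) \<partial>M) = (\<Sum>q\<in>Q. if p = q then c q else 0)"
      unfolding dist[OF pG] using on that by (intro sum.cong) auto
    also have "\<dots> = c p" using Q that by simp
    finally show ?thesis by (simp add: c_def mult.commute)
  qed
  have recover: "ip M R (X i) = 0"
    if "R \<in> G" "\<And>q. q \<in> Q \<Longrightarrow> ip M R q = 0" "ip M R r = 0" for R
  proof -
    have "ip M R (X i) = (\<integral>w. R w * r w + R w * (\<Sum>q\<in>Q. c q * q w) \<partial>M)"
      by (intro Bochner_Integration.integral_cong) (auto simp: r_def algebra_simps)
    also have "\<dots> = 0"
      using mult_integrable[OF that(1) rG] mult_integrable[OF that(1) sG] that dist by simp
    finally show ?thesis .
  qed
  define v where "v = (\<integral>w. (r w)\<^sup>2 \<partial>M)"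
  show ?case
  proof (cases "v = 0")
    case True
    then have "AE w in M. (r w)\<^sup>2 = 0"
      using integral_nonneg_eq_0_iff_AE[OF square_integrable[OF rG]] by (simp add: v_def)
    then have r0: "AE w in M. r w = 0" by simp
    have "ip M R r = 0" if "R \<in> G" for R
    proof -
      note [measurable] = meas[OF rG] meas[OF that]
      have "ip M R r = (\<integral>w. 0 \<partial>M)"
        using r0 by (intro integral_cong_AE) (auto elim: AE_mp)
      then show ?thesis by simp
    qed
    then show ?thesis using Q on sp recover insert.hyps
      by (intro exI[of _ Q]) (auto simp: card_insert_if)
  next
    case False
    have v: "v > 0" using False by (simp add: v_def less_le)
    define p where "p w = (1 / sqrt v) * r w" for w
    have pG: "p \<in> G" unfolding p_def using rG by (intro scale_closed)
    have pp: "ip M p p = 1"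
    proof -
      have "ip M p p = (\<integral>w. (1 / v) * (r w)\<^sup>2 \<partial>M)"
        using v by (intro Bochner_Integration.integral_cong) (auto simp: p_def power2_eq_square field_simps)
      then show ?thesis using v by (simp add: v_def)
    qed
    have pq: "ip M q p = 0" if "q \<in> Q" for q
    proof -
      have "ip M q p = (\<integral>w. (1 / sqrt v) * (q w * r w) \<partial>M)"
        by (intro Bochner_Integration.integral_cong) (auto simp: p_def)
      then show ?thesis using rorth[OF that] by simp
    qed
    have pQ: "p \<notin> Q" using pq pp by auto
    have on': "ip M a b = (if a = b then 1 else 0)" if "a \<in> insert p Q" "b \<in> insert p Q" for a b
      using that on pq pp pQ by (auto simp: mult.commute)
    have sp': "ip M R (X k) = 0"
      if "R \<in> G" "\<forall>q\<in>insert p Q. ip M R q = 0" "k \<in> insert i I" for R k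
    proof -
      have "ip M R r = (\<integral>w. sqrt v * (R w * p w) \<partial>M)"
        using v by (intro Bochner_Integration.integral_cong) (auto simp: p_def)
      then have "ip M R r = 0" using that by simp
      then show ?thesis using that sp[of R k] recover[of R] by auto
    qed
    show ?thesis
      using Q pQ pG on' sp' insert.hyps by (intro exI[of _ "insert p Q"]) auto
  qed
qed

text \<open>
  Split \<open>\<xi>\<close> into its projection \<open>P\<close> onto the span of \<open>Q\<close> and a remainder \<open>R\<close>. The remainder is
  uncorrelated both with \<open>P\<close> and with \<open>g(X)\<close>, however nonlinear \<open>g\<close> is, so its variance survives in
  \<open>\<xi> - g(X) = R + (P - g(X))\<close>.
\<close>
lemma best_approximation:
  assumes I: "finite I" and X: "\<And>i. i \<in> I \<Longrightarrow> X i \<in> G"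
    and Q: "finite Q" "Q \<subseteq> G"
    and on: "\<And>p q. p \<in> Q \<Longrightarrow> q \<in> Q \<Longrightarrow> ip M p q = (if p = q then 1 else 0)"
    and sp: "\<And>R i. R \<in> G \<Longrightarrow> (\<And>q. q \<in> Q \<Longrightarrow> ip M R q = 0) \<Longrightarrow> i \<in> I \<Longrightarrow> ip M R (X i) = 0"
    and \<xi>: "\<xi> \<in> G" and g: "g \<in> borel_measurable (Pi\<^sub>M I (\<lambda>_. borel))"
  shows "ennreal ((\<integral>w. (\<xi> w)\<^sup>2 \<partial>M) - (\<Sum>q\<in>Q. (ip M \<xi> q)\<^sup>2))
           \<le> (\<integral>\<^sup>+w. ennreal ((\<xi> w - g (\<lambda>i\<in>I. X i w))\<^sup>2) \<partial>M)"
proof (cases "(\<integral>\<^sup>+w. ennreal ((\<xi> w - g (\<lambda>i\<in>I. X i w))\<^sup>2) \<partial>M) = \<infinity>")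
  case False
  define h where "h w = g (\<lambda>i\<in>I. X i w)" for w
  have XM: "(\<lambda>w. \<lambda>i\<in>I. X i w) \<in> measurable M (Pi\<^sub>M I (\<lambda>_. borel))"
    by (rule measurable_restrict) (rule meas[OF X])
  have hm[measurable]: "h \<in> borel_measurable M" unfolding h_def using XM g by (rule measurable_compose)
  note [measurable] = meas[OF \<xi>]
  \<comment> \<open>A finite error forces \<open>g(X)\<close> to be square integrable, as \<open>uncorrelated_function\<close> requires.\<close>
  have di: "integrable M (\<lambda>w. (\<xi> w - h w)\<^sup>2)"
    using False unfolding h_def[symmetric] by (intro integrableI_nonneg) (auto simp: less_top)
  have hi: "integrable M (\<lambda>w. (h w)\<^sup>2)"
  proof (rule Bochner_Integration.integrable_bound)
    show "integrable M (\<lambda>w. 2 * (\<xi> w)\<^sup>2 + 2 * (\<xi> w - h w)\<^sup>2)" using di square_integrable[OF \<xi>] by simp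
    have "(h w)\<^sup>2 \<le> 2 * (\<xi> w)\<^sup>2 + 2 * (\<xi> w - h w)\<^sup>2" for w
      using zero_le_power2[of "2 * \<xi> w - h w"] by (simp add: power2_eq_square algebra_simps)
    then show "AE w in M. norm ((h w)\<^sup>2) \<le> norm (2 * (\<xi> w)\<^sup>2 + 2 * (\<xi> w - h w)\<^sup>2)" by auto
  qed simp
  define c where "c q = ip M \<xi> q" for q
  define P where "P w = (\<Sum>q\<in>Q. c q * q w)" for w
  define R where "R w = \<xi> w - P w" for w
  have PG: "P \<in> G" unfolding P_def using Q by (intro sum_closed) auto
  have RG: "R \<in> G" unfolding R_def using \<xi> PG by (rule diff_closed)
  note [measurable] = meas[OF PG] meas[OF RG]
  have dist: "ip M S P = (\<Sum>q\<in>Q. c q * ip M S q)" if "S \<in> G" for S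
    unfolding P_def using ip_sum_right[OF that, of Q "\<lambda>q. q" c] Q by auto
  have Rq: "ip M R q = 0" if "q \<in> Q" for q
  proof -
    have qG: "q \<in> G" using that Q by auto
    have "ip M R q = (\<integral>w. q w * \<xi> w - q w * P w \<partial>M)"
      by (intro Bochner_Integration.integral_cong) (auto simp: R_def algebra_simps)
    also have "\<dots> = ip M q \<xi> - ip M q P"
      using mult_integrable[OF qG \<xi>] mult_integrable[OF qG PG] by simp
    also have "ip M q P = (\<Sum>p\<in>Q. if q = p then c p else 0)"
      unfolding dist[OF qG] using on that by (intro sum.cong) auto
    also have "\<dots> = c q" using Q that by simp
    finally show ?thesis by (simp add: c_def mult.commute)
  qed
  have RP: "ip M R P = 0" using dist[OF RG] Rq by simp
  have Rh: "ip M R h = 0"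
    unfolding h_def by (intro uncorrelated_function I RG X g sp Rq hi[unfolded h_def])
  have iRh: "integrable M (\<lambda>w. R w * h w)" using square_integrable[OF RG] hi by (intro square_integrable_mult) auto
  have iPh: "integrable M (\<lambda>w. P w * h w)" using square_integrable[OF PG] hi by (intro square_integrable_mult) auto
  have R2: "(\<integral>w. (R w)\<^sup>2 \<partial>M) = (\<integral>w. (\<xi> w)\<^sup>2 \<partial>M) - (\<Sum>q\<in>Q. (c q)\<^sup>2)"
    using orthonormal_residual[of Q \<xi> M "\<lambda>q. q"] Q \<xi> on meas square_integrable
    unfolding R_def P_def c_def by (auto simp: subset_iff)
  have "(\<integral>w. (R w)\<^sup>2 \<partial>M) \<le> (\<integral>w. (R w)\<^sup>2 + (P w - h w)\<^sup>2 \<partial>M)"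
  proof (rule integral_mono)
    show "integrable M (\<lambda>w. (R w)\<^sup>2 + (P w - h w)\<^sup>2)"
      using square_integrable[OF RG] square_integrable[OF PG] hi iPh by (simp add: power2_diff mult.assoc)
  qed (use square_integrable[OF RG] in auto)
  also have "\<dots> = (\<integral>w. (\<xi> w - h w)\<^sup>2 - 2 * (R w * P w) + 2 * (R w * h w) \<partial>M)"
    by (intro Bochner_Integration.integral_cong) (auto simp: R_def power2_eq_square algebra_simps)
  also have "\<dots> = (\<integral>w. (\<xi> w - h w)\<^sup>2 \<partial>M)"
    using di mult_integrable[OF RG PG] iRh RP Rh by simp
  finally have "(\<integral>w. (\<xi> w)\<^sup>2 \<partial>M) - (\<Sum>q\<in>Q. (c q)\<^sup>2) \<le> (\<integral>w. (\<xi> w - h w)\<^sup>2 \<partial>M)" using R2 by simp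
  then show ?thesis using nn_integral_eq_integral[OF di] by (simp add: c_def h_def ennreal_leI)
qed simp

end

section \<open>Average case errors of a Gaussian measure with known eigenpairs\<close>

lemma centered_normal_eq_distr:
  assumes "\<sigma> \<ge> 0"
  shows "centered_normal \<sigma> = distr std_normal_distribution borel (\<lambda>x. \<sigma> * x)"
proof (cases "\<sigma> = 0")
  case True
  interpret N: prob_space std_normal_distribution by (rule prob_space_normal_density) simp
  show ?thesis using True by (simp add: centered_normal_def N.distr_const)
next
  case False
  interpret N: prob_space std_normal_distribution by (rule prob_space_normal_density) simp
  have "distr std_normal_distribution lborel (\<lambda>x. x) = std_normal_distribution"
    by (intro distr_id2) simp
  then have "distributed std_normal_distribution lborel (\<lambda>x. x) (\<lambda>x. ennreal (std_normal_density x))"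
    unfolding distributed_def by simp
  from N.normal_density_affine[OF this, of \<sigma> 0] False
  have "distributed std_normal_distribution lborel (\<lambda>x. \<sigma> * x) (\<lambda>x. ennreal (normal_density 0 \<bar>\<sigma>\<bar> x))" by simp
  then have "distr std_normal_distribution lborel (\<lambda>x. \<sigma> * x) = density lborel (\<lambda>x. ennreal (normal_density 0 \<sigma> x))"
    using assms by (simp add: distributed_def)
  moreover have "distr std_normal_distribution lborel (\<lambda>x. \<sigma> * x) = distr std_normal_distribution borel (\<lambda>x. \<sigma> * x)"
    by (intro distr_cong) auto
  ultimately show ?thesis using False by (simp add: centered_normal_def)
qed

lemma centered_normal_moments:
  assumes "\<sigma> \<ge> 0"
  shows "integrable (centered_normal \<sigma>) (\<lambda>x. x\<^sup>2)"
    and "(\<integral>x. x\<^sup>2 \<partial>centered_normal \<sigma>) = \<sigma>\<^sup>2"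
    and "(\<integral>x. iexp x \<partial>centered_normal \<sigma>) = complex_of_real (exp (- \<sigma>\<^sup>2 / 2))"
proof -
  have i: "integrable std_normal_distribution (\<lambda>x. x\<^sup>2)"
    using integrable_std_normal_distribution_moment[of 2] by simp
  show "integrable (centered_normal \<sigma>) (\<lambda>x. x\<^sup>2)"
    unfolding centered_normal_eq_distr[OF assms] using i by (subst integrable_distr_eq) (auto simp: power_mult_distrib)
  have "(\<integral>x. x\<^sup>2 \<partial>std_normal_distribution) = 1"
    using std_normal_distribution_even_moments(1)[of 1] by (simp add: fact_numeral)
  then show "(\<integral>x. x\<^sup>2 \<partial>centered_normal \<sigma>) = \<sigma>\<^sup>2"
    unfolding centered_normal_eq_distr[OF assms] by (subst integral_distr) (auto simp: power_mult_distrib)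
  show "(\<integral>x. iexp x \<partial>centered_normal \<sigma>) = complex_of_real (exp (- \<sigma>\<^sup>2 / 2))"
    unfolding centered_normal_eq_distr[OF assms]
    using fun_cong[OF char_std_normal_distribution, of \<sigma>]
    by (subst integral_distr) (auto simp: char_def)
qed

lemma centered_gaussian_measure_gaussian_space:
  assumes "centered_gaussian_measure d M"
  shows "gaussian_space M {L. cont_linear_functional d L}"
proof -
  interpret prob_space M using assms by (simp add: centered_gaussian_measure_def)
  have sets: "sets M = sets (C_borel d)" using assms by (simp add: centered_gaussian_measure_def)
  have meas: "L \<in> borel_measurable M" if "cont_linear_functional d L" for L
    using cont_linear_functional_measurable[OF that] measurable_cong_sets[OF sets refl] by blast
  show ?thesis
  proof (unfold_locales, goal_cases)
    case (5 L)
    then have m[measurable]: "L \<in> borel_measurable M" using meas by simp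
    obtain \<sigma> where "\<sigma> \<ge> 0" "distr M borel L = centered_normal \<sigma>"
      using 5 assms by (auto simp: centered_gaussian_measure_def)
    then have "integrable (distr M borel L) (\<lambda>x. x\<^sup>2)" using centered_normal_moments(1)[of \<sigma>] by simp
    then show ?case by (subst (asm) integrable_distr_eq) auto
  next
    case (6 L)
    then have m[measurable]: "L \<in> borel_measurable M" using meas by simp
    obtain \<sigma> where s: "\<sigma> \<ge> 0" "distr M borel L = centered_normal \<sigma>"
      using 6 assms by (auto simp: centered_gaussian_measure_def)
    have "(\<integral>w. iexp (L w) \<partial>M) = (\<integral>x. iexp x \<partial>distr M borel L)"
      by (subst integral_distr) auto
    moreover have "(\<integral>w. (L w)\<^sup>2 \<partial>M) = (\<integral>x. x\<^sup>2 \<partial>distr M borel L)"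
      by (subst integral_distr) auto
    ultimately show ?case using centered_normal_moments[OF s(1)] s by simp
  qed (auto intro: cont_linear_functional_add cont_linear_functional_scale cont_linear_functional_zero meas)
qed

lemma ennreal_add_le: "ennreal (x + y) \<le> ennreal x + ennreal y"
  by (cases "0 \<le> x"; cases "0 \<le> y")
     (auto simp: ennreal_plus[symmetric] ennreal_neg intro!: ennreal_leI simp del: ennreal_plus)

lemma L2_norm_square: "(L2_norm d g)\<^sup>2 = (\<integral>x. (g x)\<^sup>2 \<partial>cube_lebesgue d)"
  by (simp add: L2_norm_def)

lemma L2_diff:
  assumes "u \<in> L2 d" "v \<in> L2 d"
  shows "(\<lambda>x. u x - v x) \<in> L2 d"
proof -
  have "integrable (cube_lebesgue d) (\<lambda>x. u x * v x)"
    using assms by (intro square_integrable_mult) (auto simp: L2_def)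
  then show ?thesis using assms by (auto simp: L2_def power2_diff mult.assoc)
qed

lemma bounded_L2:
  assumes "g \<in> borel_measurable (cube_lebesgue d)" "\<And>x. x \<in> cube d \<Longrightarrow> \<bar>g x\<bar> \<le> B"
  shows "g \<in> L2 d"
proof -
  have "\<bar>(g x)\<^sup>2\<bar> \<le> B\<^sup>2" if "x \<in> cube d" for x
    using power_mono[OF assms(2)[OF that], of 2] by simp
  then have "integrable (cube_lebesgue d) (\<lambda>x. (g x)\<^sup>2)"
    using assms(1) by (intro bounded_integrable_cube) auto
  then show ?thesis using assms(1) by (simp add: L2_def)
qed

lemma C_cube_L2: "f \<in> mspace (C_cube d) \<Longrightarrow> f \<in> L2 d"
  by (metis C_cube_bounded C_cube_measurable bounded_L2)

lemma sets_L2_borel: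
  "sets (L2_borel d) = sigma_sets (L2 d)
     {U. U \<subseteq> L2 d \<and> (\<forall>g\<in>U. \<exists>r>0. \<forall>h\<in>L2 d. L2_norm d (\<lambda>x. h x - g x) < r \<longrightarrow> h \<in> U)}"
  unfolding L2_borel_def by (rule sets_measure_of) auto

lemma space_L2_borel: "space (L2_borel d) = L2 d"
  by (simp add: L2_borel_def space_measure_of_conv)

text \<open>
  The partial sums converge uniformly on the space, as in the Weierstrass M-test, so they may be
  integrated termwise along the net of finite subsets of \<open>F\<close>, whatever its cardinality.
\<close>
lemma (in prob_space) has_sum_integral_dominated:
  fixes g :: "'h \<Rightarrow> 'a \<Rightarrow> real"
  assumes g: "\<And>h. h \<in> F \<Longrightarrow> g h \<in> borel_measurable M" and s[measurable]: "s \<in> borel_measurable M"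
    and bound: "\<And>h x. h \<in> F \<Longrightarrow> x \<in> space M \<Longrightarrow> \<bar>g h x\<bar> \<le> m h" and m: "m summable_on F"
    and sum: "\<And>x. x \<in> space M \<Longrightarrow> ((\<lambda>h. g h x) has_sum s x) F"
  shows "((\<lambda>h. \<integral>x. g h x \<partial>M) has_sum (\<integral>x. s x \<partial>M)) F"
proof -
  have near: "\<bar>s x - (\<Sum>h\<in>H. g h x)\<bar> \<le> infsum m F - sum m H"
    if H: "finite H" "H \<subseteq> F" and x: "x \<in> space M" for H x
  proof -
    have D: "((\<lambda>h. g h x) has_sum (s x - (\<Sum>h\<in>H. g h x))) (F - H)"
      by (intro has_sum_Diff sum x has_sum_finite H)
    have mH: "(m has_sum (infsum m F - sum m H)) (F - H)"
      using m by (intro has_sum_Diff has_sum_finite H) simp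
    have b: "g h x \<le> m h \<and> - g h x \<le> m h" if "h \<in> F - H" for h
      using bound[of h x] that x by (simp add: abs_le_iff)
    have "s x - (\<Sum>h\<in>H. g h x) \<le> infsum m F - sum m H"
      using b by (intro has_sum_mono[OF D mH]) auto
    moreover have "- (s x - (\<Sum>h\<in>H. g h x)) \<le> infsum m F - sum m H"
      using b by (intro has_sum_mono[OF has_sum_uminusI[OF D] mH]) auto
    ultimately show ?thesis by linarith
  qed
  have gi: "integrable M (g h)" if "h \<in> F" for h
    using g[OF that] bound[OF that] by (intro integrable_const_bound[where B="m h"]) auto
  have si: "integrable M s"
    using near[of "{}"] by (intro integrable_const_bound[where B="infsum m F"]) auto
  have near_int: "norm ((\<Sum>h\<in>H. \<integral>x. g h x \<partial>M) - (\<integral>x. s x \<partial>M)) \<le> infsum m F - sum m H"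
    if H: "finite H" "H \<subseteq> F" for H
  proof -
    have gH: "integrable M (\<lambda>x. \<Sum>h\<in>H. g h x)" using gi H by auto
    have "(\<Sum>h\<in>H. \<integral>x. g h x \<partial>M) = (\<integral>x. (\<Sum>h\<in>H. g h x) \<partial>M)"
      using gi H by (subst Bochner_Integration.integral_sum) auto
    then have "norm ((\<Sum>h\<in>H. \<integral>x. g h x \<partial>M) - (\<integral>x. s x \<partial>M)) = \<bar>\<integral>x. s x - (\<Sum>h\<in>H. g h x) \<partial>M\<bar>"
      using gH si by simp
    also have "\<dots> \<le> (\<integral>x. \<bar>s x - (\<Sum>h\<in>H. g h x)\<bar> \<partial>M)" by (rule integral_abs_bound)
    also have "\<dots> \<le> (\<integral>x. infsum m F - sum m H \<partial>M)"
      using near[OF H] gH si by (intro integral_mono) auto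
    finally show ?thesis by (simp add: prob_space)
  qed
  have "((\<lambda>H. (\<Sum>h\<in>H. \<integral>x. g h x \<partial>M) - (\<integral>x. s x \<partial>M)) \<longlongrightarrow> 0) (finite_subsets_at_top F)"
  proof (rule Lim_null_comparison)
    show "\<forall>\<^sub>F H in finite_subsets_at_top F. norm ((\<Sum>h\<in>H. \<integral>x. g h x \<partial>M) - (\<integral>x. s x \<partial>M)) \<le> infsum m F - sum m H"
      using near_int by (rule eventually_finite_subsets_at_top_weakI)
    have "(sum m \<longlongrightarrow> infsum m F) (finite_subsets_at_top F)"
      using m by (simp add: has_sum_def[symmetric])
    from tendsto_diff[OF tendsto_const this, of "infsum m F"]
    show "((\<lambda>H. infsum m F - sum m H) \<longlongrightarrow> 0) (finite_subsets_at_top F)" by simp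
  qed
  then show ?thesis by (simp add: has_sum_def LIM_zero_iff)
qed

text \<open>
  A Gaussian measure whose covariance kernel has a Mercer expansion in an orthonormal system that is
  bounded uniformly by \<open>B\<close>. The \<open>\<psi> h\<close> are then eigenfunctions of the covariance operator on \<open>L\<^sub>2\<close> with
  eigenvalues \<open>lam h\<close>, and the coefficients \<open>\<xi> h\<close> below are uncorrelated with variances \<open>lam h\<close>.
\<close>
locale eigen_gaussian =
  fixes d :: nat and M :: "((nat \<Rightarrow> real) \<Rightarrow> real) measure"
    and F :: "'h set" and lam :: "'h \<Rightarrow> real" and \<psi> :: "'h \<Rightarrow> (nat \<Rightarrow> real) \<Rightarrow> real" and B :: real
  assumes gauss: "centered_gaussian_measure d M"
    and psi_meas: "h \<in> F \<Longrightarrow> \<psi> h \<in> borel_measurable (cube_lebesgue d)"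
    and psi_bound: "h \<in> F \<Longrightarrow> x \<in> cube d \<Longrightarrow> \<bar>\<psi> h x\<bar> \<le> B"
    and orthonormal: "h \<in> F \<Longrightarrow> k \<in> F \<Longrightarrow>
          (ip (cube_lebesgue d) (\<psi> h) (\<psi> k)) = (if h = k then 1 else 0)"
    and lam_pos: "h \<in> F \<Longrightarrow> 0 < lam h"
    and lam_summable: "lam summable_on F"
    and cov: "x \<in> cube d \<Longrightarrow> y \<in> cube d \<Longrightarrow>
          (\<integral>f. f x * f y \<partial>M) = (\<Sum>\<^sub>\<infinity>h\<in>F. lam h * (\<psi> h x * \<psi> h y))"
begin

sublocale gs: gaussian_space M "{L. cont_linear_functional d L}"
  by (rule centered_gaussian_measure_gaussian_space[OF gauss])

sublocale Q: prob_space "cube_lebesgue d" by (rule prob_space_cube_lebesgue)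

sublocale MQ: pair_sigma_finite M "cube_lebesgue d" ..

lemma sets_M: "sets M = sets (C_borel d)"
  using gauss by (simp add: centered_gaussian_measure_def)

lemma space_M: "space M = mspace (C_cube d)"
  using sets_eq_imp_space_eq[OF sets_M] by (simp add: space_C_borel)

lemma eval_pair: "(\<lambda>p. fst p (snd p)) \<in> borel_measurable (M \<Otimes>\<^sub>M cube_lebesgue d)"
  using eval_measurable_pair[of d] measurable_cong_sets[OF sets_pair_measure_cong[OF sets_M refl] refl] by blast

definition \<xi> :: "'h \<Rightarrow> ((nat \<Rightarrow> real) \<Rightarrow> real) \<Rightarrow> real" where
  "\<xi> h f = ip (cube_lebesgue d) f (\<psi> h)"

lemma xi_functional: "h \<in> F \<Longrightarrow> cont_linear_functional d (\<xi> h)"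
  unfolding \<xi>_def using psi_meas psi_bound by (intro cont_linear_functional_integral) auto

lemma psi_L2: "h \<in> F \<Longrightarrow> \<psi> h \<in> L2 d"
  using psi_meas psi_bound by (intro bounded_L2)

lemma cov_has_sum:
  assumes x: "x \<in> cube d" and y: "y \<in> cube d"
  shows "((\<lambda>h. lam h * (\<psi> h x * \<psi> h y)) has_sum (\<integral>f. f x * f y \<partial>M)) F"
    and "h \<in> F \<Longrightarrow> \<bar>lam h * (\<psi> h x * \<psi> h y)\<bar> \<le> B\<^sup>2 * lam h"
proof -
  show le: "\<bar>lam h * (\<psi> h x * \<psi> h y)\<bar> \<le> B\<^sup>2 * lam h" if "h \<in> F" for h
  proof -
    have "\<bar>\<psi> h x * \<psi> h y\<bar> \<le> B * B"
      unfolding abs_mult using psi_bound[OF that] x y by (intro mult_mono) (auto intro: order_trans[OF abs_ge_zero])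
    then show ?thesis using lam_pos[OF that] by (simp add: abs_mult power2_eq_square mult.commute)
  qed
  have "(\<lambda>h. norm (lam h * (\<psi> h x * \<psi> h y))) summable_on F"
    using le by (intro summable_on_comparison_test[OF summable_on_cmult_right[OF lam_summable]]) auto
  then have "(\<lambda>h. lam h * (\<psi> h x * \<psi> h y)) summable_on F" by (rule abs_summable_summable)
  then show "((\<lambda>h. lam h * (\<psi> h x * \<psi> h y)) has_sum (\<integral>f. f x * f y \<partial>M)) F"
    unfolding cov[OF x y] by (rule has_sum_infsum)
qed

lemma eval_variance_bounded: "x \<in> cube d \<Longrightarrow> (\<integral>f. (f x)\<^sup>2 \<partial>M) \<le> B\<^sup>2 * (\<Sum>\<^sub>\<infinity>h\<in>F. lam h)"
  using has_sum_mono[OF cov_has_sum(1)[of x x] has_sum_cmult_right[OF has_sum_infsum[OF lam_summable], of "B\<^sup>2"]]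
    cov_has_sum(2)[of x x] by (force simp: power2_eq_square abs_le_iff)

lemma eval_square_integrable: "integrable (M \<Otimes>\<^sub>M cube_lebesgue d) (\<lambda>p. (fst p (snd p))\<^sup>2)"
proof (rule integrableI_nonneg)
  let ?P = "M \<Otimes>\<^sub>M cube_lebesgue d"
  note [measurable] = eval_pair
  have "(\<integral>\<^sup>+p. ennreal ((fst p (snd p))\<^sup>2) \<partial>?P) = (\<integral>\<^sup>+y. \<integral>\<^sup>+f. ennreal ((f y)\<^sup>2) \<partial>M \<partial>cube_lebesgue d)"
    by (subst MQ.nn_integral_snd[symmetric]) auto
  also have "\<dots> \<le> (\<integral>\<^sup>+y. ennreal (B\<^sup>2 * (\<Sum>\<^sub>\<infinity>h\<in>F. lam h)) \<partial>cube_lebesgue d)"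
  proof (intro nn_integral_mono)
    fix y assume y: "y \<in> space (cube_lebesgue d)"
    then have "(\<integral>\<^sup>+f. ennreal ((f y)\<^sup>2) \<partial>M) = ennreal (\<integral>f. (f y)\<^sup>2 \<partial>M)"
      using gs.square_integrable cont_linear_functional_eval
      by (intro nn_integral_eq_integral) (auto simp: space_cube_lebesgue)
    then show "(\<integral>\<^sup>+f. ennreal ((f y)\<^sup>2) \<partial>M) \<le> ennreal (B\<^sup>2 * (\<Sum>\<^sub>\<infinity>h\<in>F. lam h))"
      using eval_variance_bounded y by (auto simp: space_cube_lebesgue intro: ennreal_leI)
  qed
  also have "\<dots> < \<infinity>" by (simp add: Q.emeasure_space_1)
  finally show "(\<integral>\<^sup>+p. ennreal ((fst p (snd p))\<^sup>2) \<partial>?P) < \<infinity>" .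
qed (use eval_pair in auto)

lemma covariance_measurable:
  assumes V: "cont_linear_functional d V"
  shows "(\<lambda>y. \<integral>f. V f * f y \<partial>M) \<in> borel_measurable (cube_lebesgue d)"
proof -
  have m: "(\<lambda>p. V (snd p) * snd p (fst p)) \<in> borel_measurable (cube_lebesgue d \<Otimes>\<^sub>M M)"
  proof (intro borel_measurable_times)
    show "(\<lambda>p. V (snd p)) \<in> borel_measurable (cube_lebesgue d \<Otimes>\<^sub>M M)"
      using V gs.meas by (intro measurable_compose[OF measurable_snd]) auto
    have "(\<lambda>p. (snd p, fst p)) \<in> measurable (cube_lebesgue d \<Otimes>\<^sub>M M) (M \<Otimes>\<^sub>M cube_lebesgue d)" by simp
    from measurable_compose[OF this eval_pair]
    show "(\<lambda>p. snd p (fst p)) \<in> borel_measurable (cube_lebesgue d \<Otimes>\<^sub>M M)" by simp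
  qed
  show ?thesis
    by (rule gs.borel_measurable_lebesgue_integral) (use m in \<open>simp add: case_prod_unfold\<close>)
qed

text \<open>
  Fubini's theorem applies because \<open>V f\<close> and \<open>f y\<close> are square integrable on the product of \<open>M\<close> with the
  cube and \<open>\<psi> h\<close> is bounded.
\<close>
lemma covariance_with_xi:
  assumes V: "cont_linear_functional d V" and h: "h \<in> F"
  shows "ip M V (\<xi> h) = (\<integral>y. (\<integral>f. V f * f y \<partial>M) * \<psi> h y \<partial>cube_lebesgue d)"
proof -
  let ?P = "M \<Otimes>\<^sub>M cube_lebesgue d"
  have Vm: "(\<lambda>p. V (fst p)) \<in> borel_measurable ?P"
    using V gs.meas by (intro measurable_compose[OF measurable_fst]) auto
  have pm: "(\<lambda>p. \<psi> h (snd p)) \<in> borel_measurable ?P"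
    using psi_meas[OF h] by (intro measurable_compose[OF measurable_snd])
  note [measurable] = Vm pm eval_pair
  have iV: "integrable ?P (\<lambda>p. (V (fst p))\<^sup>2)"
  proof (rule integrableI_nonneg)
    have "(\<integral>\<^sup>+p. ennreal ((V (fst p))\<^sup>2) \<partial>?P) = (\<integral>\<^sup>+f. \<integral>\<^sup>+y. ennreal ((V f)\<^sup>2) \<partial>cube_lebesgue d \<partial>M)"
      by (subst Q.nn_integral_fst[symmetric]) auto
    also have "\<dots> = ennreal (\<integral>f. (V f)\<^sup>2 \<partial>M)"
      using V gs.square_integrable[of V] by (subst nn_integral_eq_integral[symmetric]) (auto simp: Q.emeasure_space_1)
    finally show "(\<integral>\<^sup>+p. ennreal ((V (fst p))\<^sup>2) \<partial>?P) < \<infinity>" by simp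
  qed auto
  have iVe: "integrable ?P (\<lambda>p. V (fst p) * fst p (snd p))"
    using iV eval_square_integrable by (intro square_integrable_mult) auto
  have "integrable ?P (\<lambda>p. B * (V (fst p) * fst p (snd p)))" using iVe by simp
  then have "integrable ?P (\<lambda>p. V (fst p) * (fst p (snd p) * \<psi> h (snd p)))"
  proof (rule Bochner_Integration.integrable_bound)
    show "AE p in ?P. norm (V (fst p) * (fst p (snd p) * \<psi> h (snd p))) \<le> norm (B * (V (fst p) * fst p (snd p)))"
    proof (rule AE_I2)
      fix p assume "p \<in> space ?P"
      then have "\<bar>\<psi> h (snd p)\<bar> \<le> B" using psi_bound[OF h] by (auto simp: space_pair_measure space_cube_lebesgue)
      then have "\<bar>V (fst p) * fst p (snd p)\<bar> * \<bar>\<psi> h (snd p)\<bar> \<le> \<bar>V (fst p) * fst p (snd p)\<bar> * \<bar>B\<bar>"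
        by (intro mult_left_mono) auto
      then show "norm (V (fst p) * (fst p (snd p) * \<psi> h (snd p))) \<le> norm (B * (V (fst p) * fst p (snd p)))"
        by (simp add: abs_mult mult_ac)
    qed
  qed auto
  then have int: "integrable ?P (\<lambda>(f, y). V f * (f y * \<psi> h y))" by (simp add: case_prod_unfold)
  have "ip M V (\<xi> h) = (\<integral>f. (\<integral>y. V f * (f y * \<psi> h y) \<partial>cube_lebesgue d) \<partial>M)"
    by (simp add: \<xi>_def)
  also have "\<dots> = (\<integral>y. (\<integral>f. V f * (f y * \<psi> h y) \<partial>M) \<partial>cube_lebesgue d)"
    using MQ.Fubini_integral[OF int] by simp
  also have "\<dots> = (\<integral>y. (\<integral>f. V f * f y \<partial>M) * \<psi> h y \<partial>cube_lebesgue d)"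
    by (intro Bochner_Integration.integral_cong refl) (simp add: mult.assoc[symmetric])
  finally show ?thesis .
qed

text \<open>
  The eigenfunction equation: integrate the Mercer expansion against \<open>\<psi> h\<close> term by term; by
  orthonormality one term remains.
\<close>
lemma xi_eval:
  assumes h: "h \<in> F" and y: "y \<in> cube d"
  shows "(\<integral>f. \<xi> h f * f y \<partial>M) = lam h * \<psi> h y"
proof -
  define k where "k x = (\<integral>f. f y * f x \<partial>M)" for x
  define g where "g j x = lam j * (\<psi> j y * \<psi> j x) * \<psi> h x" for j x
  have km: "k \<in> borel_measurable (cube_lebesgue d)"
    unfolding k_def using cont_linear_functional_eval[OF y] by (rule covariance_measurable)
  have "((\<lambda>j. \<integral>x. g j x \<partial>cube_lebesgue d) has_sum (\<integral>x. k x * \<psi> h x \<partial>cube_lebesgue d)) F"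
  proof (rule Q.has_sum_integral_dominated[where m="\<lambda>j. B\<^sup>2 * lam j * B"])
    show "\<bar>g j x\<bar> \<le> B\<^sup>2 * lam j * B" if "j \<in> F" "x \<in> space (cube_lebesgue d)" for j x
      unfolding g_def abs_mult[of _ "\<psi> h x"] using that cov_has_sum(2)[OF y, of x j] psi_bound[OF h, of x]
      by (intro mult_mono) (auto simp: space_cube_lebesgue intro: order_trans[OF abs_ge_zero])
    show "((\<lambda>j. g j x) has_sum k x * \<psi> h x) F" if "x \<in> space (cube_lebesgue d)" for x
      unfolding g_def k_def using that y by (intro has_sum_cmult_left cov_has_sum) (auto simp: space_cube_lebesgue)
    show "g j \<in> borel_measurable (cube_lebesgue d)" if "j \<in> F" for j
      unfolding g_def using psi_meas that h by (intro borel_measurable_times borel_measurable_const) auto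
  qed (use km psi_meas[OF h] lam_summable in \<open>auto intro!: summable_on_cmult_left summable_on_cmult_right\<close>)
  moreover have "(\<integral>x. g j x \<partial>cube_lebesgue d) = (if j = h then lam h * \<psi> h y else 0)" if "j \<in> F" for j
  proof -
    have "(\<integral>x. g j x \<partial>cube_lebesgue d) = (\<integral>x. lam j * \<psi> j y * (\<psi> j x * \<psi> h x) \<partial>cube_lebesgue d)"
      by (simp add: g_def mult_ac)
    then show ?thesis using orthonormal[OF that h] by simp
  qed
  ultimately have "((\<lambda>j. if j = h then lam h * \<psi> h y else 0) has_sum (\<integral>x. k x * \<psi> h x \<partial>cube_lebesgue d)) F"
    by (simp cong: has_sum_cong)
  moreover have "((\<lambda>j. if j = h then lam h * \<psi> h y else 0) has_sum (lam h * \<psi> h y)) F"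
    using h by (intro has_sum_finite_neutralI[of "{h}"]) auto
  ultimately have "(\<integral>x. k x * \<psi> h x \<partial>cube_lebesgue d) = lam h * \<psi> h y" by (rule has_sum_unique)
  then show ?thesis
    using covariance_with_xi[OF cont_linear_functional_eval[OF y] h] by (simp add: k_def mult.commute)
qed

lemma xi_covariance:
  assumes "h \<in> F" "k \<in> F"
  shows "ip M (\<xi> h) (\<xi> k) = (if h = k then lam h else 0)"
proof -
  have "ip M (\<xi> h) (\<xi> k) = (\<integral>y. (\<integral>f. \<xi> h f * f y \<partial>M) * \<psi> k y \<partial>cube_lebesgue d)"
    using assms by (intro covariance_with_xi xi_functional)
  also have "\<dots> = (\<integral>y. lam h * (\<psi> h y * \<psi> k y) \<partial>cube_lebesgue d)"
    using assms by (intro Bochner_Integration.integral_cong) (auto simp: space_cube_lebesgue xi_eval)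
  also have "\<dots> = (if h = k then lam h else 0)" using orthonormal[OF assms] by simp
  finally show ?thesis .
qed

text \<open>
  The expected squared norm is the trace of the covariance operator.
\<close>
lemma expected_square_norm:
  "(\<integral>f. (\<integral>x. (f x)\<^sup>2 \<partial>cube_lebesgue d) \<partial>M) = (\<Sum>\<^sub>\<infinity>h\<in>F. lam h)"
  "integrable M (\<lambda>f. \<integral>x. (f x)\<^sup>2 \<partial>cube_lebesgue d)"
proof -
  have int: "integrable (M \<Otimes>\<^sub>M cube_lebesgue d) (\<lambda>(f, y). (f y)\<^sup>2)"
    using eval_square_integrable by (simp add: case_prod_unfold)
  show "integrable M (\<lambda>f. \<integral>x. (f x)\<^sup>2 \<partial>cube_lebesgue d)" using MQ.integrable_fst'[OF int] by simp
  have "((\<lambda>h. \<integral>y. lam h * (\<psi> h y * \<psi> h y) \<partial>cube_lebesgue d) has_sum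
          (\<integral>y. (\<integral>f. (f y)\<^sup>2 \<partial>M) \<partial>cube_lebesgue d)) F"
  proof (rule Q.has_sum_integral_dominated[where m="\<lambda>h. B\<^sup>2 * lam h"])
    show "(\<lambda>y. \<integral>f. (f y)\<^sup>2 \<partial>M) \<in> borel_measurable (cube_lebesgue d)"
      using MQ.integrable_snd[OF int] by (rule borel_measurable_integrable)
    show "(\<lambda>y. lam h * (\<psi> h y * \<psi> h y)) \<in> borel_measurable (cube_lebesgue d)" if "h \<in> F" for h
      using psi_meas[OF that] by (intro borel_measurable_times borel_measurable_const)
  qed (use cov_has_sum lam_summable in \<open>auto simp: space_cube_lebesgue power2_eq_square intro!: summable_on_cmult_right\<close>)
  then have "(lam has_sum (\<integral>y. (\<integral>f. (f y)\<^sup>2 \<partial>M) \<partial>cube_lebesgue d)) F"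
    using orthonormal by (simp cong: has_sum_cong)
  then show "(\<integral>f. (\<integral>x. (f x)\<^sup>2 \<partial>cube_lebesgue d) \<partial>M) = (\<Sum>\<^sub>\<infinity>h\<in>F. lam h)"
    using MQ.Fubini_integral[OF int] by (simp add: infsumI)
qed

text \<open>
  The map is continuous from \<open>\<real>\<^sup>n\<close> to \<open>L\<^sub>2\<close>. Extending vectors by zero moves the question to functions on
  all natural numbers, where the product sigma-algebra is the Borel algebra of the product topology.
\<close>
lemma reconstruction_measurable:
  fixes e :: "nat \<Rightarrow> 'h"
  assumes e: "\<And>i. i \<in> {1..n} \<Longrightarrow> e i \<in> F"
  shows "(\<lambda>y x. \<Sum>i\<in>{1..n}. y i * \<psi> (e i) x) \<in> measurable (Pi\<^sub>M {1..n} (\<lambda>_. borel)) (L2_borel d)"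
proof -
  define \<Phi> where "\<Phi> y = (\<lambda>x. \<Sum>i\<in>{1..n}. y i * \<psi> (e i) x)" for y :: "nat \<Rightarrow> real"
  have bd: "\<bar>\<Phi> y x\<bar> \<le> (\<Sum>i\<in>{1..n}. \<bar>y i\<bar>) * B" if "x \<in> cube d" for x y
  proof -
    have "\<bar>\<Phi> y x\<bar> \<le> (\<Sum>i\<in>{1..n}. \<bar>y i * \<psi> (e i) x\<bar>)" unfolding \<Phi>_def by (rule sum_abs)
    also have "\<dots> \<le> (\<Sum>i\<in>{1..n}. \<bar>y i\<bar> * B)"
      using psi_bound[OF e that] by (intro sum_mono) (auto simp: abs_mult intro!: mult_left_mono)
    finally show ?thesis by (simp add: sum_distrib_right)
  qed
  have m: "\<Phi> y \<in> borel_measurable (cube_lebesgue d)" for y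
    unfolding \<Phi>_def using psi_meas e by (intro borel_measurable_sum borel_measurable_times borel_measurable_const) auto
  have L: "\<Phi> y \<in> L2 d" for y using m bd by (intro bounded_L2)
  have op: "open {z. \<Phi> z \<in> U}"
    if U: "\<And>g. g \<in> U \<Longrightarrow> \<exists>r>0. \<forall>h\<in>L2 d. L2_norm d (\<lambda>x. h x - g x) < r \<longrightarrow> h \<in> U" for U
  proof (rule Topological_Spaces.openI, goal_cases)
    case (1 z0)
    then obtain r where r: "r > 0" "\<And>h. h \<in> L2 d \<Longrightarrow> L2_norm d (\<lambda>x. h x - \<Phi> z0 x) < r \<Longrightarrow> h \<in> U"
      using U by blast
    let ?V = "{z. (\<Sum>i\<in>{1..n}. \<bar>z i - z0 i\<bar>) * B < r}"
    have "open ?V"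
      by (intro open_Collect_less continuous_intros continuous_on_product_coordinates)
    moreover have "z0 \<in> ?V" using r by simp
    moreover have "?V \<subseteq> {z. \<Phi> z \<in> U}"
    proof safe
      fix z assume z: "(\<Sum>i\<in>{1..n}. \<bar>z i - z0 i\<bar>) * B < r"
      have eq: "\<Phi> z x - \<Phi> z0 x = \<Phi> (\<lambda>i. z i - z0 i) x" for x
        by (simp add: \<Phi>_def left_diff_distrib sum_subtractf)
      have B0: "0 \<le> (\<Sum>i\<in>{1..n}. \<bar>z i - z0 i\<bar>) * B"
        using bd[of _ "\<lambda>i. z i - z0 i"] cube_nonempty[of d] by (meson abs_ge_zero equals0I order_trans)
      have "(L2_norm d (\<lambda>x. \<Phi> z x - \<Phi> z0 x))\<^sup>2 \<le> (\<integral>x. ((\<Sum>i\<in>{1..n}. \<bar>z i - z0 i\<bar>) * B)\<^sup>2 \<partial>cube_lebesgue d)"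
        unfolding L2_norm_square eq
      proof (intro integral_mono)
        show "integrable (cube_lebesgue d) (\<lambda>x. (\<Phi> (\<lambda>i. z i - z0 i) x)\<^sup>2)" using L by (simp add: L2_def)
        show "(\<Phi> (\<lambda>i. z i - z0 i) x)\<^sup>2 \<le> ((\<Sum>i\<in>{1..n}. \<bar>z i - z0 i\<bar>) * B)\<^sup>2"
          if "x \<in> space (cube_lebesgue d)" for x
          using power_mono[OF bd[of x "\<lambda>i. z i - z0 i"], of 2] that by (simp add: space_cube_lebesgue)
      qed auto
      then have "(L2_norm d (\<lambda>x. \<Phi> z x - \<Phi> z0 x))\<^sup>2 \<le> ((\<Sum>i\<in>{1..n}. \<bar>z i - z0 i\<bar>) * B)\<^sup>2"
        by (simp add: Q.prob_space)
      then have "L2_norm d (\<lambda>x. \<Phi> z x - \<Phi> z0 x) \<le> (\<Sum>i\<in>{1..n}. \<bar>z i - z0 i\<bar>) * B"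
        using B0 by (rule power2_le_imp_le)
      then show "\<Phi> z \<in> U" using z L by (intro r(2)) auto
    qed
    ultimately show ?case by blast
  qed
  define E where "E y = (\<lambda>i. if i \<in> {1..n} then y i else 0)" for y :: "nat \<Rightarrow> real"
  have "E \<in> measurable (Pi\<^sub>M {1..n} (\<lambda>_. borel)) (Pi\<^sub>M UNIV (\<lambda>_. borel))"
    unfolding E_def
  proof (rule measurable_PiM_single')
    fix i :: nat
    show "(\<lambda>y. if i \<in> {1..n} then y i else 0) \<in> borel_measurable (Pi\<^sub>M {1..n} (\<lambda>_. borel))"
      by (cases "i \<in> {1..n}") (auto intro: measurable_component_singleton)
  qed auto
  then have Em: "E \<in> borel_measurable (Pi\<^sub>M {1..n} (\<lambda>_. borel))"
    unfolding measurable_cong_sets[OF refl sets_PiM_equal_borel] .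
  have EP: "\<Phi> (E y) = \<Phi> y" for y by (auto simp: \<Phi>_def E_def fun_eq_iff intro!: sum.cong)
  have "\<Phi> \<in> measurable (Pi\<^sub>M {1..n} (\<lambda>_. borel)) (L2_borel d)"
    unfolding L2_borel_def
  proof (rule measurable_measure_of)
    fix U assume "U \<in> {U. U \<subseteq> L2 d \<and> (\<forall>g\<in>U. \<exists>r>0. \<forall>h\<in>L2 d. L2_norm d (\<lambda>x. h x - g x) < r \<longrightarrow> h \<in> U)}"
    then have "{z. \<Phi> z \<in> U} \<in> sets borel" using op[of U] by auto
    from measurable_sets[OF Em this]
    show "\<Phi> -` U \<inter> space (Pi\<^sub>M {1..n} (\<lambda>_. borel)) \<in> sets (Pi\<^sub>M {1..n} (\<lambda>_. borel))"
      by (simp add: vimage_def EP)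
  qed (use L in auto)
  then show ?thesis by (simp add: \<Phi>_def[abs_def])
qed

text \<open>
  By Pythagoras the squared error is \<open>\<parallel>f\<parallel>\<^sup>2 - (\<Sum>h\<in>H. (\<xi> h f)\<^sup>2)\<close> for every single \<open>f\<close>.
\<close>
lemma projection_error:
  assumes H: "finite H" "H \<subseteq> F"
  shows "(\<integral>\<^sup>+f. ennreal ((L2_norm d (\<lambda>x. f x - (\<Sum>h\<in>H. \<xi> h f * \<psi> h x)))\<^sup>2) \<partial>M)
           = ennreal ((\<Sum>\<^sub>\<infinity>h\<in>F. lam h) - sum lam H)"
proof -
  have eq: "(L2_norm d (\<lambda>x. f x - (\<Sum>h\<in>H. \<xi> h f * \<psi> h x)))\<^sup>2 = (\<integral>x. (f x)\<^sup>2 \<partial>cube_lebesgue d) - (\<Sum>h\<in>H. (\<xi> h f)\<^sup>2)"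
    if "f \<in> space M" for f
    unfolding L2_norm_square \<xi>_def
    using C_cube_L2[of f d] that psi_L2 orthonormal H
    by (intro orthonormal_residual) (auto simp: L2_def space_M subset_iff)
  have i: "integrable M (\<lambda>f. (\<integral>x. (f x)\<^sup>2 \<partial>cube_lebesgue d) - (\<Sum>h\<in>H. (\<xi> h f)\<^sup>2))"
    using expected_square_norm(2) gs.square_integrable xi_functional H
    by (intro Bochner_Integration.integrable_diff Bochner_Integration.integrable_sum) auto
  have "(\<integral>\<^sup>+f. ennreal ((L2_norm d (\<lambda>x. f x - (\<Sum>h\<in>H. \<xi> h f * \<psi> h x)))\<^sup>2) \<partial>M)
      = (\<integral>\<^sup>+f. ennreal ((\<integral>x. (f x)\<^sup>2 \<partial>cube_lebesgue d) - (\<Sum>h\<in>H. (\<xi> h f)\<^sup>2)) \<partial>M)"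
    by (intro nn_integral_cong) (simp add: eq)
  also have "\<dots> = ennreal (\<integral>f. (\<integral>x. (f x)\<^sup>2 \<partial>cube_lebesgue d) - (\<Sum>h\<in>H. (\<xi> h f)\<^sup>2) \<partial>M)"
    by (intro nn_integral_eq_integral i AE_I2) (simp add: eq[symmetric])
  also have "(\<integral>f. (\<integral>x. (f x)\<^sup>2 \<partial>cube_lebesgue d) - (\<Sum>h\<in>H. (\<xi> h f)\<^sup>2) \<partial>M)
       = (\<Sum>\<^sub>\<infinity>h\<in>F. lam h) - (\<Sum>h\<in>H. (\<integral>f. (\<xi> h f)\<^sup>2 \<partial>M))"
    using expected_square_norm gs.square_integrable xi_functional H
    by (subst Bochner_Integration.integral_diff) (auto simp: Bochner_Integration.integral_sum subset_iff)
  also have "(\<Sum>h\<in>H. (\<integral>f. (\<xi> h f)\<^sup>2 \<partial>M)) = sum lam H"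
    using xi_covariance H by (intro sum.cong) (auto simp: power2_eq_square subset_iff)
  finally show ?thesis .
qed

lemma projection_is_algorithm:
  assumes H: "finite H" "H \<subseteq> F"
  shows "(\<lambda>f x. \<Sum>h\<in>H. \<xi> h f * \<psi> h x) \<in> algorithms (card H) d"
proof -
  obtain e where e: "bij_betw e {1..card H} H" using ex_bij_betw_nat_finite_1[OF H(1)] by blast
  have eF: "e i \<in> F" if "i \<in> {1..card H}" for i using e that H by (auto simp: bij_betw_def)
  have "(\<Sum>h\<in>H. \<xi> h f * \<psi> h x) = (\<Sum>i\<in>{1..card H}. (\<lambda>i\<in>{1..card H}. \<xi> (e i) f) i * \<psi> (e i) x)" for f x
    using sum.reindex_bij_betw[OF e, of "\<lambda>h. \<xi> h f * \<psi> h x"] by simp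
  then show ?thesis
    unfolding algorithms_def using reconstruction_measurable[of "card H" e] eF xi_functional
    by (intro CollectI exI[of _ "\<lambda>i. \<xi> (e i)"] exI[of _ "\<lambda>y x. \<Sum>i\<in>{1..card H}. y i * \<psi> (e i) x"]) auto
qed

lemma psi_coefficient_measurable:
  assumes h: "h \<in> F"
  shows "(\<lambda>u. \<integral>x. u x * \<psi> h x \<partial>cube_lebesgue d) \<in> borel_measurable (L2_borel d)"
proof (rule borel_measurableI)
  let ?c = "\<lambda>u. \<integral>x. u x * \<psi> h x \<partial>cube_lebesgue d"
  fix S :: "real set" assume S: "open S"
  have lip: "\<bar>?c v - ?c u\<bar> \<le> L2_norm d (\<lambda>x. v x - u x)" if "u \<in> L2 d" "v \<in> L2 d" for u v
  proof -
    have i: "integrable (cube_lebesgue d) (\<lambda>x. w x * \<psi> h x)" if "w \<in> L2 d" for w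
      using that psi_L2[OF h] by (intro square_integrable_mult) (auto simp: L2_def)
    have "?c v - ?c u = (\<integral>x. (v x - u x) * \<psi> h x \<partial>cube_lebesgue d)"
      using i that by (simp add: left_diff_distrib)
    moreover have "(\<integral>x. (v x - u x) * \<psi> h x \<partial>cube_lebesgue d)\<^sup>2 \<le> (\<integral>x. (v x - u x)\<^sup>2 \<partial>cube_lebesgue d)"
      using Bessel_inequality[of "{h}" "\<lambda>x. v x - u x" "cube_lebesgue d" \<psi>] L2_diff[OF that(2,1)] psi_L2[OF h] orthonormal[OF h h]
      by (auto simp: L2_def)
    ultimately have "\<bar>?c v - ?c u\<bar>\<^sup>2 \<le> (L2_norm d (\<lambda>x. v x - u x))\<^sup>2" by (simp add: L2_norm_square)
    then show ?thesis by (rule power2_le_imp_le) (simp add: L2_norm_def)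
  qed
  have "?c -` S \<inter> L2 d \<in> {U. U \<subseteq> L2 d \<and> (\<forall>g\<in>U. \<exists>r>0. \<forall>h\<in>L2 d. L2_norm d (\<lambda>x. h x - g x) < r \<longrightarrow> h \<in> U)}"
  proof (intro CollectI conjI ballI)
    fix u assume u: "u \<in> ?c -` S \<inter> L2 d"
    then obtain r where r: "r > 0" "\<And>y. dist y (?c u) < r \<Longrightarrow> y \<in> S"
      using S[unfolded open_dist, rule_format, of "?c u"] by blast
    show "\<exists>r>0. \<forall>v\<in>L2 d. L2_norm d (\<lambda>x. v x - u x) < r \<longrightarrow> v \<in> ?c -` S \<inter> L2 d"
    proof (intro exI[of _ r] conjI ballI impI)
      fix v assume v: "v \<in> L2 d" "L2_norm d (\<lambda>x. v x - u x) < r"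
      then show "v \<in> ?c -` S \<inter> L2 d" using lip[of u v] u by (auto simp: dist_real_def intro!: r(2))
    qed (rule r(1))
  qed auto
  then show "?c -` S \<inter> space (L2_borel d) \<in> sets (L2_borel d)"
    unfolding sets_L2_borel space_L2_borel by (rule sigma_sets.Basic)
qed

text \<open>
  Let \<open>Q\<close> be an orthonormal basis in \<open>L\<^sub>2(M)\<close> of the span of the functionals used, so \<open>card Q \<le> n\<close>. The
  share of the variance of \<open>\<xi> h\<close> that \<open>Q\<close> explains is \<open>p h = (\<Sum>q\<in>Q. (ip M (\<xi> h) q)\<^sup>2) / lam h\<close>, at most \<open>1\<close>.
  As the normalised \<open>\<xi> h\<close> are orthonormal too, Bessel's inequality for each \<open>q\<close> gives \<open>sum p H \<le> n\<close>. The
  unexplained part \<open>lam h * (1 - p h)\<close> is at least \<open>min (lam h) c - c * p h\<close>.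
\<close>
lemma algorithm_error_ge:
  assumes H: "finite H" "H \<subseteq> F" and c: "c > 0" and A: "A \<in> algorithms n d"
  shows "ennreal ((\<Sum>h\<in>H. min (lam h) c) - c * real n)
           \<le> (\<integral>\<^sup>+f. ennreal ((L2_norm d (\<lambda>x. f x - A f x))\<^sup>2) \<partial>M)"
proof -
  obtain L \<phi> where L: "\<And>i. i \<in> {1..n} \<Longrightarrow> cont_linear_functional d (L i)"
    and phi: "\<phi> \<in> measurable (Pi\<^sub>M {1..n} (\<lambda>_. borel)) (L2_borel d)"
    and A_eq: "A = (\<lambda>f. \<phi> (\<lambda>i\<in>{1..n}. L i f))"
    using A unfolding algorithms_def by blast
  define g where "g h y = ip (cube_lebesgue d) (\<phi> y) (\<psi> h)" for h y
  have gm: "g h \<in> borel_measurable (Pi\<^sub>M {1..n} (\<lambda>_. borel))" if "h \<in> F" for h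
    unfolding g_def by (rule measurable_compose[OF phi psi_coefficient_measurable[OF that]])
  obtain Q where Q: "finite Q" "Q \<subseteq> {L. cont_linear_functional d L}" "card Q \<le> card {1..n}"
      and on: "\<And>p q. p \<in> Q \<Longrightarrow> q \<in> Q \<Longrightarrow> ip M p q = (if p = q then 1 else 0)"
      and sp: "\<And>R i. cont_linear_functional d R \<Longrightarrow> (\<And>q. q \<in> Q \<Longrightarrow> ip M R q = 0) \<Longrightarrow>
                 i \<in> {1..n} \<Longrightarrow> ip M R (L i) = 0"
    using gs.orthonormal_basis[of "{1..n}" L] L by auto
  define r where "r h q = ip M (\<xi> h) q" for h q
  have Bessel: "(L2_norm d (\<lambda>x. f x - A f x))\<^sup>2 \<ge> (\<Sum>h\<in>H. (\<xi> h f - g h (\<lambda>i\<in>{1..n}. L i f))\<^sup>2)"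
    if f: "f \<in> space M" for f
  proof -
    have fL: "f \<in> L2 d" using f C_cube_L2 by (simp add: space_M)
    have AL: "A f \<in> L2 d"
      unfolding A_eq using measurable_space[OF phi, of "\<lambda>i\<in>{1..n}. L i f"] by (simp add: space_L2_borel space_PiM)
    have "(\<Sum>h\<in>H. (\<integral>x. (f x - A f x) * \<psi> h x \<partial>cube_lebesgue d)\<^sup>2) \<le> (\<integral>x. (f x - A f x)\<^sup>2 \<partial>cube_lebesgue d)"
      using L2_diff[OF fL AL] psi_L2 orthonormal H by (intro Bessel_inequality) (auto simp: L2_def subset_iff)
    moreover have "(\<integral>x. (f x - A f x) * \<psi> h x \<partial>cube_lebesgue d) = \<xi> h f - g h (\<lambda>i\<in>{1..n}. L i f)" if "h \<in> H" for h
    proof -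
      have hL: "\<psi> h \<in> L2 d" using psi_L2 \<open>h \<in> H\<close> H by auto
      have i: "integrable (cube_lebesgue d) (\<lambda>x. w x * \<psi> h x)" if "w \<in> L2 d" for w
        using that hL by (intro square_integrable_mult) (auto simp: L2_def)
      show ?thesis using i[OF fL] i[OF AL] by (simp add: left_diff_distrib \<xi>_def g_def A_eq)
    qed
    ultimately show ?thesis by (simp add: L2_norm_square)
  qed
  have main: "(\<Sum>h\<in>H. min (lam h) c) - c * real n \<le> (\<Sum>h\<in>H. lam h - (\<Sum>q\<in>Q. (r h q)\<^sup>2))"
  proof -
    define p where "p h = (\<Sum>q\<in>Q. (r h q)\<^sup>2) / lam h" for h
    have p1: "p h \<le> 1" if "h \<in> H" for h
    proof -
      have hF: "h \<in> F" using that H by auto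
      have "(\<Sum>q\<in>Q. (r h q)\<^sup>2) \<le> (\<integral>f. (\<xi> h f)\<^sup>2 \<partial>M)"
        unfolding r_def
      proof (rule Bessel_inequality[where e="\<lambda>q. q"])
        show "finite Q" by (rule Q)
        show "\<xi> h \<in> borel_measurable M" "integrable M (\<lambda>f. (\<xi> h f)\<^sup>2)"
          using xi_functional[OF hF] gs.meas gs.square_integrable by blast+
        show "q \<in> borel_measurable M" "integrable M (\<lambda>f. (q f)\<^sup>2)" if "q \<in> Q" for q
          using that Q(2) gs.meas gs.square_integrable by blast+
      qed (rule on)
      also have "\<dots> = lam h" using xi_covariance[OF hF hF] by (simp add: power2_eq_square)
      finally show ?thesis using lam_pos[OF hF] by (simp add: p_def)
    qed
    have q1: "(\<Sum>h\<in>H. (r h q)\<^sup>2 / lam h) \<le> 1" if "q \<in> Q" for q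
    proof -
      define e where "e h f = (1 / sqrt (lam h)) * \<xi> h f" for h f
      have eG: "cont_linear_functional d (e h)" if "h \<in> H" for h
        unfolding e_def using that H xi_functional by (intro cont_linear_functional_scale) auto
      have "(\<Sum>h\<in>H. (ip M q (e h))\<^sup>2) \<le> (\<integral>f. (q f)\<^sup>2 \<partial>M)"
      proof (intro Bessel_inequality H)
        fix h k assume hk: "h \<in> H" "k \<in> H"
        have "ip M (e h) (e k) = (\<integral>f. (1 / sqrt (lam h) * (1 / sqrt (lam k))) * (\<xi> h f * \<xi> k f) \<partial>M)"
          by (intro Bochner_Integration.integral_cong) (auto simp: e_def)
        also have "\<dots> = (if h = k then 1 else 0)"
          using xi_covariance[of h k] lam_pos[of h] hk H by (auto simp: subset_iff)
        finally show "ip M (e h) (e k) = (if h = k then 1 else 0)" .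
      next
        show "q \<in> borel_measurable M" "integrable M (\<lambda>f. (q f)\<^sup>2)"
          using that Q(2) gs.meas gs.square_integrable by blast+
        show "e h \<in> borel_measurable M" "integrable M (\<lambda>f. (e h f)\<^sup>2)" if "h \<in> H" for h
          using eG[OF that] gs.meas gs.square_integrable by blast+
      qed
      also have "(\<integral>f. (q f)\<^sup>2 \<partial>M) = 1" using on[OF that that] by (simp add: power2_eq_square)
      also have "(\<Sum>h\<in>H. (ip M q (e h))\<^sup>2) = (\<Sum>h\<in>H. (r h q)\<^sup>2 / lam h)"
      proof (intro sum.cong refl)
        fix h assume h: "h \<in> H"
        have "ip M q (e h) = (\<integral>f. (1 / sqrt (lam h)) * (\<xi> h f * q f) \<partial>M)"
          by (intro Bochner_Integration.integral_cong) (auto simp: e_def)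
        then show "(ip M q (e h))\<^sup>2 = (r h q)\<^sup>2 / lam h"
          using lam_pos[of h] h H by (auto simp: r_def power_divide)
      qed
      finally show ?thesis .
    qed
    have "sum p H = (\<Sum>q\<in>Q. \<Sum>h\<in>H. (r h q)\<^sup>2 / lam h)"
      unfolding p_def sum_divide_distrib by (rule sum.swap)
    also have "\<dots> \<le> (\<Sum>q\<in>Q. 1)" using q1 by (rule sum_mono)
    also have "\<dots> \<le> real n" using Q by simp
    finally have sp: "sum p H \<le> real n" .
    have "min (lam h) c - c * p h \<le> lam h - (\<Sum>q\<in>Q. (r h q)\<^sup>2)" if "h \<in> H" for h
    proof -
      have l: "lam h > 0" using that H lam_pos by auto
      then have eq: "lam h - (\<Sum>q\<in>Q. (r h q)\<^sup>2) = lam h * (1 - p h)" by (simp add: p_def right_diff_distrib)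
      have p0: "0 \<le> p h" using l by (simp add: p_def sum_nonneg)
      have "min (lam h) c * (1 - p h) \<le> lam h * (1 - p h)" using p1[OF that] by (intro mult_right_mono) auto
      moreover have "min (lam h) c * p h \<le> c * p h" using p0 by (intro mult_right_mono) auto
      ultimately show ?thesis unfolding eq by (simp add: right_diff_distrib)
    qed
    then have "(\<Sum>h\<in>H. min (lam h) c - c * p h) \<le> (\<Sum>h\<in>H. lam h - (\<Sum>q\<in>Q. (r h q)\<^sup>2))" by (rule sum_mono)
    moreover have "c * sum p H \<le> c * real n" using sp c by simp
    ultimately show ?thesis by (simp add: sum_subtractf sum_distrib_left)
  qed
  have xm: "(\<lambda>f. (\<xi> h f - g h (\<lambda>i\<in>{1..n}. L i f))\<^sup>2) \<in> borel_measurable M" if "h \<in> F" for h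
  proof -
    have "(\<lambda>f. \<lambda>i\<in>{1..n}. L i f) \<in> measurable M (Pi\<^sub>M {1..n} (\<lambda>_. borel))"
      using L gs.meas by (intro measurable_restrict) auto
    from measurable_compose[OF this gm[OF that]] show ?thesis
      using gs.meas[of "\<xi> h"] xi_functional[OF that] by auto
  qed
  have "ennreal ((\<Sum>h\<in>H. min (lam h) c) - c * real n) \<le> ennreal (\<Sum>h\<in>H. lam h - (\<Sum>q\<in>Q. (r h q)\<^sup>2))"
    using main by (rule ennreal_leI)
  also have "\<dots> \<le> (\<Sum>h\<in>H. ennreal (lam h - (\<Sum>q\<in>Q. (r h q)\<^sup>2)))"
    using H(1) by (induction H) (auto intro: order_trans[OF ennreal_add_le] add_left_mono)
  also have "\<dots> \<le> (\<Sum>h\<in>H. \<integral>\<^sup>+f. ennreal ((\<xi> h f - g h (\<lambda>i\<in>{1..n}. L i f))\<^sup>2) \<partial>M)"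
  proof (intro sum_mono)
    fix h assume h: "h \<in> H"
    then have hF: "h \<in> F" using H by auto
    have "lam h = (\<integral>f. (\<xi> h f)\<^sup>2 \<partial>M)" using xi_covariance[OF hF hF] by (simp add: power2_eq_square)
    then show "ennreal (lam h - (\<Sum>q\<in>Q. (r h q)\<^sup>2)) \<le> (\<integral>\<^sup>+f. ennreal ((\<xi> h f - g h (\<lambda>i\<in>{1..n}. L i f))\<^sup>2) \<partial>M)"
      unfolding r_def using gs.best_approximation[of "{1..n}" L Q "\<xi> h" "g h"] L Q on sp xi_functional[OF hF] gm[OF hF]
      by auto
  qed
  also have "\<dots> = (\<integral>\<^sup>+f. ennreal (\<Sum>h\<in>H. (\<xi> h f - g h (\<lambda>i\<in>{1..n}. L i f))\<^sup>2) \<partial>M)"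
    using xm H by (subst nn_integral_sum[symmetric]) (auto simp: sum_ennreal subset_iff)
  also have "\<dots> \<le> (\<integral>\<^sup>+f. ennreal ((L2_norm d (\<lambda>x. f x - A f x))\<^sup>2) \<partial>M)"
    using Bessel by (intro nn_integral_mono ennreal_leI)
  finally show ?thesis .
qed

end

section \<open>The one-dimensional weight sums\<close>

definition lattice_tail :: "real \<Rightarrow> real \<Rightarrow> real" where
  "lattice_tail u b = (\<Sum>\<^sub>\<infinity>h\<in>-{0::int}. exp (- (u * \<bar>real_of_int h\<bar> powr b)))"

text \<open>
  Take \<open>p\<close>-th powers in \<open>v / p \<le> exp (v / p)\<close>.
\<close>
lemma exp_minus_le_powr:
  fixes p v :: real
  assumes "p > 0" "v > 0"
  shows "exp (- v) \<le> p powr p * v powr (- p)"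
proof -
  have "(v / p) powr p \<le> exp (v / p) powr p"
  proof (intro powr_mono2)
    show "v / p \<le> exp (v / p)" using exp_ge_add_one_self[of "v / p"] by linarith
  qed (use assms in auto)
  also have "\<dots> = exp v" using assms by (simp add: powr_def)
  finally have "exp (- v) \<le> inverse ((v / p) powr p)"
    unfolding exp_minus using assms by (intro le_imp_inverse_le) auto
  also have "\<dots> = p powr p * v powr (- p)" using assms by (simp add: powr_divide powr_minus field_simps)
  finally show ?thesis .
qed

lemma int_nonzero_split: "-{0::int} = range (\<lambda>n. int (Suc n)) \<union> range (\<lambda>n. - int (Suc n))"
proof (intro set_eqI iffI)
  fix h :: int assume "h \<in> -{0}"
  then have "h = int (Suc (nat (h - 1))) \<or> h = - int (Suc (nat (- h - 1)))" by auto
  then show "h \<in> range (\<lambda>n. int (Suc n)) \<union> range (\<lambda>n. - int (Suc n))" by blast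
qed auto

lemma summable_inverse_squares_int: "(\<lambda>h. \<bar>real_of_int h\<bar> powr (- 2)) summable_on (-{0::int})"
proof -
  have "summable (\<lambda>n. inverse (real (Suc n) ^ 2))"
    using inverse_power_summable[of 2, where 'a=real] by (subst summable_Suc_iff) simp
  then have n: "(\<lambda>n. inverse (real (Suc n) ^ 2)) summable_on UNIV"
    by (intro norm_summable_imp_summable_on) simp
  have pos: "(\<lambda>h. \<bar>real_of_int h\<bar> powr (- 2)) \<circ> (\<lambda>n. int (Suc n)) = (\<lambda>n. inverse (real (Suc n) ^ 2))"
    and neg: "(\<lambda>h. \<bar>real_of_int h\<bar> powr (- 2)) \<circ> (\<lambda>n. - int (Suc n)) = (\<lambda>n. inverse (real (Suc n) ^ 2))"
    by (auto simp: fun_eq_iff powr_minus powr_numeral power2_commute)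
       (simp add: power2_eq_square algebra_simps flip: inverse_mult_distrib)
  have "(\<lambda>h. \<bar>real_of_int h\<bar> powr (- 2)) summable_on range (\<lambda>n. int (Suc n))"
    using n by (subst summable_on_reindex) (auto simp only: pos, auto simp: inj_on_def)
  moreover have "(\<lambda>h. \<bar>real_of_int h\<bar> powr (- 2)) summable_on range (\<lambda>n. - int (Suc n))"
    using n by (subst summable_on_reindex) (auto simp only: neg, auto simp: inj_on_def)
  ultimately show ?thesis unfolding int_nonzero_split by (intro summable_on_Un_disjoint) auto
qed

lemma one_le_abs_int_powr: "h \<noteq> 0 \<Longrightarrow> 0 \<le> b \<Longrightarrow> 1 \<le> \<bar>real_of_int h\<bar> powr b"
  by (intro ge_one_powr_ge_zero) auto

lemma exp_abs_int_powr_le: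
  assumes "u > 0" "b > 0" "p * b \<ge> 2" "p > 0" "h \<noteq> 0"
  shows "exp (- (u * \<bar>real_of_int h\<bar> powr b)) \<le> p powr p * u powr (- p) * \<bar>real_of_int h\<bar> powr (- 2)"
proof -
  have h: "\<bar>real_of_int h\<bar> \<ge> 1" using assms(5) by linarith
  have "exp (- (u * \<bar>real_of_int h\<bar> powr b)) \<le> p powr p * (u * \<bar>real_of_int h\<bar> powr b) powr (- p)"
    using assms h by (intro exp_minus_le_powr) auto
  also have "(u * \<bar>real_of_int h\<bar> powr b) powr (- p) = u powr (- p) * \<bar>real_of_int h\<bar> powr (- (p * b))"
    using assms by (simp add: powr_mult powr_powr mult.commute)
  also have "\<bar>real_of_int h\<bar> powr (- (p * b)) \<le> \<bar>real_of_int h\<bar> powr (- 2)"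
    using assms h by (intro powr_mono) auto
  finally show ?thesis by (simp add: mult.assoc mult_left_mono)
qed

lemma lattice_tail_summable:
  assumes "u > 0" "b > 0"
  shows "(\<lambda>h. exp (- (u * \<bar>real_of_int h\<bar> powr b))) summable_on (-{0::int})"
proof (rule summable_on_comparison_test)
  show "(\<lambda>h. (2 / b) powr (2 / b) * u powr (- (2 / b)) * \<bar>real_of_int h\<bar> powr (- 2)) summable_on (-{0::int})"
    by (intro summable_on_cmult_right summable_inverse_squares_int)
  show "exp (- (u * \<bar>real_of_int h\<bar> powr b)) \<le> (2 / b) powr (2 / b) * u powr (- (2 / b)) * \<bar>real_of_int h\<bar> powr (- 2)"
    if "h \<in> -{0}" for h :: int
    using that assms by (intro exp_abs_int_powr_le) auto
qed auto

lemma lattice_tail_nonneg: "0 \<le> lattice_tail u b"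
  unfolding lattice_tail_def by (rule infsum_nonneg) simp

lemma lattice_tail_ge:
  assumes "u > 0" "b > 0"
  shows "2 * exp (- u) \<le> lattice_tail u b"
proof -
  have "(\<Sum>h\<in>{1, -1::int}. exp (- (u * \<bar>real_of_int h\<bar> powr b))) \<le> lattice_tail u b"
    unfolding lattice_tail_def using lattice_tail_summable[OF assms] by (intro finite_sum_le_infsum) auto
  then show ?thesis by simp
qed

text \<open>
  The first terms \<open>\<bar>h\<bar> = 1\<close> dominate: after factoring out \<open>exp (- u)\<close> the exponents \<open>u (\<bar>h\<bar>\<^sup>b - 1)\<close> are
  smallest for the smallest admissible \<open>u\<close> and \<open>b\<close>.
\<close>
lemma lattice_tail_le_exp:
  assumes "u0 > 0" "b0 > 0" "u \<ge> u0" "b \<ge> b0"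
  shows "lattice_tail u b \<le> exp u0 * lattice_tail u0 b0 * exp (- u)"
proof -
  have "lattice_tail u b \<le> (\<Sum>\<^sub>\<infinity>h\<in>-{0::int}. (exp u0 * exp (- u)) * exp (- (u0 * \<bar>real_of_int h\<bar> powr b0)))"
    unfolding lattice_tail_def
  proof (rule infsum_mono)
    fix h :: int assume "h \<in> -{0}"
    then have h: "\<bar>real_of_int h\<bar> \<ge> 1" by auto
    have "u0 * (\<bar>real_of_int h\<bar> powr b0 - 1) \<le> u * (\<bar>real_of_int h\<bar> powr b - 1)"
      using assms h powr_mono[of b0 b "\<bar>real_of_int h\<bar>"] ge_one_powr_ge_zero[of "\<bar>real_of_int h\<bar>" b0]
      by (intro mult_mono) auto
    then have "- (u * \<bar>real_of_int h\<bar> powr b) \<le> u0 + (- u) + - (u0 * \<bar>real_of_int h\<bar> powr b0)"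
      by (simp add: algebra_simps)
    then show "exp (- (u * \<bar>real_of_int h\<bar> powr b)) \<le> (exp u0 * exp (- u)) * exp (- (u0 * \<bar>real_of_int h\<bar> powr b0))"
      by (simp only: exp_add[symmetric] exp_le_cancel_iff)
  qed (use assms in \<open>auto intro!: lattice_tail_summable summable_on_cmult_right\<close>)
  also have "\<dots> = (exp u0 * exp (- u)) * lattice_tail u0 b0"
    unfolding lattice_tail_def by (rule infsum_cmult_right')
  finally show ?thesis by (simp add: mult_ac)
qed

lemma lattice_tail_scale_le:
  assumes "u > 0" "b > 0" "\<theta> \<ge> 0"
  shows "lattice_tail ((1 + \<theta>) * u) b \<le> exp (- (\<theta> * u)) * lattice_tail u b"
proof -
  have "lattice_tail ((1 + \<theta>) * u) b \<le> (\<Sum>\<^sub>\<infinity>h\<in>-{0::int}. exp (- (\<theta> * u)) * exp (- (u * \<bar>real_of_int h\<bar> powr b)))"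
    unfolding lattice_tail_def
  proof (rule infsum_mono)
    fix h :: int assume "h \<in> -{0}"
    then have "1 \<le> \<bar>real_of_int h\<bar> powr b" using assms by (intro one_le_abs_int_powr) auto
    then have "\<theta> * u * 1 \<le> \<theta> * u * \<bar>real_of_int h\<bar> powr b" using assms by (intro mult_left_mono) auto
    then have "- ((1 + \<theta>) * u * \<bar>real_of_int h\<bar> powr b) \<le> - (\<theta> * u) + - (u * \<bar>real_of_int h\<bar> powr b)"
      by (simp add: algebra_simps)
    then show "exp (- ((1 + \<theta>) * u * \<bar>real_of_int h\<bar> powr b)) \<le> exp (- (\<theta> * u)) * exp (- (u * \<bar>real_of_int h\<bar> powr b))"
      by (simp only: exp_add[symmetric] exp_le_cancel_iff)
  qed (use assms in \<open>auto intro!: lattice_tail_summable summable_on_cmult_right\<close>)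
  also have "\<dots> = exp (- (\<theta> * u)) * lattice_tail u b"
    unfolding lattice_tail_def by (rule infsum_cmult_right')
  finally show ?thesis .
qed

lemma ln_one_plus_le_powr:
  fixes z :: real
  assumes "z \<ge> 0" "0 < r" "r \<le> 1"
  shows "ln (1 + z) \<le> (1 + 1 / r) * z powr r"
proof (cases "z \<le> 1")
  case True
  have "ln (1 + z) \<le> z" using assms by (intro ln_add_one_self_le_self)
  also have "z \<le> z powr r"
  proof (cases "z = 0")
    case False
    then have "z powr 1 \<le> z powr r" using assms True by (intro powr_mono') auto
    then show ?thesis using False assms by simp
  qed simp
  also have "\<dots> \<le> (1 + 1 / r) * z powr r" using assms by (simp add: mult_right_mono distrib_right)
  finally show ?thesis .
next
  case False
  then have z: "z > 1" by simp
  have "ln (1 + z) \<le> ln (2 * z)" using z by (subst ln_le_cancel_iff) auto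
  also have "\<dots> = ln 2 + ln z" using z by (intro ln_mult_pos) auto
  also have "\<dots> \<le> z powr r + z powr r / r"
  proof (rule add_mono)
    have "ln (2::real) \<le> 1" using ln_2_less_1 by simp
    also have "1 \<le> z powr r" using z assms by (intro ge_one_powr_ge_zero) auto
    finally show "ln 2 \<le> z powr r" .
    show "ln z \<le> z powr r / r" using z assms by (intro ln_powr_bound) auto
  qed
  finally show ?thesis by (simp add: distrib_right)
qed

text \<open>
  For small \<open>u\<close> the sum itself may grow like \<open>u\<close> to the power \<open>- 1/b\<close>, but its logarithm is at
  most a multiple of every negative power of \<open>u\<close>, uniformly in \<open>b \<ge> b0\<close>.
\<close>
lemma ln_lattice_tail_le_powr:
  assumes "\<kappa> > 0" "b0 > 0"
  shows "\<exists>C\<ge>0. \<forall>u>0. \<forall>b\<ge>b0. ln (1 + lattice_tail u b) \<le> C * u powr (- \<kappa>)"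
proof -
  \<comment> \<open>Large enough for \<open>\<bar>h\<bar> powr (- p * b)\<close> to be summable; the logarithm then lowers the exponent from \<open>p\<close> to \<open>\<kappa>\<close>.\<close>
  define p where "p = max \<kappa> (2 / b0)"
  define S where "S = (\<Sum>\<^sub>\<infinity>h\<in>-{0::int}. \<bar>real_of_int h\<bar> powr (- 2))"
  define D where "D = p powr p * S"
  define r where "r = \<kappa> / p"
  have p: "p > 0" "p \<ge> \<kappa>" using assms by (auto simp: p_def)
  have r: "0 < r" "r \<le> 1" using assms p by (auto simp: r_def)
  have "S \<ge> 0" unfolding S_def by (rule infsum_nonneg) simp
  then have D: "D \<ge> 0" by (simp add: D_def)
  have "ln (1 + lattice_tail u b) \<le> (1 + 1 / r) * D powr r * u powr (- \<kappa>)" if u: "u > 0" and b: "b \<ge> b0" for u b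
  proof -
    have pb: "p * b \<ge> 2"
    proof -
      have "2 = 2 / b0 * b0" using assms by simp
      also have "\<dots> \<le> p * b" using assms b by (intro mult_mono) (auto simp: p_def)
      finally show ?thesis .
    qed
    have "lattice_tail u b \<le> (\<Sum>\<^sub>\<infinity>h\<in>-{0::int}. p powr p * u powr (- p) * \<bar>real_of_int h\<bar> powr (- 2))"
      unfolding lattice_tail_def using u b p pb assms
      by (intro infsum_mono lattice_tail_summable summable_on_cmult_right summable_inverse_squares_int exp_abs_int_powr_le) auto
    also have "\<dots> = D * u powr (- p)"
      by (simp add: infsum_cmult_right' D_def S_def mult_ac)
    finally have le: "lattice_tail u b \<le> D * u powr (- p)" .
    have "ln (1 + lattice_tail u b) \<le> ln (1 + D * u powr (- p))"
      using le lattice_tail_nonneg[of u b] by (subst ln_le_cancel_iff) auto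
    also have "\<dots> \<le> (1 + 1 / r) * (D * u powr (- p)) powr r"
      using D r by (intro ln_one_plus_le_powr) auto
    also have "(D * u powr (- p)) powr r = D powr r * u powr (- \<kappa>)"
      using D p u by (simp add: powr_mult powr_powr r_def)
    finally show ?thesis by (simp add: mult_ac)
  qed
  then show ?thesis using r by (intro exI[of _ "(1 + 1 / r) * D powr r"]) auto
qed

section \<open>The spectrum\<close>

definition freqs :: "nat \<Rightarrow> (nat \<Rightarrow> int) set" where
  "freqs d = {1..d} \<rightarrow>\<^sub>E UNIV"

locale spectrum =
  fixes \<alpha> b :: "nat \<Rightarrow> real" and b0 :: real
  assumes alpha_pos: "k \<ge> 1 \<Longrightarrow> 0 < \<alpha> k"
    and b0_pos: "0 < b0" and b_ge: "k \<ge> 1 \<Longrightarrow> b0 \<le> b k"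
begin

definition wt :: "nat \<Rightarrow> (nat \<Rightarrow> int) \<Rightarrow> real" where
  "wt d h = exp (- (\<Sum>k=1..d. \<alpha> k * \<bar>real_of_int (h k)\<bar> powr b k))"

text \<open>By \<open>wt_powr_has_sum\<close> below, the sum of the \<open>\<tau>\<close>-th powers of all weights.\<close>
definition Z :: "nat \<Rightarrow> real \<Rightarrow> real" where
  "Z d \<tau> = (\<Prod>k=1..d. 1 + lattice_tail (\<tau> * \<alpha> k) (b k))"

lemma wt_pos: "0 < wt d h" by (simp add: wt_def)

lemma wt_le_1: "wt d h \<le> 1"
  using alpha_pos unfolding wt_def exp_le_one_iff neg_le_0_iff_le
  by (intro sum_nonneg mult_nonneg_nonneg) (auto intro: less_imp_le)

lemma b_pos: "k \<ge> 1 \<Longrightarrow> 0 < b k" using b_ge[of k] b0_pos by linarith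

lemma Z_ge_1: "1 \<le> Z d \<tau>"
  unfolding Z_def using lattice_tail_nonneg by (intro prod_ge_1) auto

lemma ln_Z: "ln (Z d \<tau>) = (\<Sum>k=1..d. ln (1 + lattice_tail (\<tau> * \<alpha> k) (b k)))"
  unfolding Z_def
proof (rule ln_prod)
  fix k
  show "1 + lattice_tail (\<tau> * \<alpha> k) (b k) \<noteq> 0" using lattice_tail_nonneg[of "\<tau> * \<alpha> k" "b k"] by linarith
qed simp

lemma wt_powr_has_sum:
  assumes "\<tau> > 0"
  shows "((\<lambda>h. wt d h powr \<tau>) has_sum Z d \<tau>) (freqs d)"
proof -
  define f where "f k h = exp (- (\<tau> * \<alpha> k * \<bar>real_of_int h\<bar> powr b k))" for k and h :: int
  have eq: "wt d h powr \<tau> = (\<Prod>k\<in>{1..d}. f k (h k))" for h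
    by (simp add: wt_def f_def powr_def exp_sum[symmetric] sum_negf sum_distrib_left mult_ac)
  have f0: "(f k has_sum (1 + lattice_tail (\<tau> * \<alpha> k) (b k))) UNIV" if k: "k \<in> {1..d}" for k
  proof -
    have s: "f k summable_on (-{0})"
      unfolding f_def using assms alpha_pos[of k] b_pos[of k] k by (intro lattice_tail_summable) auto
    have "(f k has_sum f k 0) {0}" using has_sum_finite[of "{0}" "f k"] by simp
    from has_sum_Un_disjoint[OF this has_sum_infsum[OF s]]
    show ?thesis using b_pos[of k] k by (simp add: f_def[abs_def] lattice_tail_def Compl_eq_Diff_UNIV insert_Diff_if)
  qed
  have "infsum (\<lambda>g. \<Prod>k\<in>{1..d}. f k (g k)) (PiE {1..d} (\<lambda>_. UNIV)) = (\<Prod>k\<in>{1..d}. infsum (f k) UNIV)"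
  proof (rule infsum_prod_PiE_abs)
    show "(\<lambda>h. norm (f k h)) summable_on UNIV" if "k \<in> {1..d}" for k
    proof -
      have "norm (f k h) = f k h" for h by (simp add: f_def)
      then show ?thesis using has_sum_imp_summable[OF f0[OF that]] by simp
    qed
  qed simp
  also have "\<dots> = Z d \<tau>"
    unfolding Z_def using f0 by (intro prod.cong) (auto simp: infsumI)
  finally have inf: "infsum (\<lambda>h. wt d h powr \<tau>) (freqs d) = Z d \<tau>" by (simp add: eq freqs_def)
  then have "(\<lambda>h. wt d h powr \<tau>) summable_on freqs d"
    using Z_ge_1[of d \<tau>] infsum_not_exists[of "\<lambda>h. wt d h powr \<tau>" "freqs d"] by fastforce
  then show ?thesis using inf by (simp add: has_sum_iff)
qed

lemma wt_has_sum: "(wt d has_sum Z d 1) (freqs d)"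
  using wt_powr_has_sum[of 1 d] wt_pos by (simp add: less_imp_le)

text \<open>
  Rankin's trick: the indicator of \<open>c \<le> wt d h\<close> is at most \<open>(wt d h / c)\<^sup>\<tau>\<close>, and below the threshold
  \<open>wt d h\<close> is at most \<open>c\<^sup>1\<^sup>-\<^sup>\<tau> (wt d h)\<^sup>\<tau>\<close>.
\<close>
lemma large_weights:
  fixes d :: nat
  assumes \<tau>: "0 < \<tau>" "\<tau> < 1" and c: "c > 0"
  defines "H \<equiv> {h \<in> freqs d. c \<le> wt d h}"
  shows "finite H" "real (card H) \<le> c powr (- \<tau>) * Z d \<tau>"
    "Z d 1 - sum (wt d) H \<le> c powr (1 - \<tau>) * Z d \<tau>"
proof -
  note hs = wt_powr_has_sum[OF \<tau>(1), of d]
  have fin: "real (card P) \<le> c powr (- \<tau>) * Z d \<tau>" if P: "finite P" "P \<subseteq> H" for P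
  proof -
    have "real (card P) * c powr \<tau> = (\<Sum>h\<in>P. c powr \<tau>)" by simp
    also have "\<dots> \<le> (\<Sum>h\<in>P. wt d h powr \<tau>)"
      using P c \<tau> by (intro sum_mono powr_mono2) (auto simp: H_def)
    also have "\<dots> \<le> infsum (\<lambda>h. wt d h powr \<tau>) (freqs d)"
      using P hs by (intro finite_sum_le_infsum) (auto simp: H_def has_sum_imp_summable)
    also have "\<dots> = Z d \<tau>" using hs by (rule infsumI)
    finally show ?thesis using c by (simp add: powr_minus field_simps)
  qed
  show finH: "finite H"
  proof (rule ccontr)
    assume "infinite H"
    then obtain P where P: "P \<subseteq> H" "finite P" "card P = nat \<lceil>c powr (- \<tau>) * Z d \<tau>\<rceil> + 1"
      using infinite_arbitrarily_large by blast
    have "real (card P) > c powr (- \<tau>) * Z d \<tau>" unfolding P(3) by linarith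
    then show False using fin[OF P(2,1)] by simp
  qed
  show "real (card H) \<le> c powr (- \<tau>) * Z d \<tau>" using fin[OF finH] by simp
  have s: "wt d summable_on A" if "A \<subseteq> freqs d" for A
    using wt_has_sum[of d] that by (auto intro: summable_on_subset_banach has_sum_imp_summable)
  have HF: "H \<subseteq> freqs d" by (auto simp: H_def)
  have "infsum (wt d) (H \<union> (freqs d - H)) = infsum (wt d) H + infsum (wt d) (freqs d - H)"
    using s HF by (intro infsum_Un_disjoint) auto
  then have "Z d 1 - sum (wt d) H = infsum (wt d) (freqs d - H)"
    using finH HF infsumI[OF wt_has_sum[of d]] by (simp add: Un_absorb1)
  also have "\<dots> \<le> infsum (\<lambda>h. c powr (1 - \<tau>) * wt d h powr \<tau>) (freqs d)"
  proof (rule infsum_mono_neutral)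
    show "wt d summable_on (freqs d - H)" by (rule s) auto
    show "(\<lambda>h. c powr (1 - \<tau>) * wt d h powr \<tau>) summable_on freqs d"
      using hs by (intro summable_on_cmult_right) (rule has_sum_imp_summable)
    show "wt d h \<le> c powr (1 - \<tau>) * wt d h powr \<tau>" if "h \<in> (freqs d - H) \<inter> freqs d" for h
    proof -
      have "wt d h \<le> c" using that by (auto simp: H_def)
      then have "wt d h powr (1 - \<tau>) \<le> c powr (1 - \<tau>)" using \<tau> wt_pos[of d h] by (intro powr_mono2) auto
      then have "wt d h powr (1 - \<tau>) * wt d h powr \<tau> \<le> c powr (1 - \<tau>) * wt d h powr \<tau>" by (intro mult_right_mono) auto
      then show ?thesis using wt_pos[of d h] by (simp add: powr_add[symmetric])
    qed
  qed auto
  also have "\<dots> = c powr (1 - \<tau>) * Z d \<tau>"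
    using infsumI[OF hs] by (simp add: infsum_cmult_right')
  finally show "Z d 1 - sum (wt d) H \<le> c powr (1 - \<tau>) * Z d \<tau>" .
qed

lemma sum_wt_le_Z: "finite H \<Longrightarrow> H \<subseteq> freqs d \<Longrightarrow> sum (wt d) H \<le> Z d 1"
  using finite_sum_le_infsum[of "wt d" "freqs d" H] wt_has_sum[of d] wt_pos infsumI[OF wt_has_sum]
  by (auto simp: has_sum_imp_summable less_imp_le)

end

section \<open>The eigenfunctions of the Korobov kernel\<close>

definition phase :: "nat \<Rightarrow> (nat \<Rightarrow> int) \<Rightarrow> (nat \<Rightarrow> real) \<Rightarrow> real" where
  "phase d h x = 2 * pi * (\<Sum>k=1..d. real_of_int (h k) * x k)"

text \<open>
  The kernel of the Hartley transform: a real orthonormal basis that, like the characters, is indexed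
  by all of \<open>\<int>\<^sup>d\<close>.
\<close>
definition hartley :: "nat \<Rightarrow> (nat \<Rightarrow> int) \<Rightarrow> (nat \<Rightarrow> real) \<Rightarrow> real" where
  "hartley d h x = cos (phase d h x) + sin (phase d h x)"

lemma unit_interval_character_integral:
  "(\<integral>x. iexp (2 * pi * real_of_int m * x) \<partial>unit_lebesgue) = (if m = 0 then 1 else 0)"
proof (cases "m = 0")
  case True
  then show ?thesis using unit_lebesgue.prob_space by simp
next
  case False
  define c where "c = 2 * pi * real_of_int m"
  have c: "c \<noteq> 0" using False by (simp add: c_def)
  define F where "F x = iexp (c * x) / (\<i> * c)" for x :: real
  have "(\<integral>x. iexp (c * x) \<partial>unit_lebesgue) = (\<integral>x. indicator {0..1} x *\<^sub>R iexp (c * x) \<partial>lborel)"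
    by (subst integral_restrict_space) auto
  also have "\<dots> = F 1 - F 0"
  proof (rule integral_FTC_Icc)
    show "(F has_vector_derivative iexp (c * x)) (at x within {0..1})" for x
    proof -
      have "((\<lambda>z. exp (\<i> * (c * z)) / (\<i> * c)) has_field_derivative iexp (c * x)) (at (complex_of_real x))"
        using c by (auto intro!: derivative_eq_intros simp: complex_eq_iff)
      from has_vector_derivative_real_field[OF this] show ?thesis by (simp add: F_def[abs_def])
    qed
    show "continuous_on {0..1} (\<lambda>x. iexp (c * x))" by (intro continuous_intros)
  qed simp
  also have "\<dots> = 0"
  proof -
    have "iexp c = 1"
      unfolding exp_eq_1 by (auto simp: c_def intro!: exI[of _ m])
    then show ?thesis by (simp add: F_def)
  qed
  finally show ?thesis using False by (simp add: c_def)
qed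

lemma phase_measurable: "phase d h \<in> borel_measurable (cube_lebesgue d)"
  unfolding phase_def[abs_def] by (auto intro!: borel_measurable_times borel_measurable_sum cube_coordinate_measurable)

lemma cube_character_integral:
  "(\<integral>x. iexp (phase d h x) \<partial>cube_lebesgue d) = (if \<forall>k\<in>{1..d}. h k = 0 then 1 else 0)"
proof -
  have eq: "iexp (phase d h x) = (\<Prod>k\<in>{1..d}. iexp (2 * pi * real_of_int (h k) * x k))" for x
    by (simp add: phase_def exp_sum[symmetric] sum_distrib_left mult_ac)
  have "(\<integral>x. iexp (phase d h x) \<partial>cube_lebesgue d) = (\<Prod>k\<in>{1..d}. \<integral>x. iexp (2 * pi * real_of_int (h k) * x) \<partial>unit_lebesgue)"
    unfolding eq cube_lebesgue_def
  proof (rule cube_lebesgue.product_integral_prod)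
    fix k
    show "integrable unit_lebesgue (\<lambda>x. iexp (2 * pi * real_of_int (h k) * x))"
      by (intro unit_lebesgue.integrable_const_bound[where B=1]) (auto intro!: measurable_restrict_space1)
  qed simp
  also have "\<dots> = (\<Prod>k\<in>{1..d}. if h k = 0 then 1 else 0)"
    by (simp only: unit_interval_character_integral)
  also have "\<dots> = (if \<forall>k\<in>{1..d}. h k = 0 then 1 else 0)" by (auto intro!: prod_zero)
  finally show ?thesis .
qed

lemma cube_cos_sin_integral:
  "(\<integral>x. cos (phase d h x) \<partial>cube_lebesgue d) = (if \<forall>k\<in>{1..d}. h k = 0 then 1 else 0)"
  "(\<integral>x. sin (phase d h x) \<partial>cube_lebesgue d) = 0"
proof -
  interpret Q: prob_space "cube_lebesgue d" by (rule prob_space_cube_lebesgue)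
  note [measurable] = phase_measurable
  have i: "integrable (cube_lebesgue d) (\<lambda>x. iexp (phase d h x))"
    by (intro Q.integrable_const_bound[where B=1]) auto
  have "(\<integral>x. cos (phase d h x) \<partial>cube_lebesgue d) = Re (\<integral>x. iexp (phase d h x) \<partial>cube_lebesgue d)"
    by (subst integral_Re[OF i, symmetric]) (simp add: Re_exp)
  then show "(\<integral>x. cos (phase d h x) \<partial>cube_lebesgue d) = (if \<forall>k\<in>{1..d}. h k = 0 then 1 else 0)"
    unfolding cube_character_integral by auto
  have "(\<integral>x. sin (phase d h x) \<partial>cube_lebesgue d) = Im (\<integral>x. iexp (phase d h x) \<partial>cube_lebesgue d)"
    by (subst integral_Im[OF i, symmetric]) (simp add: Im_exp)
  then show "(\<integral>x. sin (phase d h x) \<partial>cube_lebesgue d) = 0"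
    unfolding cube_character_integral by auto
qed

lemma hartley_mult:
  "hartley d h x * hartley d k y = cos (phase d h x - phase d k y) + sin (phase d h x + phase d k y)"
  by (simp add: hartley_def cos_diff sin_add algebra_simps)

lemma hartley_measurable: "hartley d h \<in> borel_measurable (cube_lebesgue d)"
proof -
  note [measurable] = phase_measurable
  show ?thesis unfolding hartley_def[abs_def] by measurable
qed

lemma hartley_bound: "\<bar>hartley d h x\<bar> \<le> 2"
  unfolding hartley_def using abs_cos_le_one[of "phase d h x"] abs_sin_le_one[of "phase d h x"] by linarith

lemma hartley_orthonormal:
  assumes "h \<in> freqs d" "k \<in> freqs d"
  shows "(\<integral>x. hartley d h x * hartley d k x \<partial>cube_lebesgue d) = (if h = k then 1 else 0)"
proof -
  interpret Q: prob_space "cube_lebesgue d" by (rule prob_space_cube_lebesgue)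
  note [measurable] = phase_measurable
  have eq: "hartley d h x * hartley d k x = cos (phase d (\<lambda>i. h i - k i) x) + sin (phase d (\<lambda>i. h i + k i) x)" for x
    unfolding hartley_mult phase_def
    by (simp add: sum.distrib sum_subtractf algebra_simps)
  have "(\<integral>x. hartley d h x * hartley d k x \<partial>cube_lebesgue d) = (if \<forall>i\<in>{1..d}. h i - k i = 0 then 1 else 0)"
    unfolding eq
    by (subst Bochner_Integration.integral_add)
       (auto simp: cube_cos_sin_integral intro!: Q.integrable_const_bound[where B=1])
  moreover have "(\<forall>i\<in>{1..d}. h i - k i = 0) \<longleftrightarrow> h = k"
    using assms by (auto simp: freqs_def PiE_iff extensional_def fun_eq_iff)
  ultimately show ?thesis by simp
qed

text \<open>
  A product of two basis functions is \<open>cos (phase h x - phase h y) + sin (phase h x + phase h y)\<close>. The sine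
  terms, like the imaginary parts on the left, are odd in \<open>h\<close> while the weights are even.
\<close>
lemma (in spectrum) hartley_expansion:
  "(\<Sum>\<^sub>\<infinity>h\<in>freqs d. complex_of_real (wt d h) * iexp (phase d h x - phase d h y))
     = complex_of_real (\<Sum>\<^sub>\<infinity>h\<in>freqs d. wt d h * (hartley d h x * hartley d h y))"
proof -
  define neg where "neg h = (\<lambda>k\<in>{1..d}. - h k)" for h :: "nat \<Rightarrow> int"
  have nb: "bij_betw neg (freqs d) (freqs d)"
  proof (rule bij_betw_byWitness[where f'=neg])
  qed (auto simp: neg_def freqs_def PiE_iff extensional_def fun_eq_iff)
  have wn: "wt d (neg h) = wt d h" for h by (simp add: wt_def neg_def)
  have pn: "phase d (neg h) z = - phase d h z" for h z by (simp add: phase_def neg_def sum_negf)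
  have ws: "wt d summable_on freqs d" using wt_has_sum has_sum_imp_summable by blast
  have sb: "(\<lambda>h. wt d h * g h) summable_on freqs d" if "\<And>h. \<bar>g h\<bar> \<le> 1" for g
  proof (rule abs_summable_summable, rule summable_on_comparison_test[OF ws])
    show "norm (wt d h * g h) \<le> wt d h" for h
      using that[of h] wt_pos[of d h] by (simp add: abs_mult mult_left_le)
  qed simp
  have odd: "(\<Sum>\<^sub>\<infinity>h\<in>freqs d. wt d h * g h) = 0" if "\<And>h. g (neg h) = - g h" for g
  proof -
    have "(\<Sum>\<^sub>\<infinity>h\<in>freqs d. wt d h * g h) = (\<Sum>\<^sub>\<infinity>h\<in>freqs d. wt d (neg h) * g (neg h))"
      using infsum_reindex_bij_betw[OF nb, of "\<lambda>h. wt d h * g h"] by simp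
    also have "\<dots> = - (\<Sum>\<^sub>\<infinity>h\<in>freqs d. wt d h * g h)"
      by (simp add: wn that infsum_uminus)
    finally show ?thesis by simp
  qed
  have cs: "(\<lambda>h. complex_of_real (wt d h) * iexp (phase d h x - phase d h y)) summable_on freqs d"
    by (rule abs_summable_summable, rule summable_on_comparison_test[OF ws])
       (use wt_pos in \<open>auto simp: norm_mult less_imp_le\<close>)
  have "Re (\<Sum>\<^sub>\<infinity>h\<in>freqs d. complex_of_real (wt d h) * iexp (phase d h x - phase d h y))
      = (\<Sum>\<^sub>\<infinity>h\<in>freqs d. wt d h * cos (phase d h x - phase d h y))"
    using infsum_Re[OF cs] by (simp add: Re_exp)
  also have "\<dots> = (\<Sum>\<^sub>\<infinity>h\<in>freqs d. wt d h * (hartley d h x * hartley d h y))"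
  proof -
    have "(\<Sum>\<^sub>\<infinity>h\<in>freqs d. wt d h * (hartley d h x * hartley d h y))
       = (\<Sum>\<^sub>\<infinity>h\<in>freqs d. wt d h * cos (phase d h x - phase d h y) + wt d h * sin (phase d h x + phase d h y))"
      by (simp add: hartley_mult distrib_left)
    also have "\<dots> = (\<Sum>\<^sub>\<infinity>h\<in>freqs d. wt d h * cos (phase d h x - phase d h y)) + (\<Sum>\<^sub>\<infinity>h\<in>freqs d. wt d h * sin (phase d h x + phase d h y))"
      by (intro infsum_add sb) auto
    also have "(\<Sum>\<^sub>\<infinity>h\<in>freqs d. wt d h * sin (phase d h x + phase d h y)) = 0"
    proof (rule odd)
      fix h
      have "phase d (neg h) x + phase d (neg h) y = - (phase d h x + phase d h y)" by (simp add: pn)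
      then show "sin (phase d (neg h) x + phase d (neg h) y) = - sin (phase d h x + phase d h y)" by (simp only: sin_minus)
    qed
    finally show ?thesis by simp
  qed
  finally have re: "Re (\<Sum>\<^sub>\<infinity>h\<in>freqs d. complex_of_real (wt d h) * iexp (phase d h x - phase d h y))
      = (\<Sum>\<^sub>\<infinity>h\<in>freqs d. wt d h * (hartley d h x * hartley d h y))" .
  have "Im (\<Sum>\<^sub>\<infinity>h\<in>freqs d. complex_of_real (wt d h) * iexp (phase d h x - phase d h y))
      = (\<Sum>\<^sub>\<infinity>h\<in>freqs d. wt d h * sin (phase d h x - phase d h y))"
    using infsum_Im[OF cs] by (simp add: Im_exp)
  also have "\<dots> = 0"
  proof (rule odd)
    fix h
    have "phase d (neg h) x - phase d (neg h) y = - (phase d h x - phase d h y)" by (simp add: pn)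
    then show "sin (phase d (neg h) x - phase d (neg h) y) = - sin (phase d h x - phase d h y)" by (simp only: sin_minus)
  qed
  finally show ?thesis using re by (simp add: complex_eq_iff)
qed

section \<open>Bounds for the information complexity\<close>

lemma ennreal_sqrt_ennreal: "0 \<le> v \<Longrightarrow> ennreal_sqrt (ennreal v) = ennreal (sqrt v)"
  by (simp add: ennreal_sqrt_def)

locale korobov_problem =
  fixes \<omega> :: real and a b :: "nat \<Rightarrow> real"
    and \<mu> :: "nat \<Rightarrow> ((nat \<Rightarrow> real) \<Rightarrow> real) measure"
  assumes omega: "0 < \<omega>" "\<omega> < 1"
    and a_pos: "0 < a 1"
    and a_mono: "\<And>k. k \<ge> 1 \<Longrightarrow> a k \<le> a (Suc k)"
    and b_pos: "\<And>k. k \<ge> 1 \<Longrightarrow> 0 < b k"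
    and b_inf: "0 < (INF k\<in>{1..}. b k)"
    and gaussian: "\<And>d. d \<ge> 1 \<Longrightarrow> centered_gaussian_measure d (\<mu> d)"
    and covariance: "\<And>d. d \<ge> 1 \<Longrightarrow> has_covariance_kernel d (\<mu> d) (korobov_kernel \<omega> a b d)"
begin

definition \<alpha> :: "nat \<Rightarrow> real" where "\<alpha> k = - ln \<omega> * a k"

lemma a_mono':
  assumes "1 \<le> j" "j \<le> k" shows "a j \<le> a k"
  using assms(2)
proof (induction rule: dec_induct)
  case (step n)
  then show ?case using a_mono[of n] assms(1) by linarith
qed simp

lemma alpha_mono: "1 \<le> j \<Longrightarrow> j \<le> k \<Longrightarrow> \<alpha> j \<le> \<alpha> k"
  using a_mono'[of j k] omega by (simp add: \<alpha>_def mult_left_mono_neg)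

lemma alpha_1_pos: "0 < \<alpha> 1"
  using omega a_pos by (simp add: \<alpha>_def mult_neg_pos)

sublocale spectrum \<alpha> b "INF k\<in>{1..}. b k"
proof
  show "0 < \<alpha> k" if "k \<ge> 1" for k
    using alpha_1_pos alpha_mono[of 1 k] that by linarith
  show "(INF k\<in>{1..}. b k) \<le> b k" if "k \<ge> 1" for k
    using that b_pos by (intro cINF_lower bdd_belowI[of _ 0]) (auto intro: less_imp_le)
qed (rule b_inf)

lemma korobov_weight_eq: "korobov_weight \<omega> a b d h = wt d h"
  using omega by (simp add: korobov_weight_def wt_def powr_def \<alpha>_def sum_distrib_left sum_distrib_right sum_negf[symmetric] mult_ac)

lemma korobov_kernel_eq:
  "korobov_kernel \<omega> a b d x y = complex_of_real (\<Sum>\<^sub>\<infinity>h\<in>freqs d. wt d h * (hartley d h x * hartley d h y))"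
proof -
  have eq: "2 * complex_of_real pi * \<i> * complex_of_real (\<Sum>k=1..d. real_of_int (h k) * (x k - y k))
      = \<i> * complex_of_real (phase d h x - phase d h y)" for h
    by (simp add: phase_def sum_subtractf right_diff_distrib algebra_simps)
  show ?thesis
    unfolding korobov_kernel_def korobov_weight_eq eq freqs_def[symmetric] by (rule hartley_expansion)
qed

lemma eigen_gaussian: "d \<ge> 1 \<Longrightarrow> eigen_gaussian d (\<mu> d) (freqs d) (wt d) (hartley d) 2"
proof
  assume d: "d \<ge> 1"
  show "centered_gaussian_measure d (\<mu> d)" using gaussian[OF d] .
  show "wt d summable_on freqs d" using wt_has_sum has_sum_imp_summable by blast
  show "(\<integral>f. f x * f y \<partial>\<mu> d) = (\<Sum>\<^sub>\<infinity>h\<in>freqs d. wt d h * (hartley d h x * hartley d h y))"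
    if "x \<in> cube d" "y \<in> cube d" for x y
    using covariance[OF d] that unfolding has_covariance_kernel_def korobov_kernel_eq of_real_eq_iff by blast
qed (auto simp: hartley_measurable hartley_bound hartley_orthonormal wt_pos)

lemma min_avg_error_0:
  assumes "d \<ge> 1" shows "min_avg_error \<mu> 0 d = ennreal (sqrt (Z d 1))"
proof -
  interpret eigen_gaussian d "\<mu> d" "freqs d" "wt d" "hartley d" 2 using eigen_gaussian[OF assms] .
  show ?thesis
    using projection_error[of "{}"] infsumI[OF wt_has_sum[of d]] Z_ge_1[of d 1]
    by (simp add: min_avg_error_def avg_error_def ennreal_sqrt_ennreal)
qed

lemma min_avg_error_le:
  assumes d: "d \<ge> 1" and H: "finite H" "H \<subseteq> freqs d"
  shows "min_avg_error \<mu> (card H) d \<le> ennreal (sqrt (Z d 1 - sum (wt d) H))"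
proof (cases "H = {}")
  case True
  then show ?thesis using min_avg_error_0[OF d] by simp
next
  case False
  interpret eigen_gaussian d "\<mu> d" "freqs d" "wt d" "hartley d" 2 using eigen_gaussian[OF d] .
  have c: "card H \<noteq> 0" using False H by simp
  have "min_avg_error \<mu> (card H) d \<le> avg_error d (\<mu> d) (\<lambda>f x. \<Sum>h\<in>H. \<xi> h f * hartley d h x)"
    using c projection_is_algorithm[OF H] by (simp add: min_avg_error_def INF_lower)
  also have "\<dots> = ennreal (sqrt (Z d 1 - sum (wt d) H))"
    using projection_error[OF H] infsumI[OF wt_has_sum[of d]] sum_wt_le_Z[OF H]
    by (simp add: avg_error_def ennreal_sqrt_ennreal)
  finally show ?thesis .
qed

lemma min_avg_error_lower:
  assumes d: "d \<ge> 1" and H: "finite H" "H \<subseteq> freqs d" and c: "c > 0" and r: "r \<ge> 0"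
    and le: "min_avg_error \<mu> n d \<le> ennreal r"
  shows "(\<Sum>h\<in>H. min (wt d h) c) - c * real n \<le> r\<^sup>2"
proof -
  interpret eigen_gaussian d "\<mu> d" "freqs d" "wt d" "hartley d" 2 using eigen_gaussian[OF d] .
  define v where "v = (\<Sum>h\<in>H. min (wt d h) c) - c * real n"
  have "ennreal (sqrt (max 0 v)) \<le> min_avg_error \<mu> n d"
  proof (cases "n = 0")
    case True
    have "v \<le> sum (wt d) H" using True by (auto simp: v_def intro!: sum_mono)
    then have "max 0 v \<le> Z d 1" using sum_wt_le_Z[OF H] Z_ge_1[of d 1] by auto
    then show ?thesis using True min_avg_error_0[OF d] by (simp add: ennreal_leI)
  next
    case False
    have "ennreal (sqrt (max 0 v)) \<le> avg_error d (\<mu> d) A" if A: "A \<in> algorithms n d" for A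
    proof -
      have "ennreal v \<le> (\<integral>\<^sup>+f. ennreal ((L2_norm d (\<lambda>x. f x - A f x))\<^sup>2) \<partial>\<mu> d)" (is "_ \<le> ?I")
        unfolding v_def using algorithm_error_ge[OF H c A] .
      then have I: "ennreal (max 0 v) \<le> ?I" by (simp add: ennreal_max_0)
      show ?thesis
      proof (cases ?I)
        case (real w)
        then show ?thesis using I by (simp add: avg_error_def ennreal_sqrt_ennreal ennreal_leI)
      qed (simp add: avg_error_def ennreal_sqrt_def)
    qed
    then show ?thesis using False by (auto simp: min_avg_error_def intro: INF_greatest)
  qed
  then have "ennreal (sqrt (max 0 v)) \<le> ennreal r" using le by (rule order_trans)
  then have "sqrt (max 0 v) \<le> r" using r by (simp add: ennreal_le_iff)
  then have "max 0 v \<le> r\<^sup>2" by (rule sqrt_le_D)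
  then show ?thesis by (simp add: v_def)
qed

definition cri :: "criterion \<Rightarrow> nat \<Rightarrow> real" where
  "cri X d = (case X of ABS \<Rightarrow> 1 | NOR \<Rightarrow> sqrt (Z d 1))"

lemma CRI_eq: "d \<ge> 1 \<Longrightarrow> CRI X \<mu> d = ennreal (cri X d)"
  by (cases X) (auto simp: CRI_def cri_def min_avg_error_0)

lemma cri_ge_1: "1 \<le> cri X d"
  using Z_ge_1[of d 1] by (cases X) (auto simp: cri_def)

lemma cri_square_le: "(cri X d)\<^sup>2 \<le> Z d 1"
  using Z_ge_1[of d 1] by (cases X) (auto simp: cri_def)

context
  fixes \<epsilon> :: real and d :: nat and X :: criterion
  assumes eps: "0 < \<epsilon>" "\<epsilon> < 1" and d: "d \<ge> 1"
begin

lemma info_complexity_eq: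
  "info_complexity X \<mu> \<epsilon> d = (LEAST n. min_avg_error \<mu> n d \<le> ennreal (\<epsilon> * cri X d))"
  using eps cri_ge_1[of X d] by (simp add: info_complexity_def CRI_eq[OF d] ennreal_mult)

lemma rhs_nonneg:
  assumes \<tau>: "0 < \<tau>" "\<tau> < 1"
  shows "0 \<le> (ln (Z d \<tau>) + 2 * \<tau> * ln (1 / \<epsilon>)) / (1 - \<tau>)"
proof -
  have "0 \<le> ln (Z d \<tau>)" using Z_ge_1 by (rule ln_ge_zero)
  moreover have "0 \<le> ln (1 / \<epsilon>)" using eps by (intro ln_ge_zero) simp
  ultimately show ?thesis using \<tau> by (intro divide_nonneg_pos add_nonneg_nonneg mult_nonneg_nonneg) auto
qed

text \<open>
  Cutting at a threshold \<open>c\<close> costs at most \<open>c\<^sup>-\<^sup>\<tau> Z d \<tau>\<close> functionals and leaves a squared error of at most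
  \<open>c\<^sup>1\<^sup>-\<^sup>\<tau> Z d \<tau>\<close>; the threshold below makes the latter equal to \<open>\<epsilon>\<^sup>2\<close>.
\<close>
lemma sufficient_information:
  assumes \<tau>: "0 < \<tau>" "\<tau> < 1"
  shows "\<exists>n. min_avg_error \<mu> n d \<le> ennreal (\<epsilon> * cri X d) \<and>
             ln (real n) \<le> (ln (Z d \<tau>) + 2 * \<tau> * ln (1 / \<epsilon>)) / (1 - \<tau>)"
proof -
  define c where "c = (\<epsilon>\<^sup>2 / Z d \<tau>) powr (1 / (1 - \<tau>))"
  have Z: "Z d \<tau> \<ge> 1" by (rule Z_ge_1)
  have c: "c > 0" using eps Z by (auto simp: c_def)
  define H where "H = {h \<in> freqs d. c \<le> wt d h}"
  note H = large_weights[OF \<tau> c, of d, folded H_def]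
  have "c powr (1 - \<tau>) * Z d \<tau> = \<epsilon>\<^sup>2"
    using eps Z \<tau> by (simp add: c_def powr_powr)
  then have "sqrt (Z d 1 - sum (wt d) H) \<le> sqrt (\<epsilon>\<^sup>2)" using H(3) by (intro real_sqrt_le_mono) simp
  also have "\<dots> = \<epsilon> * 1" using eps by simp
  also have "\<dots> \<le> \<epsilon> * cri X d" using eps cri_ge_1[of X d] by (intro mult_left_mono) auto
  finally have "min_avg_error \<mu> (card H) d \<le> ennreal (\<epsilon> * cri X d)"
    using min_avg_error_le[OF d H(1)] by (auto simp: H_def intro: order_trans ennreal_leI)
  moreover note rhs_nonneg = rhs_nonneg[OF \<tau>]
  have "ln (real (card H)) \<le> (ln (Z d \<tau>) + 2 * \<tau> * ln (1 / \<epsilon>)) / (1 - \<tau>)"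
  proof (cases "card H = 0")
    case True
    then show ?thesis using rhs_nonneg by simp
  next
    case False
    then have "ln (real (card H)) \<le> ln (c powr (- \<tau>) * Z d \<tau>)" using H(2) by (subst ln_le_cancel_iff) auto
    also have "\<dots> = - \<tau> * ln c + ln (Z d \<tau>)" using c Z by (simp add: ln_mult ln_powr)
    also have "ln c = (ln (\<epsilon>\<^sup>2) - ln (Z d \<tau>)) / (1 - \<tau>)"
      using eps Z by (simp add: c_def ln_powr ln_div)
    also have "ln (\<epsilon>\<^sup>2) = - 2 * ln (1 / \<epsilon>)" using eps by (simp add: ln_realpow ln_div)
    also have "- \<tau> * ((- 2 * ln (1 / \<epsilon>) - ln (Z d \<tau>)) / (1 - \<tau>)) + ln (Z d \<tau>) = (ln (Z d \<tau>) + 2 * \<tau> * ln (1 / \<epsilon>)) / (1 - \<tau>)"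
      using \<tau> by (simp add: field_simps)
    finally show ?thesis .
  qed
  ultimately show ?thesis by blast
qed

text \<open>
  The least \<open>n\<close> in the definition exists because the errors tend to zero.
\<close>
lemma info_complexity_attained:
  "min_avg_error \<mu> (info_complexity X \<mu> \<epsilon> d) d \<le> ennreal (\<epsilon> * cri X d)"
proof -
  obtain n where n: "min_avg_error \<mu> n d \<le> ennreal (\<epsilon> * cri X d)"
    using sufficient_information[of "1/2"] by auto
  show ?thesis unfolding info_complexity_eq by (rule LeastI[where P="\<lambda>n. min_avg_error \<mu> n d \<le> ennreal (\<epsilon> * cri X d)", OF n])
qed

lemma info_complexity_lower:
  assumes "finite H" "H \<subseteq> freqs d" "c > 0"
  shows "(\<Sum>h\<in>H. min (wt d h) c) - c * real (info_complexity X \<mu> \<epsilon> d) \<le> \<epsilon>\<^sup>2 * (cri X d)\<^sup>2"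
  using min_avg_error_lower[OF d assms _ info_complexity_attained] eps cri_ge_1[of X d]
  by (simp add: power_mult_distrib)

lemma ln_info_complexity_upper:
  assumes \<tau>: "0 < \<tau>" "\<tau> < 1"
  shows "ln (real (info_complexity X \<mu> \<epsilon> d)) \<le> (ln (Z d \<tau>) + 2 * \<tau> * ln (1 / \<epsilon>)) / (1 - \<tau>)"
proof (cases "info_complexity X \<mu> \<epsilon> d = 0")
  case True
  then show ?thesis using rhs_nonneg[OF \<tau>] by simp
next
  case False
  obtain n where n: "min_avg_error \<mu> n d \<le> ennreal (\<epsilon> * cri X d)"
      "ln (real n) \<le> (ln (Z d \<tau>) + 2 * \<tau> * ln (1 / \<epsilon>)) / (1 - \<tau>)"
    using sufficient_information[OF \<tau>] by blast
  have "info_complexity X \<mu> \<epsilon> d \<le> n" unfolding info_complexity_eq using n(1) by (rule Least_le)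
  then have "ln (real (info_complexity X \<mu> \<epsilon> d)) \<le> ln (real n)" using False by (subst ln_le_cancel_iff) auto
  then show ?thesis using n(2) by linarith
qed

end

end

section \<open>Elementary inequalities\<close>

lemma powr_absorb:
  fixes p q K \<delta> :: real
  assumes "0 < p" "p < q" "K \<ge> 0" "\<delta> > 0"
  shows "\<exists>C\<ge>0. \<forall>y\<ge>0. K * y powr p \<le> \<delta> * y powr q + C"
proof -
  define Y where "Y = (K / \<delta>) powr (1 / (q - p))"
  have "K * y powr p \<le> \<delta> * y powr q + K * Y powr p" if y: "y \<ge> 0" for y
  proof (cases "y \<le> Y")
    case True
    then have "K * y powr p \<le> K * Y powr p" using assms y by (intro mult_left_mono powr_mono2) auto
    then show ?thesis using assms by (simp add: add_increasing)
  next
    case False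
    then have y0: "y > 0" using y by (smt (verit) Y_def powr_ge_zero)
    have "K / \<delta> = Y powr (q - p)" using assms by (simp add: Y_def powr_powr)
    also have "\<dots> \<le> y powr (q - p)" using False assms by (intro powr_mono2) (auto simp: Y_def)
    finally have "K \<le> \<delta> * y powr (q - p)" using assms by (simp add: field_simps)
    then have "K * y powr p \<le> (\<delta> * y powr (q - p)) * y powr p" by (intro mult_right_mono) auto
    also have "\<dots> = \<delta> * y powr q" using y0 by (simp add: powr_add[symmetric] mult.assoc)
    finally show ?thesis using assms by (simp add: add_increasing2)
  qed
  then show ?thesis using assms by (intro exI[of _ "K * Y powr p"]) auto
qed

lemma one_plus_powr_le:
  fixes x p :: real
  assumes "x \<ge> 0" "0 < p" "p \<le> 1"
  shows "(1 + x) powr p \<le> 2 * (1 + x powr p)"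
proof -
  have "(1 + x) powr p \<le> (2 * max 1 x) powr p" using assms by (intro powr_mono2) auto
  also have "\<dots> = 2 powr p * max 1 x powr p" using assms by (simp add: powr_mult)
  also have "\<dots> \<le> 2 * (1 + x powr p)"
  proof (intro mult_mono)
    show "2 powr p \<le> (2::real)" using assms powr_mono[of p 1 "2::real"] by simp
    show "max 1 x powr p \<le> 1 + x powr p" by (simp add: max_def)
  qed auto
  finally show ?thesis .
qed

lemma sum_le_small_slope:
  fixes v :: "nat \<Rightarrow> real"
  assumes "v \<longlonglongrightarrow> 0" "\<And>k. 0 \<le> v k" "\<delta> > 0"
  shows "\<exists>C\<ge>0. \<forall>d. (\<Sum>k=1..d. v k) \<le> \<delta> * real d + C"
proof -
  obtain K where K: "\<And>k. k \<ge> K \<Longrightarrow> v k < \<delta>"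
    using order_tendstoD(2)[OF assms(1,3)] unfolding eventually_sequentially by auto
  have "(\<Sum>k=1..d. v k) \<le> \<delta> * real d + (\<Sum>k<K. v k)" for d
  proof -
    have "(\<Sum>k=1..d. v k) \<le> (\<Sum>k=1..d. \<delta> + (if k < K then v k else 0))"
      using K assms by (intro sum_mono) (auto simp: not_less less_imp_le)
    also have "\<dots> = \<delta> * real d + (\<Sum>k\<in>{1..d} \<inter> {..<K}. v k)"
      by (simp add: sum.distrib sum.If_cases lessThan_def)
    also have "(\<Sum>k\<in>{1..d} \<inter> {..<K}. v k) \<le> (\<Sum>k<K. v k)"
      using assms by (intro sum_mono2) auto
    finally show ?thesis by simp
  qed
  then show ?thesis using assms by (intro exI[of _ "\<Sum>k<K. v k"]) (auto intro: sum_nonneg)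
qed

lemma sum_inverse_sqrt_le: "(\<Sum>k=1..n. 1 / sqrt (real k)) \<le> 2 * sqrt (real n)"
proof (induction n)
  case (Suc n)
  have "1 / sqrt (real (Suc n)) \<le> 2 * (sqrt (real (Suc n)) - sqrt (real n))"
  proof -
    define u v where "u = sqrt (real (Suc n))" and "v = sqrt (real n)"
    have uv: "0 < u" "v \<le> u" by (simp_all add: u_def v_def)
    have "u\<^sup>2 = v\<^sup>2 + 1" by (simp add: u_def v_def)
    then have "1 = (u - v) * (u + v)" by (simp add: power2_eq_square algebra_simps)
    also have "\<dots> \<le> (u - v) * (2 * u)" using uv by (intro mult_left_mono) auto
    finally have "1 \<le> 2 * (u - v) * u" by (simp add: mult_ac)
    then show ?thesis using uv by (simp only: u_def[symmetric] v_def[symmetric] pos_divide_le_eq)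
  qed
  then show ?case using Suc by simp
qed simp

lemma sum_inverse_squares_le: "(\<Sum>k=Suc n..d. 1 / (real k)\<^sup>2) \<le> 2 / real (Suc n) "
proof -
  have "(\<Sum>k=Suc n..<Suc n + m. 1 / (real k)\<^sup>2) \<le> 2 / real (Suc n) - 2 / real (Suc n + m)" for m
  proof (induction m)
    case (Suc m)
    define x where "x = real (Suc n + m)"
    have x: "x \<ge> 1" by (simp add: x_def)
    have "1 / x\<^sup>2 \<le> 2 / x - 2 / (x + 1)"
      using x by (simp add: divide_simps power2_eq_square)
    then show ?case using Suc by (simp add: x_def add_ac)
  qed simp
  from this[of "Suc d - Suc n"] show ?thesis
    by (cases "n \<le> d") (auto simp: atLeastLessThanSuc_atLeastAtMost intro: order_trans)
qed

text \<open>
  The square root is summed up to \<open>k = W\<close> and the square beyond; each part is at most \<open>2 W\<close>.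
\<close>
lemma sum_min_sqrt_square_le:
  fixes W :: real
  assumes "W > 0"
  shows "(\<Sum>k=1..d. min (sqrt (W / real k)) ((W / real k)\<^sup>2)) \<le> 4 * W"
proof -
  define n where "n = nat \<lfloor>W\<rfloor>"
  have n: "real n \<le> W" "W < real (Suc n)" using assms by (auto simp: n_def) linarith
  define f where "f k = min (sqrt (W / real k)) ((W / real k)\<^sup>2)" for k
  have f0: "f k \<ge> 0" for k using assms by (simp add: f_def)
  have "(\<Sum>k=1..d. f k) \<le> (\<Sum>k\<in>{1..n} \<union> {Suc n..d}. f k)"
    using f0 by (intro sum_mono2) auto
  also have "\<dots> = (\<Sum>k=1..n. f k) + (\<Sum>k=Suc n..d. f k)" by (intro sum.union_disjoint) auto
  also have "(\<Sum>k=1..n. f k) \<le> (\<Sum>k=1..n. sqrt W * (1 / sqrt (real k)))"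
    by (intro sum_mono) (auto simp: f_def real_sqrt_divide)
  also have "\<dots> \<le> sqrt W * (2 * sqrt (real n))"
    unfolding sum_distrib_left[symmetric] using assms by (intro mult_left_mono sum_inverse_sqrt_le) auto
  also have "\<dots> \<le> sqrt W * (2 * sqrt W)" using n assms by (intro mult_left_mono) auto
  also have "\<dots> = 2 * W" using assms by simp
  also have "(\<Sum>k=Suc n..d. f k) \<le> (\<Sum>k=Suc n..d. W\<^sup>2 * (1 / (real k)\<^sup>2))"
    by (intro sum_mono) (auto simp: f_def power_divide)
  also have "\<dots> \<le> W\<^sup>2 * (2 / real (Suc n))"
    unfolding sum_distrib_left[symmetric] using assms by (intro mult_left_mono sum_inverse_squares_le) auto
  also have "\<dots> \<le> W\<^sup>2 * (2 / W)" using n assms by (intro mult_left_mono divide_left_mono) auto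
  also have "\<dots> = 2 * W" using assms by (simp add: power2_eq_square)
  finally show ?thesis by (simp add: f_def)
qed

lemma sum_powr_le:
  fixes p :: real
  assumes "0 < p" "p \<le> 1"
  shows "(\<Sum>k=1..d. real k powr (p - 1)) \<le> real d powr p / p"
proof (induction d)
  case (Suc d)
  define x where "x = real (Suc d)"
  have x: "x \<ge> 1" "real d = x - 1" by (auto simp: x_def)
  have "p * x powr (p - 1) \<le> x powr p - (x - 1) powr p"
  proof (cases "x = 1")
    case True then show ?thesis using assms by simp
  next
    case False
    then have y: "0 < (x - 1) / x" using x by simp
    have "((x - 1) / x) powr p * 1 powr (1 - p) \<le> p * ((x - 1) / x) + (1 - p) * 1"
      using assms y by (intro Youngs_inequality_0) auto
    then have "((x - 1) / x) powr p \<le> 1 - p / x" using x by (simp add: field_simps)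
    then have "x powr p * ((x - 1) / x) powr p \<le> x powr p * (1 - p / x)" by (intro mult_left_mono) auto
    then have "(x - 1) powr p \<le> x powr p * (1 - p / x)" using x False by (simp add: powr_divide)
    also have "\<dots> = x powr p - p * x powr (p - 1)" using x by (simp add: powr_diff field_simps)
    finally show ?thesis by simp
  qed
  then have "x powr (p - 1) \<le> x powr p / p - (x - 1) powr p / p" using assms by (simp add: field_simps)
  moreover have "(\<Sum>k=1..Suc d. real k powr (p - 1)) = (\<Sum>k=1..d. real k powr (p - 1)) + x powr (p - 1)"
    by (simp add: x_def)
  ultimately show ?case using Suc unfolding x(2) x_def[symmetric] by linarith
qed (use assms in simp)

lemma xexp_decreasing:
  fixes v w :: real
  assumes "1 \<le> v" "v \<le> w"
  shows "w * exp (- w) \<le> v * exp (- v)"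
proof -
  have "w / v = 1 + (w - v) / v" using assms by (simp add: field_simps)
  also have "\<dots> \<le> 1 + (w - v)"
    using assms divide_left_mono[of 1 v "w - v"] by simp
  also have "\<dots> \<le> exp (w - v)" by (rule exp_ge_add_one_self)
  finally have "w \<le> v * exp (w - v)" using assms by (simp add: field_simps)
  then have "w * exp (- w) \<le> (v * exp (w - v)) * exp (- w)" by (intro mult_right_mono) auto
  then show ?thesis by (simp add: mult.assoc exp_add[symmetric])
qed

lemma one_minus_exp_ge:
  fixes v :: real
  assumes "0 \<le> v" "v \<le> 1"
  shows "v / 2 \<le> 1 - exp (- v)"
proof -
  have "exp (- v) \<le> 1 / (1 + v)"
    using exp_ge_add_one_self[of v] assms by (simp add: exp_minus field_simps)
  also have "\<dots> \<le> 1 - v / 2"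
    using assms mult_left_mono[of v 1 v] by (simp add: field_simps)
  finally show ?thesis by simp
qed

section \<open>Unfolding the definition of tractability\<close>

lemma eventually_eps_dim_filter:
  "eventually P eps_dim_filter \<longleftrightarrow>
     (\<exists>B. \<forall>\<epsilon> d. 0 < \<epsilon> \<and> \<epsilon> < 1 \<and> d \<ge> 1 \<and> 1 / \<epsilon> + real d \<ge> B \<longrightarrow> P (\<epsilon>, d))"
  unfolding eps_dim_filter_def eventually_inf_principal eventually_filtercomap_at_top_linorder
  by (auto simp: greaterThanLessThan_iff)

text \<open>
  The additive constant is harmless because \<open>ln (1/\<epsilon>)\<^sup>s + d\<^sup>t\<close> tends to infinity along the filter.
\<close>
lemma EC_st_WT_I:
  assumes st: "s > 0" "t > 0"
    and bound: "\<And>\<delta>. \<delta> > 0 \<Longrightarrow> \<exists>C. \<forall>\<epsilon> d. 0 < \<epsilon> \<longrightarrow> \<epsilon> < 1 \<longrightarrow> d \<ge> 1 \<longrightarrow>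
       ln (real (info_complexity X \<mu> \<epsilon> d)) \<le> \<delta> * (ln (1 / \<epsilon>) powr s + real d powr t) + C"
  shows "EC_st_WT X \<mu> s t"
  unfolding EC_st_WT_def
proof (rule tendstoI)
  fix e :: real assume e: "e > 0"
  obtain C where C: "\<And>\<epsilon> d. 0 < \<epsilon> \<Longrightarrow> \<epsilon> < 1 \<Longrightarrow> d \<ge> 1 \<Longrightarrow>
       ln (real (info_complexity X \<mu> \<epsilon> d)) \<le> e / 2 * (ln (1 / \<epsilon>) powr s + real d powr t) + C"
    using bound[of "e / 2"] e by auto
  define K where "K = max 1 (2 * \<bar>C\<bar> / e + 1)"
  have K: "K \<ge> 1" "K > 2 * C / e" using e by (auto simp: K_def max_def divide_simps)
  define B where "B = 2 * max (exp (K powr (1 / s))) (K powr (1 / t))"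
  have main: "dist (ln (real (info_complexity X \<mu> \<epsilon> d)) / (ln (1 / \<epsilon>) powr s + real d powr t)) 0 < e"
    if \<epsilon>: "0 < \<epsilon>" "\<epsilon> < 1" and d: "d \<ge> 1" and ge: "1 / \<epsilon> + real d \<ge> B" for \<epsilon> d
  proof -
    define D where "D = ln (1 / \<epsilon>) powr s + real d powr t"
    have DK: "D \<ge> K"
    proof (cases "1 / \<epsilon> \<ge> B / 2")
      case True
      then have "exp (K powr (1 / s)) \<le> 1 / \<epsilon>" by (simp add: B_def)
      then have "K powr (1 / s) \<le> ln (1 / \<epsilon>)" using \<epsilon> by (subst ln_ge_iff) auto
      then have "(K powr (1 / s)) powr s \<le> ln (1 / \<epsilon>) powr s" using st by (intro powr_mono2) auto
      then have "K \<le> ln (1 / \<epsilon>) powr s" using K st by (simp add: powr_powr)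
      then show ?thesis by (simp add: D_def add_increasing2)
    next
      case False
      then have "real d \<ge> B / 2" using ge by linarith
      then have "K powr (1 / t) \<le> real d" by (simp add: B_def)
      then have "(K powr (1 / t)) powr t \<le> real d powr t" using st by (intro powr_mono2) auto
      then have "K \<le> real d powr t" using K st by (simp add: powr_powr)
      then show ?thesis by (simp add: D_def add_increasing)
    qed
    have D0: "D > 0" using DK K by linarith
    have n0: "0 \<le> ln (real (info_complexity X \<mu> \<epsilon> d))"
      by (cases "info_complexity X \<mu> \<epsilon> d") auto
    have "C < e / 2 * K" using K(2) e by (simp add: field_simps)
    also have "\<dots> \<le> e / 2 * D" using DK e by (intro mult_left_mono) auto
    finally have "ln (real (info_complexity X \<mu> \<epsilon> d)) < e * D"
      using C[OF \<epsilon> d] by (simp add: D_def[symmetric])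
    then have "ln (real (info_complexity X \<mu> \<epsilon> d)) / D < e" using D0 by (simp add: pos_divide_less_eq)
    moreover have "0 \<le> ln (real (info_complexity X \<mu> \<epsilon> d)) / D" using n0 D0 by simp
    ultimately show ?thesis by (simp add: D_def)
  qed
  show "\<forall>\<^sub>F p in eps_dim_filter. dist (case p of (\<epsilon>, d) \<Rightarrow>
      ln (real (info_complexity X \<mu> \<epsilon> d)) / (ln (1 / \<epsilon>) powr s + real d powr t)) 0 < e"
    unfolding eventually_eps_dim_filter using main by (intro exI[of _ B]) auto
qed

text \<open>
  For large \<open>d\<close> the bound is uniform in \<open>\<epsilon>\<close>, so \<open>\<epsilon>\<close> may be chosen depending on \<open>d\<close>.
\<close>
lemma EC_st_WT_D:
  assumes "EC_st_WT X \<mu> s t" "\<delta> > 0"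
  shows "\<exists>N\<ge>1. \<forall>\<epsilon> d. 0 < \<epsilon> \<longrightarrow> \<epsilon> < 1 \<longrightarrow> d \<ge> N \<longrightarrow>
       ln (real (info_complexity X \<mu> \<epsilon> d)) \<le> \<delta> * (ln (1 / \<epsilon>) powr s + real d powr t)"
proof -
  from tendstoD[OF assms(1)[unfolded EC_st_WT_def] assms(2)] obtain B where
    B: "\<And>\<epsilon> d. 0 < \<epsilon> \<Longrightarrow> \<epsilon> < 1 \<Longrightarrow> d \<ge> 1 \<Longrightarrow> 1 / \<epsilon> + real d \<ge> B \<Longrightarrow>
      dist (ln (real (info_complexity X \<mu> \<epsilon> d)) / (ln (1 / \<epsilon>) powr s + real d powr t)) 0 < \<delta>"
    unfolding eventually_eps_dim_filter by auto
  define N where "N = max 1 (nat \<lceil>B\<rceil>)"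
  have "ln (real (info_complexity X \<mu> \<epsilon> d)) \<le> \<delta> * (ln (1 / \<epsilon>) powr s + real d powr t)"
    if \<epsilon>: "0 < \<epsilon>" "\<epsilon> < 1" and d: "d \<ge> N" for \<epsilon> d
  proof -
    have d1: "d \<ge> 1" using d by (simp add: N_def)
    have "real d \<ge> B" using d by (simp add: N_def)
    then have "1 / \<epsilon> + real d \<ge> B" using \<epsilon> by (simp add: add_increasing)
    note lt = B[OF \<epsilon> d1 this]
    have "real d powr t > 0" using d1 by simp
    then have "ln (1 / \<epsilon>) powr s + real d powr t > 0" by (simp add: add_nonneg_pos)
    then show ?thesis using lt by (simp add: dist_real_def divide_simps abs_less_iff)
  qed
  then show ?thesis by (intro exI[of _ N]) (auto simp: N_def)
qed

lemma not_tendsto_zero_frequently: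
  fixes f :: "nat \<Rightarrow> real"
  assumes "\<not> f \<longlonglongrightarrow> 0"
  shows "\<exists>e>0. \<forall>N. \<exists>j\<ge>N. \<bar>f j\<bar> \<ge> e"
  using assms unfolding LIMSEQ_iff by (auto simp: not_less)

context korobov_problem begin

abbreviation N :: "criterion \<Rightarrow> real \<Rightarrow> nat \<Rightarrow> nat" where
  "N X \<epsilon> d \<equiv> info_complexity X \<mu> \<epsilon> d"

abbreviation b_min :: real where "b_min \<equiv> (INF k\<in>{1..}. b k)"

section \<open>Consequences of the two bounds\<close>

lemma alpha_ge: "k \<ge> 1 \<Longrightarrow> \<alpha> 1 \<le> \<alpha> k" using alpha_mono[of 1 k] by simp

lemma ln_Z_le_exp_sum:
  assumes "\<tau>0 > 0"
  shows "\<exists>C>0. \<forall>\<tau>\<ge>\<tau>0. \<forall>d. ln (Z d \<tau>) \<le> C * (\<Sum>k=1..d. exp (- (\<tau> * \<alpha> k)))"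
proof -
  define u0 where "u0 = \<tau>0 * \<alpha> 1"
  define C where "C = exp u0 * lattice_tail u0 b_min"
  have u0: "u0 > 0" using assms alpha_1_pos by (simp add: u0_def)
  have "0 < lattice_tail u0 b_min"
    using lattice_tail_ge[OF u0 b0_pos] exp_gt_zero[of "- u0"] by linarith
  then have C: "C > 0" by (simp add: C_def)
  have "ln (Z d \<tau>) \<le> C * (\<Sum>k=1..d. exp (- (\<tau> * \<alpha> k)))" if \<tau>: "\<tau> \<ge> \<tau>0" for \<tau> d
    unfolding ln_Z sum_distrib_left
  proof (rule sum_mono)
    fix k assume k: "k \<in> {1..d}"
    have "u0 \<le> \<tau> * \<alpha> k"
      unfolding u0_def using assms \<tau> alpha_ge[of k] alpha_1_pos k by (intro mult_mono) auto
    then have "lattice_tail (\<tau> * \<alpha> k) (b k) \<le> C * exp (- (\<tau> * \<alpha> k))"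
      unfolding C_def using u0 b0_pos b_ge[of k] k by (intro lattice_tail_le_exp) auto
    moreover have "ln (1 + lattice_tail (\<tau> * \<alpha> k) (b k)) \<le> lattice_tail (\<tau> * \<alpha> k) (b k)"
      by (rule ln_add_one_self_le_self) (rule lattice_tail_nonneg)
    ultimately show "ln (1 + lattice_tail (\<tau> * \<alpha> k) (b k)) \<le> C * exp (- (\<tau> * \<alpha> k))" by linarith
  qed
  then show ?thesis using C by blast
qed

lemma ln_N_le:
  assumes "0 < \<epsilon>" "\<epsilon> < 1" "d \<ge> 1" "0 < \<tau>" "\<tau> \<le> 1 / 2"
  shows "ln (real (N X \<epsilon> d)) \<le> 2 * ln (Z d \<tau>) + 4 * (\<tau> * ln (1 / \<epsilon>))"
proof -
  have A: "0 \<le> ln (Z d \<tau>) + 2 * \<tau> * ln (1 / \<epsilon>)"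
    using assms Z_ge_1[of d \<tau>] by (intro add_nonneg_nonneg ln_ge_zero mult_nonneg_nonneg) auto
  have "ln (real (N X \<epsilon> d)) \<le> (ln (Z d \<tau>) + 2 * \<tau> * ln (1 / \<epsilon>)) / (1 - \<tau>)"
    using assms by (intro ln_info_complexity_upper) auto
  also have "\<dots> \<le> (ln (Z d \<tau>) + 2 * \<tau> * ln (1 / \<epsilon>)) / (1 / 2)"
    using A assms by (intro divide_left_mono) auto
  finally show ?thesis by simp
qed

lemma N_lower:
  assumes "0 < \<epsilon>" "\<epsilon> < 1" "d \<ge> 1" "c > 0"
    and g: "\<And>h. h \<in> freqs d \<Longrightarrow> g h \<le> min (wt d h) c" "(g has_sum G) (freqs d)"
  shows "G - c * real (N X \<epsilon> d) \<le> \<epsilon>\<^sup>2 * (cri X d)\<^sup>2"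
proof -
  have "G \<le> c * real (N X \<epsilon> d) + \<epsilon>\<^sup>2 * (cri X d)\<^sup>2"
  proof (rule has_sum_le_finite_sums[OF g(2)])
    fix H assume H: "finite H" "H \<subseteq> freqs d"
    have "sum g H \<le> (\<Sum>h\<in>H. min (wt d h) c)" using g(1) H by (intro sum_mono) auto
    then show "sum g H \<le> c * real (N X \<epsilon> d) + \<epsilon>\<^sup>2 * (cri X d)\<^sup>2"
      using info_complexity_lower[OF assms(1-3) H assms(4), of X] by linarith
  qed
  then show ?thesis by simp
qed

lemma N_ge_trace:
  assumes "0 < \<epsilon>" "\<epsilon> < 1" "d \<ge> 1"
  shows "(1 - \<epsilon>\<^sup>2) * Z d 1 \<le> real (N X \<epsilon> d)"
proof -
  have "Z d 1 - 1 * real (N X \<epsilon> d) \<le> \<epsilon>\<^sup>2 * (cri X d)\<^sup>2"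
    using assms wt_le_1 by (intro N_lower[where g="wt d"] wt_has_sum) auto
  also have "\<dots> \<le> \<epsilon>\<^sup>2 * Z d 1" using cri_square_le by (intro mult_left_mono) auto
  finally show ?thesis by (simp add: left_diff_distrib)
qed

text \<open>
  If \<open>n < card H\<close>, at least one unit of \<open>c\<close> remains in \<open>(\<Sum>h\<in>H. min (wt d h) c) - c n\<close>.
\<close>
lemma N_ge_card:
  assumes "0 < \<epsilon>" "\<epsilon> < 1" "d \<ge> 1" "c > 0" and H: "finite H" "H \<subseteq> freqs d"
    and ge: "\<And>h. h \<in> H \<Longrightarrow> c \<le> wt d h" and small: "\<epsilon>\<^sup>2 * (cri X d)\<^sup>2 < c"
  shows "card H \<le> N X \<epsilon> d"
proof -
  have "(\<Sum>h\<in>H. min (wt d h) c) = (\<Sum>h\<in>H. c)" using ge by (intro sum.cong) auto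
  then have "real (card H) * c - c * real (N X \<epsilon> d) < c"
    using info_complexity_lower[OF assms(1-3) H assms(4), of X] small by simp
  then have "c * (real (card H) - real (N X \<epsilon> d)) < c * 1" by (simp add: algebra_simps)
  then have "real (card H) - real (N X \<epsilon> d) < 1" using assms(4) by simp
  then show ?thesis by linarith
qed

text \<open>
  By Markov's inequality for the \<open>\<theta>\<close>-th moment of \<open>wt d h / c\<close>, under the distribution proportional to
  the weights, the weights below \<open>c\<close> sum to at least \<open>Z d 1 - c powr (- \<theta>) * Z d (1 + \<theta>)\<close>.
\<close>
lemma N_ge_Chernoff:
  assumes "0 < \<epsilon>" "\<epsilon> < 1" "d \<ge> 1" "c > 0" "\<theta> > 0"
  shows "Z d 1 - c powr (- \<theta>) * Z d (1 + \<theta>) - c * real (N X \<epsilon> d) \<le> \<epsilon>\<^sup>2 * (cri X d)\<^sup>2"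
proof (rule N_lower[OF assms(1-4), where g="\<lambda>h. wt d h - c powr (- \<theta>) * wt d h powr (1 + \<theta>)"])
  show "((\<lambda>h. wt d h - c powr (- \<theta>) * wt d h powr (1 + \<theta>)) has_sum Z d 1 - c powr (- \<theta>) * Z d (1 + \<theta>)) (freqs d)"
    unfolding diff_conv_add_uminus using assms
    by (intro has_sum_add has_sum_uminusI wt_has_sum has_sum_cmult_right wt_powr_has_sum) auto
  fix h
  have w: "wt d h > 0" by (rule wt_pos)
  have eq: "c powr (- \<theta>) * wt d h powr (1 + \<theta>) = wt d h * (wt d h / c) powr \<theta>"
    using w assms by (simp add: powr_add powr_divide powr_minus field_simps)
  show "wt d h - c powr (- \<theta>) * wt d h powr (1 + \<theta>) \<le> min (wt d h) c"
  proof (cases "wt d h \<le> c")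
    case True
    then show ?thesis using w unfolding eq by simp
  next
    case False
    then have "1 \<le> (wt d h / c) powr \<theta>" using assms by (intro ge_one_powr_ge_zero) auto
    then have "wt d h * 1 \<le> wt d h * (wt d h / c) powr \<theta>" using w by (intro mult_left_mono) auto
    moreover have "0 \<le> min (wt d h) c" using w assms by simp
    ultimately show ?thesis unfolding eq by linarith
  qed
qed

text \<open>
  Among the frequencies with the same set of nonzero coordinates these have the largest weight.
\<close>
definition ind_freq :: "nat \<Rightarrow> nat set \<Rightarrow> nat \<Rightarrow> int" where
  "ind_freq d S = (\<lambda>k\<in>{1..d}. if k \<in> S then 1 else 0)"

lemma ind_freq_mem: "ind_freq d S \<in> freqs d"
  by (simp add: ind_freq_def freqs_def)

lemma inj_ind_freq: "inj_on (ind_freq d) (Pow {1..d})"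
proof (rule inj_onI)
  fix S T assume *: "S \<in> Pow {1..d}" "T \<in> Pow {1..d}" "ind_freq d S = ind_freq d T"
  have "k \<in> S \<longleftrightarrow> k \<in> T" if "k \<in> {1..d}" for k
    using fun_cong[OF *(3), of k] that by (auto simp: ind_freq_def split: if_splits)
  then show "S = T" using *(1,2) by blast
qed

lemma wt_ind_freq:
  assumes "S \<subseteq> {1..d}" "d \<ge> 1"
  shows "exp (- (real (card S) * \<alpha> d)) \<le> wt d (ind_freq d S)"
proof -
  have "(\<Sum>k=1..d. \<alpha> k * \<bar>real_of_int (ind_freq d S k)\<bar> powr b k) = (\<Sum>k\<in>{1..d}. if k \<in> S then \<alpha> k else 0)"
    using b_pos by (intro sum.cong) (auto simp: ind_freq_def)
  also have "\<dots> = (\<Sum>k\<in>S. \<alpha> k)"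
    using assms by (simp add: sum.If_cases Int_absorb1)
  also have "\<dots> \<le> (\<Sum>k\<in>S. \<alpha> d)" using assms by (intro sum_mono alpha_mono) auto
  finally show ?thesis by (simp add: wt_def)
qed

lemma eps_of_x:
  fixes x :: real
  assumes "x > 0"
  shows "0 < exp (- x)" "exp (- x) < 1" "ln (1 / exp (- x)) = x"
  using assms by (auto simp: ln_div)

section \<open>Large power of the dimension\<close>

text \<open>
  Let \<open>\<tau>\<close> decrease like \<open>x\<close> to the power \<open>\<sigma> - 1\<close> with \<open>\<sigma> < s\<close>, so that \<open>\<tau> x\<close> is negligible. Each
  coordinate then contributes at most \<open>(1 + x)\<^sup>\<kappa>\<close> to \<open>ln (Z d \<tau>)\<close>, with \<open>\<kappa>\<close> as small as desired, and
  \<open>t > 1\<close> leaves room for \<open>d (1 + x)\<^sup>\<kappa>\<close>.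
\<close>
theorem EC_WT_if_t_gt_1:
  assumes s: "s > 0" and t: "t > 1"
  shows "EC_st_WT X \<mu> s t"
proof (rule EC_st_WT_I)
  fix \<delta> :: real assume \<delta>: "\<delta> > 0"
  define \<sigma> where "\<sigma> = min s (1/2) / 2"
  have \<sigma>: "0 < \<sigma>" "\<sigma> < s" "\<sigma> \<le> 1" "1 - \<sigma> \<le> 1" using s by (auto simp: \<sigma>_def min_def)
  \<comment> \<open>Chosen so that \<open>d (1 + x)\<^sup>\<kappa> \<le> (1 + x)\<^sup>\<sigma>\<close> whenever \<open>(1 + x)\<^sup>\<kappa>\<close> exceeds \<open>d powr ((t - 1) / 2)\<close>.\<close>
  define \<kappa> where "\<kappa> = \<sigma> * (t - 1) / (t + 1)"
  have \<kappa>: "\<kappa> > 0" using \<sigma> t by (simp add: \<kappa>_def)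
  obtain C where C: "C \<ge> 0" "\<And>u b'. u > 0 \<Longrightarrow> b' \<ge> b_min \<Longrightarrow> ln (1 + lattice_tail u b') \<le> C * u powr (- \<kappa>)"
    using ln_lattice_tail_le_powr[OF \<kappa> b0_pos] by blast
  define K where "K = 2 * C * \<alpha> 1 powr (- \<kappa>) * 2 powr \<kappa>"
  have K: "K \<ge> 0" using C by (simp add: K_def)
  obtain C1 where C1: "C1 \<ge> 0" "\<And>y. y \<ge> 0 \<Longrightarrow> K * y powr ((t + 1) / 2) \<le> \<delta> * y powr t + C1"
    using powr_absorb[of "(t + 1) / 2" t K \<delta>] t K \<delta> by auto
  obtain C2 where C2: "C2 \<ge> 0" "\<And>y. y \<ge> 0 \<Longrightarrow> 2 * (K + 2) * y powr \<sigma> \<le> \<delta> * y powr s + C2"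
    using powr_absorb[of \<sigma> s "2 * (K + 2)" \<delta>] \<sigma> K \<delta> by auto
  have "ln (real (N X \<epsilon> d)) \<le> \<delta> * (ln (1 / \<epsilon>) powr s + real d powr t) + (C1 + C2 + 2 * (K + 2))"
    if \<epsilon>: "0 < \<epsilon>" "\<epsilon> < 1" and d: "d \<ge> 1" for \<epsilon> d
  proof -
    define x where "x = ln (1 / \<epsilon>)"
    have x: "x > 0" using \<epsilon> by (simp add: x_def)
    define \<tau> where "\<tau> = (1 + x) powr (\<sigma> - 1) / 2"
    have le1: "(1 + x) powr (\<sigma> - 1) \<le> 1" using x \<sigma> powr_mono[of "\<sigma> - 1" 0 "1 + x"] by simp
    have \<tau>: "0 < \<tau>" "\<tau> \<le> 1/2" using x le1 by (auto simp: \<tau>_def)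
    have "ln (Z d \<tau>) \<le> (\<Sum>k=1..d. C * (\<tau> * \<alpha> 1) powr (- \<kappa>))"
      unfolding ln_Z
    proof (rule sum_mono)
      fix k assume k: "k \<in> {1..d}"
      have "ln (1 + lattice_tail (\<tau> * \<alpha> k) (b k)) \<le> C * (\<tau> * \<alpha> k) powr (- \<kappa>)"
        using C \<tau> alpha_pos[of k] b_ge[of k] k by auto
      also have "\<dots> \<le> C * (\<tau> * \<alpha> 1) powr (- \<kappa>)"
        using C \<tau> alpha_ge[of k] alpha_1_pos k \<kappa> by (intro mult_left_mono powr_mono2') auto
      finally show "ln (1 + lattice_tail (\<tau> * \<alpha> k) (b k)) \<le> C * (\<tau> * \<alpha> 1) powr (- \<kappa>)" .
    qed
    also have "\<dots> = real d * (C * \<alpha> 1 powr (- \<kappa>) * \<tau> powr (- \<kappa>))"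
      using \<tau> alpha_1_pos by (simp add: powr_mult)
    also have "\<tau> powr (- \<kappa>) = 2 powr \<kappa> * (1 + x) powr (\<kappa> * (1 - \<sigma>))"
    proof -
      have e: "(\<sigma> - 1) * (- \<kappa>) = \<kappa> * (1 - \<sigma>)" by (simp add: algebra_simps)
      have "\<tau> powr (- \<kappa>) = ((1 + x) powr (\<sigma> - 1)) powr (- \<kappa>) / 2 powr (- \<kappa>)"
        using x by (simp add: \<tau>_def powr_divide)
      then show ?thesis unfolding powr_powr e by (simp add: powr_minus[of 2] divide_inverse)
    qed
    also have "real d * (C * \<alpha> 1 powr (- \<kappa>) * (2 powr \<kappa> * (1 + x) powr (\<kappa> * (1 - \<sigma>))))
        = K / 2 * (real d * (1 + x) powr (\<kappa> * (1 - \<sigma>)))"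
      by (simp add: K_def)
    also have "\<dots> \<le> K / 2 * (real d * (1 + x) powr \<kappa>)"
      using K x \<kappa> \<sigma> by (intro mult_left_mono powr_mono) (auto simp: mult_left_le)
    finally have lnZ: "2 * ln (Z d \<tau>) \<le> K * (real d * (1 + x) powr \<kappa>)" by simp
    have prod: "real d * (1 + x) powr \<kappa> \<le> real d powr ((t + 1) / 2) + (1 + x) powr \<sigma>"
    proof (cases "(1 + x) powr \<kappa> \<le> real d powr ((t - 1) / 2)")
      case True
      then have "real d * (1 + x) powr \<kappa> \<le> real d powr 1 * real d powr ((t - 1) / 2)"
        using d by (auto intro!: mult_left_mono)
      also have "\<dots> = real d powr ((t + 1) / 2)"
        unfolding powr_add[symmetric] by (rule arg_cong[where f="\<lambda>p. real d powr p"]) (simp add: field_simps)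
      finally show ?thesis by (simp add: add_increasing2)
    next
      case False
      then have "(real d powr ((t - 1) / 2)) powr (2 / (t - 1)) \<le> ((1 + x) powr \<kappa>) powr (2 / (t - 1))"
        using t by (intro powr_mono2) auto
      moreover have "(t - 1) / 2 * (2 / (t - 1)) = 1" using t by simp
      ultimately have "real d \<le> (1 + x) powr (\<kappa> * (2 / (t - 1)))"
        using d by (simp only: powr_powr) simp
      then have "real d * (1 + x) powr \<kappa> \<le> (1 + x) powr (\<kappa> * (2 / (t - 1))) * (1 + x) powr \<kappa>"
        by (intro mult_right_mono) auto
      also have "\<dots> = (1 + x) powr (\<kappa> * (2 / (t - 1)) + \<kappa>)" by (simp add: powr_add)
      also have "\<kappa> * (2 / (t - 1)) + \<kappa> = \<sigma>"
      proof -
        have "\<kappa> * (2 / (t - 1)) + \<kappa> = \<kappa> * ((t + 1) / (t - 1))" using t by (simp add: field_simps)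
        also have "\<dots> = \<sigma>" using t by (simp add: \<kappa>_def)
        finally show ?thesis .
      qed
      finally show ?thesis by (simp add: add_increasing)
    qed
    have "\<tau> * x \<le> \<tau> * (1 + x)" using \<tau> by simp
    also have "\<dots> = (1 + x) powr \<sigma> / 2"
      using powr_add[of "1 + x" "\<sigma> - 1" 1] x by (simp add: \<tau>_def)
    finally have tx: "4 * (\<tau> * x) \<le> 2 * (1 + x) powr \<sigma>" by simp
    have "ln (real (N X \<epsilon> d)) \<le> 2 * ln (Z d \<tau>) + 4 * (\<tau> * x)"
      unfolding x_def using \<epsilon> d \<tau> by (rule ln_N_le)
    also have "\<dots> \<le> K * (real d powr ((t + 1) / 2) + (1 + x) powr \<sigma>) + 2 * (1 + x) powr \<sigma>"
      using lnZ tx mult_left_mono[OF prod K] by linarith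
    also have "\<dots> = K * real d powr ((t + 1) / 2) + (K + 2) * (1 + x) powr \<sigma>" by (simp add: algebra_simps)
    also have "(K + 2) * (1 + x) powr \<sigma> \<le> (K + 2) * (2 * (1 + x powr \<sigma>))"
      using K x \<sigma> by (intro mult_left_mono one_plus_powr_le) auto
    also have "\<dots> = 2 * (K + 2) + 2 * (K + 2) * x powr \<sigma>" by (simp add: algebra_simps)
    finally show ?thesis
      using C1(2)[of "real d"] C2(2)[of x] x by (simp add: x_def algebra_simps)
  qed
  then show "\<exists>C. \<forall>\<epsilon> d. 0 < \<epsilon> \<longrightarrow> \<epsilon> < 1 \<longrightarrow> d \<ge> 1 \<longrightarrow>
       ln (real (N X \<epsilon> d)) \<le> \<delta> * (ln (1 / \<epsilon>) powr s + real d powr t) + C" by blast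
qed (use s t in auto)

section \<open>Linear dependence on the dimension\<close>

text \<open>
  For constant \<open>\<tau>\<close> the term \<open>\<tau> x\<close> is a small multiple of \<open>x\<close>, and \<open>ln (Z d \<tau>)\<close> is at most a constant times
  the sum of the null sequence \<open>exp (- \<tau> \<alpha>\<^sub>k)\<close>, which is \<open>o(d)\<close>.
\<close>
theorem EC_WT_t_1_if:
  assumes lim: "filterlim \<alpha> at_top sequentially" and s: "s \<ge> 1"
  shows "EC_st_WT X \<mu> s 1"
proof (rule EC_st_WT_I)
  fix \<delta> :: real assume \<delta>: "\<delta> > 0"
  define \<tau> where "\<tau> = min (1/2) (\<delta> / 4)"
  have \<tau>: "0 < \<tau>" "\<tau> \<le> 1/2" "4 * \<tau> \<le> \<delta>" using \<delta> by (auto simp: \<tau>_def)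
  obtain C where C: "C > 0" "\<And>d. ln (Z d \<tau>) \<le> C * (\<Sum>k=1..d. exp (- (\<tau> * \<alpha> k)))"
    using ln_Z_le_exp_sum[OF \<tau>(1)] by blast
  have "(\<lambda>k. exp (- (\<tau> * \<alpha> k))) \<longlonglongrightarrow> 0"
    using lim \<tau> by (intro filterlim_compose[OF exp_at_bot] filterlim_compose[OF filterlim_uminus_at_bot_at_top]
        filterlim_tendsto_pos_mult_at_top[OF tendsto_const]) auto
  from sum_le_small_slope[OF this, of "\<delta> / (2 * C)"] C \<delta> obtain C' where
    C': "\<And>d. (\<Sum>k=1..d. exp (- (\<tau> * \<alpha> k))) \<le> \<delta> / (2 * C) * real d + C'" by auto
  have "ln (real (N X \<epsilon> d)) \<le> \<delta> * (ln (1 / \<epsilon>) powr s + real d powr 1) + (2 * C * C' + \<delta>)"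
    if \<epsilon>: "0 < \<epsilon>" "\<epsilon> < 1" and d: "d \<ge> 1" for \<epsilon> d
  proof -
    define x where "x = ln (1 / \<epsilon>)"
    have x: "x > 0" using \<epsilon> by (simp add: x_def)
    have "x \<le> 1 + x powr s"
    proof (cases "x \<le> 1")
      case False
      then show ?thesis using powr_mono[of 1 s x] s x by simp
    qed (simp add: add_increasing2)
    then have "4 * \<tau> * x \<le> \<delta> * (1 + x powr s)" using \<tau> x by (intro mult_mono) auto
    moreover have "C * (\<Sum>k=1..d. exp (- (\<tau> * \<alpha> k))) \<le> C * (\<delta> / (2 * C) * real d + C')"
      using C C' by (intro mult_left_mono) auto
    moreover have "C * (\<delta> / (2 * C) * real d + C') = \<delta> / 2 * real d + C * C'"
      using C by (simp add: field_simps)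
    moreover have "ln (real (N X \<epsilon> d)) \<le> 2 * ln (Z d \<tau>) + 4 * (\<tau> * x)"
      unfolding x_def using \<epsilon> d \<tau> by (intro ln_N_le) auto
    ultimately show ?thesis using C(2)[of d] by (simp add: x_def algebra_simps)
  qed
  then show "\<exists>C. \<forall>\<epsilon> d. 0 < \<epsilon> \<longrightarrow> \<epsilon> < 1 \<longrightarrow> d \<ge> 1 \<longrightarrow>
       ln (real (N X \<epsilon> d)) \<le> \<delta> * (ln (1 / \<epsilon>) powr s + real d powr 1) + C" by blast
qed (use s in auto)

text \<open>
  If \<open>\<alpha>\<close> is bounded by \<open>A\<close>, the trace is at least \<open>(1 + 2 exp (- A))\<^sup>d\<close>, and by \<open>N_ge_trace\<close> so is,
  up to a factor, the number of functionals for \<open>\<epsilon> = 1/2\<close>.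
\<close>
theorem EC_WT_t_1_only_if:
  assumes EC: "EC_st_WT X \<mu> s 1"
  shows "filterlim \<alpha> at_top sequentially"
proof (rule ccontr)
  assume nlim: "\<not> filterlim \<alpha> at_top sequentially"
  then obtain A where A: "\<And>n. \<exists>j\<ge>n. \<alpha> j < A"
    unfolding filterlim_at_top eventually_sequentially by (auto simp: not_le)
  have le: "\<alpha> k \<le> A" if "k \<ge> 1" for k
  proof -
    obtain j where "j \<ge> k" "\<alpha> j < A" using A by blast
    then show ?thesis using alpha_mono[of k j] that by linarith
  qed
  define L where "L = ln (1 + 2 * exp (- A))"
  have L: "L > 0" unfolding L_def by (rule ln_gt_zero) simp
  have Z: "exp (real d * L) \<le> Z d 1" for d
  proof -
    have "exp (real d * L) = (\<Prod>k=1..d. 1 + 2 * exp (- A))"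
      by (simp add: L_def exp_of_nat_mult add_pos_pos)
    also have "\<dots> \<le> Z d 1"
      unfolding Z_def
    proof (rule prod_mono)
      fix k assume k: "k \<in> {1..d}"
      then have "2 * exp (- A) \<le> 2 * exp (- \<alpha> k)" using le[of k] by simp
      also have "\<dots> \<le> lattice_tail (\<alpha> k) (b k)" using k alpha_pos b_pos by (intro lattice_tail_ge) auto
      finally show "0 \<le> 1 + 2 * exp (- A) \<and> 1 + 2 * exp (- A) \<le> 1 + lattice_tail (1 * \<alpha> k) (b k)"
        by (simp add: add_nonneg_nonneg)
    qed
    finally show ?thesis .
  qed
  have lower: "real d * L + ln (3/4) \<le> ln (real (N X (1/2) d))" if d: "d \<ge> 1" for d
  proof -
    have "3/4 * exp (real d * L) \<le> (1 - (1/2)\<^sup>2) * Z d 1" using Z[of d] by (simp add: power2_eq_square)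
    also have "\<dots> \<le> real (N X (1/2) d)" using d by (intro N_ge_trace) auto
    finally have *: "3/4 * exp (real d * L) \<le> real (N X (1/2) d)" .
    have "ln (3/4 * exp (real d * L)) \<le> ln (real (N X (1/2) d))"
      using * exp_gt_zero[of "real d * L"] by (subst ln_le_cancel_iff) linarith+
    moreover have "ln (3/4 * exp (real d * L)) = ln (3/4) + real d * L" by (subst ln_mult) auto
    ultimately show ?thesis by linarith
  qed
  obtain n where n: "n \<ge> 1" "\<And>\<epsilon> d. 0 < \<epsilon> \<Longrightarrow> \<epsilon> < 1 \<Longrightarrow> d \<ge> n \<Longrightarrow>
      ln (real (N X \<epsilon> d)) \<le> L / 2 * (ln (1 / \<epsilon>) powr s + real d powr 1)"
    using EC_st_WT_D[OF EC, of "L / 2"] L by force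
  define d where "d = max n (nat \<lceil>(L / 2 * ln 2 powr s - ln (3/4)) / (L / 2)\<rceil> + 1)"
  have "real d > (L / 2 * ln 2 powr s - ln (3/4)) / (L / 2)" by (simp add: d_def) linarith
  then have "real d * (L / 2) > L / 2 * ln 2 powr s - ln (3/4)" using L by (simp add: divide_less_eq)
  moreover have "real d * L + ln (3/4) \<le> L / 2 * (ln 2 powr s + real d powr 1)"
  proof -
    have "d \<ge> n" "d \<ge> 1" by (simp_all add: d_def)
    then show ?thesis using lower[of d] n(2)[of "1/2" d] by simp
  qed
  moreover have "L / 2 * (ln 2 powr s + real d powr 1) = L / 2 * ln 2 powr s + real d * (L / 2)"
    by (simp add: algebra_simps)
  moreover have "real d * L = real d * (L / 2) + real d * (L / 2)" by (simp add: algebra_simps)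
  ultimately show False by linarith
qed

section \<open>Sublinear dependence on the dimension, linear dependence on the digits\<close>

text \<open>
  For every constant \<open>\<tau> > 0\<close> the series of \<open>exp (- \<tau> \<alpha>\<^sub>k)\<close> converges by comparison with the inverse
  squares, so \<open>ln (Z d \<tau>)\<close> is bounded in \<open>d\<close>.
\<close>
theorem EC_WT_s_1_if:
  assumes lim: "(\<lambda>j. ln (real j) / \<alpha> j) \<longlonglongrightarrow> 0" and t: "t > 0"
  shows "EC_st_WT X \<mu> 1 t"
proof (rule EC_st_WT_I)
  fix \<delta> :: real assume \<delta>: "\<delta> > 0"
  define \<tau> where "\<tau> = min (1/2) (\<delta> / 4)"
  have \<tau>: "0 < \<tau>" "\<tau> \<le> 1/2" "4 * \<tau> \<le> \<delta>" using \<delta> by (auto simp: \<tau>_def)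
  obtain C where C: "C > 0" "\<And>d. ln (Z d \<tau>) \<le> C * (\<Sum>k=1..d. exp (- (\<tau> * \<alpha> k)))"
    using ln_Z_le_exp_sum[OF \<tau>(1)] by blast
  have "\<forall>\<^sub>F k in sequentially. ln (real k) / \<alpha> k < \<tau> / 2"
    using order_tendstoD(2)[OF lim, of "\<tau> / 2"] \<tau> by simp
  then have ev: "\<forall>\<^sub>F k in sequentially. norm (exp (- (\<tau> * \<alpha> k))) \<le> inverse (real k ^ 2)"
    using eventually_ge_at_top[of 1]
  proof eventually_elim
    case (elim k)
    then have "2 * ln (real k) \<le> \<tau> * \<alpha> k" using alpha_pos[of k] by (simp add: field_simps)
    then have "exp (- (\<tau> * \<alpha> k)) \<le> exp (- (2 * ln (real k)))" by simp
    also have "\<dots> = inverse (real k ^ 2)" using elim by (simp add: exp_minus exp_of_nat_mult[of 2, simplified])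
    finally show ?case by simp
  qed
  have sm: "summable (\<lambda>k. exp (- (\<tau> * \<alpha> k)))"
    by (rule summable_comparison_test_ev[OF ev]) (rule inverse_power_summable, simp)
  define S where "S = suminf (\<lambda>k. exp (- (\<tau> * \<alpha> k)))"
  have S: "(\<Sum>k=1..d. exp (- (\<tau> * \<alpha> k))) \<le> S" for d
    unfolding S_def by (rule sum_le_suminf[OF sm]) auto
  have "ln (real (N X \<epsilon> d)) \<le> \<delta> * (ln (1 / \<epsilon>) powr 1 + real d powr t) + 2 * C * S"
    if \<epsilon>: "0 < \<epsilon>" "\<epsilon> < 1" and d: "d \<ge> 1" for \<epsilon> d
  proof -
    have x: "ln (1 / \<epsilon>) > 0" using \<epsilon> by simp
    have "ln (real (N X \<epsilon> d)) \<le> 2 * ln (Z d \<tau>) + 4 * (\<tau> * ln (1 / \<epsilon>))"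
      using \<epsilon> d \<tau> by (intro ln_N_le) auto
    moreover have "C * (\<Sum>k=1..d. exp (- (\<tau> * \<alpha> k))) \<le> C * S" using C S by (intro mult_left_mono) auto
    moreover have "4 * \<tau> * ln (1 / \<epsilon>) \<le> \<delta> * ln (1 / \<epsilon>)" using \<tau>(3) x by (intro mult_right_mono) auto
    moreover have "0 \<le> \<delta> * real d powr t" using \<delta> by simp
    moreover have "\<delta> * (ln (1 / \<epsilon>) powr 1 + real d powr t) = \<delta> * ln (1 / \<epsilon>) + \<delta> * real d powr t"
      using x by (simp add: distrib_left)
    ultimately show ?thesis using C(2)[of d] by linarith
  qed
  then show "\<exists>C. \<forall>\<epsilon> d. 0 < \<epsilon> \<longrightarrow> \<epsilon> < 1 \<longrightarrow> d \<ge> 1 \<longrightarrow>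
       ln (real (N X \<epsilon> d)) \<le> \<delta> * (ln (1 / \<epsilon>) powr 1 + real d powr t) + C" by blast
qed (use t in auto)

text \<open>
  Suppose \<open>\<alpha>\<^sub>j \<le> ln j / e\<close>. The indicators of the \<open>m\<close>-subsets of \<open>{1..j}\<close> are at least \<open>(j/m)\<^sup>m\<close> frequencies
  of weight at least \<open>exp (- x)\<close>, \<open>x = m \<alpha>\<^sub>j\<close>. With \<open>m\<close> of order \<open>j\<close> to the power \<open>t'\<close>, where \<open>t < t' < 1\<close>,
  \<open>ln n\<close> is at least of order \<open>m ln j\<close>, whereas \<open>x + j\<^sup>t\<close> is at most of that order, which contradicts
  \<open>ln n = o(x + j\<^sup>t)\<close>. Under the absolute criterion, \<open>\<epsilon> = exp (- x)\<close> makes \<open>\<epsilon>\<^sup>2\<close> smaller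
  than every weight counted.
\<close>
theorem EC_WT_s_1_only_if:
  assumes EC: "EC_st_WT ABS \<mu> 1 t" and t: "0 < t" "t < 1"
  shows "(\<lambda>j. ln (real j) / \<alpha> j) \<longlonglongrightarrow> 0"
proof (rule ccontr)
  assume "\<not> (\<lambda>j. ln (real j) / \<alpha> j) \<longlonglongrightarrow> 0"
  then obtain e where e: "e > 0" "\<And>n. \<exists>j\<ge>n. \<bar>ln (real j) / \<alpha> j\<bar> \<ge> e"
    using not_tendsto_zero_frequently by blast
  define t' where "t' = (1 + t) / 2"
  have t': "t < t'" "t' < 1" "0 < t'" using t by (auto simp: t'_def)
  define \<delta> where "\<delta> = (1 - t') * e / 2"
  have \<delta>: "\<delta> > 0" using t' e by (simp add: \<delta>_def)
  obtain n where n: "n \<ge> 1" "\<And>\<epsilon> d. 0 < \<epsilon> \<Longrightarrow> \<epsilon> < 1 \<Longrightarrow> d \<ge> n \<Longrightarrow>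
      ln (real (N ABS \<epsilon> d)) \<le> \<delta> * (ln (1 / \<epsilon>) powr 1 + real d powr t)"
    using EC_st_WT_D[OF EC \<delta>] by blast
  define n' where "n' = n + nat \<lceil>exp (2 * (ln 2 + \<delta>) / (1 - t'))\<rceil> + 2"
  obtain j where j: "j \<ge> n'" "\<bar>ln (real j) / \<alpha> j\<bar> \<ge> e" using e by blast
  have j1: "j \<ge> 2" "j \<ge> n" using j by (auto simp: n'_def)
  have aj: "\<alpha> j > 0" using alpha_pos[of j] j1 by simp
  have lj: "ln (real j) > 0" using j1 by simp
  have ale: "\<alpha> j * e \<le> ln (real j)" using j(2) aj lj by (simp add: field_simps)
  have "exp (2 * (ln 2 + \<delta>) / (1 - t')) < real j"
    using j(1) unfolding n'_def by linarith
  then have "ln (exp (2 * (ln 2 + \<delta>) / (1 - t'))) < ln (real j)" using j1 by (subst ln_less_cancel_iff) auto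
  then have jbig: "2 * (ln 2 + \<delta>) / (1 - t') < ln (real j)" by simp
  define m where "m = nat \<lceil>real j powr t'\<rceil>"
  have jt: "1 \<le> real j powr t'" using j1 t' by (intro ge_one_powr_ge_zero) auto
  have m: "real j powr t' \<le> real m" "real m \<le> 2 * real j powr t'" "m \<ge> 1"
    using jt unfolding m_def by linarith+
  have mj: "m \<le> j"
  proof -
    have "real j powr t' \<le> real j powr 1" using j1 t' by (intro powr_mono) auto
    then show ?thesis unfolding m_def by (simp add: ceiling_le_iff nat_le_iff)
  qed
  define x where "x = real m * \<alpha> j"
  have x: "x > 0" using m aj by (simp add: x_def)
  define H where "H = ind_freq j ` {S. S \<subseteq> {1..j} \<and> card S = m}"
  have cH: "card H = j choose m"
  proof -
    have "card H = card {S. S \<subseteq> {1..j} \<and> card S = m}"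
      unfolding H_def by (intro card_image inj_on_subset[OF inj_ind_freq]) auto
    then show ?thesis using n_subsets[of "{1..j}" m] by simp
  qed
  have "card H \<le> N ABS (exp (- x)) j"
  proof (rule N_ge_card[where c="exp (- x)"])
    show "finite H" unfolding H_def by (rule finite_subset[of _ "ind_freq j ` Pow {1..j}"]) auto
    show "H \<subseteq> freqs j" using ind_freq_mem by (auto simp: H_def)
    show "exp (- x) \<le> wt j h" if "h \<in> H" for h
      using that wt_ind_freq[of _ j] j1 by (auto simp: H_def x_def)
    show "(exp (- x))\<^sup>2 * (cri ABS j)\<^sup>2 < exp (- x)"
      using x by (simp add: cri_def power2_eq_square exp_add[symmetric])
  qed (use x j1 in auto)
  then have "real (j choose m) \<le> real (N ABS (exp (- x)) j)" using cH by simp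
  moreover have "(real j / real m) ^ m \<le> real (j choose m)"
    using binomial_ge_n_over_k_pow_k[OF mj, where 'a=real] by simp
  ultimately have ge: "(real j / real m) ^ m \<le> real (N ABS (exp (- x)) j)" by linarith
  have jm: "0 < real j / real m" using m j1 by simp
  have "real m * ln (real j / real m) = ln ((real j / real m) ^ m)" using jm by (simp add: ln_realpow)
  also have "\<dots> \<le> ln (real (N ABS (exp (- x)) j))"
    using ge zero_less_power[OF jm, of m] by (subst ln_le_cancel_iff) linarith+
  also have "\<dots> \<le> \<delta> * (x + real j powr t)"
    using n(2)[of "exp (- x)" j] eps_of_x[OF x] j1 x by simp
  also have "\<dots> \<le> \<delta> * (real m * \<alpha> j + real m)"
  proof -
    have "real j powr t \<le> real j powr t'" using j1 t' by (intro powr_mono) auto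
    then show ?thesis using m \<delta> by (intro mult_left_mono) (auto simp: x_def)
  qed
  also have "\<dots> = real m * (\<delta> * (\<alpha> j + 1))" by (simp add: algebra_simps)
  finally have "ln (real j / real m) \<le> \<delta> * (\<alpha> j + 1)" using m by simp
  moreover have "(1 - t') * ln (real j) - ln 2 \<le> ln (real j / real m)"
  proof -
    have "real j / (2 * real j powr t') \<le> real j / real m" using m j1 by (intro divide_left_mono) auto
    then have "ln (real j / (2 * real j powr t')) \<le> ln (real j / real m)"
      using j1 by (intro ln_mono) auto
    then show ?thesis using j1 by (simp add: ln_div ln_mult ln_powr algebra_simps)
  qed
  moreover have "\<delta> * (\<alpha> j + 1) \<le> (1 - t') / 2 * ln (real j) + \<delta>"
  proof -
    have "\<delta> * \<alpha> j = (1 - t') / 2 * (\<alpha> j * e)" by (simp add: \<delta>_def)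
    also have "\<dots> \<le> (1 - t') / 2 * ln (real j)" using ale t' by (intro mult_left_mono) auto
    finally show ?thesis by (simp add: distrib_left)
  qed
  ultimately have "(1 - t') / 2 * ln (real j) \<le> ln 2 + \<delta>" by (simp add: algebra_simps)
  moreover have "ln 2 + \<delta> < (1 - t') / 2 * ln (real j)" using jbig t' by (simp add: field_simps)
  ultimately show False by linarith
qed

section \<open>Sublinear dependence on the digits\<close>

text \<open>
  The constant \<open>D\<close> does not depend on \<open>G\<close>, so a fast growing \<open>\<alpha>\<close> makes the second term small. With
  \<open>W = (\<tau> G) powr (- 1/r)\<close>, a coordinate \<open>k \<ge> K\<close> has \<open>\<tau> \<alpha>\<^sub>k \<ge> (k / W)\<^sup>r\<close>; the bound of
  \<open>ln_lattice_tail_le_powr\<close> with exponents \<open>1/(2r)\<close> and \<open>2/r\<close> gives \<open>sqrt (W/k)\<close> and \<open>(W/k)\<^sup>2\<close>.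
\<close>
lemma ln_Z_le_polynomial:
  assumes r: "r > 0"
  shows "\<exists>D>0. \<forall>G>0. \<forall>K. (\<forall>k\<ge>K. G * real k powr r \<le> \<alpha> k) \<longrightarrow>
     (\<exists>E\<ge>0. \<forall>\<tau>>0. \<forall>d. ln (Z d \<tau>) \<le> E * \<tau> powr (- (1 / (2 * r))) + D * (\<tau> * G) powr (- (1 / r)))"
proof -
  obtain A1 where A1: "A1 \<ge> 0" "\<And>u b'. u > 0 \<Longrightarrow> b' \<ge> b_min \<Longrightarrow> ln (1 + lattice_tail u b') \<le> A1 * u powr (- (1 / (2 * r)))"
    using ln_lattice_tail_le_powr[of "1 / (2 * r)" b_min] r b0_pos by auto
  obtain A2 where A2: "A2 \<ge> 0" "\<And>u b'. u > 0 \<Longrightarrow> b' \<ge> b_min \<Longrightarrow> ln (1 + lattice_tail u b') \<le> A2 * u powr (- (2 / r))"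
    using ln_lattice_tail_le_powr[of "2 / r" b_min] r b0_pos by auto
  define A where "A = A1 + A2 + 1"
  have A: "A > 0" "A1 \<le> A" "A2 \<le> A" using A1 A2 by (auto simp: A_def)
  have "\<exists>E\<ge>0. \<forall>\<tau>>0. \<forall>d. ln (Z d \<tau>) \<le> E * \<tau> powr (- (1 / (2 * r))) + 4 * A * (\<tau> * G) powr (- (1 / r))"
    if G: "G > 0" and K: "\<And>k. k \<ge> K \<Longrightarrow> G * real k powr r \<le> \<alpha> k" for G K
  proof -
    define E where "E = real K * (A1 * \<alpha> 1 powr (- (1 / (2 * r))))"
    have E: "E \<ge> 0" using A1 by (simp add: E_def)
    have "ln (Z d \<tau>) \<le> E * \<tau> powr (- (1 / (2 * r))) + 4 * A * (\<tau> * G) powr (- (1 / r))" if \<tau>: "\<tau> > 0" for \<tau> d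
    proof -
      define W where "W = (\<tau> * G) powr (- (1 / r))"
      have W: "W > 0" using \<tau> G by (simp add: W_def)
      define e0 where "e0 = A1 * \<alpha> 1 powr (- (1 / (2 * r))) * \<tau> powr (- (1 / (2 * r)))"
      have e0: "e0 \<ge> 0" using A1 by (simp add: e0_def)
      have "ln (Z d \<tau>) \<le> (\<Sum>k=1..d. (if k < K then e0 else 0) + A * min (sqrt (W / real k)) ((W / real k)\<^sup>2))"
        unfolding ln_Z
      proof (rule sum_mono)
        fix k assume k: "k \<in> {1..d}"
        have pos: "0 < \<tau> * \<alpha> k" using \<tau> alpha_pos[of k] k by simp
        have bk: "b k \<ge> b_min" using b_ge[of k] k by simp
        note l1 = A1(2)[OF pos bk] and l2 = A2(2)[OF pos bk]
        show "ln (1 + lattice_tail (\<tau> * \<alpha> k) (b k)) \<le> (if k < K then e0 else 0) + A * min (sqrt (W / real k)) ((W / real k)\<^sup>2)"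
        proof (cases "k < K")
          case True
          have "A1 * (\<tau> * \<alpha> k) powr (- (1 / (2 * r))) \<le> A1 * (\<tau> * \<alpha> 1) powr (- (1 / (2 * r)))"
            using A1 \<tau> alpha_ge[of k] alpha_1_pos k r by (intro mult_left_mono powr_mono2') auto
          also have "\<dots> = e0" using \<tau> alpha_1_pos by (simp add: e0_def powr_mult)
          finally have "ln (1 + lattice_tail (\<tau> * \<alpha> k) (b k)) \<le> e0" using l1 by linarith
          moreover have "0 \<le> A * min (sqrt (W / real k)) ((W / real k)\<^sup>2)" using A W by simp
          ultimately show ?thesis using True by simp
        next
          case False
          have base: "0 < \<tau> * G * real k powr r" "\<tau> * G * real k powr r \<le> \<tau> * \<alpha> k"
            using K[of k] False \<tau> G k by (auto simp: mult.assoc)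
          have Wk: "(\<tau> * G * real k powr r) powr (- (1 / r)) = W / real k"
            using \<tau> G k r by (simp add: W_def powr_mult powr_powr powr_minus_divide)
          have "(\<tau> * \<alpha> k) powr (- (1 / (2 * r))) \<le> (\<tau> * G * real k powr r) powr (- (1 / (2 * r)))"
            using base r by (intro powr_mono2') auto
          then have "A1 * (\<tau> * \<alpha> k) powr (- (1 / (2 * r))) \<le> A * (\<tau> * G * real k powr r) powr (- (1 / (2 * r)))"
            using A A1(1) by (intro mult_mono) auto
          also have "(\<tau> * G * real k powr r) powr (- (1 / (2 * r))) = ((\<tau> * G * real k powr r) powr (- (1 / r))) powr (1/2)"
            by (simp add: powr_powr mult.commute)
          also have "\<dots> = sqrt (W / real k)" unfolding Wk using W by (simp add: powr_half_sqrt)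
          finally have 1: "ln (1 + lattice_tail (\<tau> * \<alpha> k) (b k)) \<le> A * sqrt (W / real k)" using l1 by linarith
          have "(\<tau> * \<alpha> k) powr (- (2 / r)) \<le> (\<tau> * G * real k powr r) powr (- (2 / r))"
            using base r by (intro powr_mono2') auto
          then have "A2 * (\<tau> * \<alpha> k) powr (- (2 / r)) \<le> A * (\<tau> * G * real k powr r) powr (- (2 / r))"
            using A A2(1) by (intro mult_mono) auto
          also have "(\<tau> * G * real k powr r) powr (- (2 / r)) = ((\<tau> * G * real k powr r) powr (- (1 / r))) powr 2"
            by (simp add: powr_powr)
          also have "\<dots> = (W / real k)\<^sup>2" unfolding Wk using W k by (simp add: powr_numeral)
          finally have 2: "ln (1 + lattice_tail (\<tau> * \<alpha> k) (b k)) \<le> A * (W / real k)\<^sup>2" using l2 by linarith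
          show ?thesis using 1 2 False by (simp add: min_def)
        qed
      qed
      also have "\<dots> = (\<Sum>k\<in>{1..d} \<inter> {..<K}. e0) + A * (\<Sum>k=1..d. min (sqrt (W / real k)) ((W / real k)\<^sup>2))"
        by (simp add: sum.distrib sum.If_cases lessThan_def sum_distrib_left)
      also have "(\<Sum>k\<in>{1..d} \<inter> {..<K}. e0) \<le> (\<Sum>k<K. e0)" using e0 by (intro sum_mono2) auto
      also have "(\<Sum>k<K. e0) = E * \<tau> powr (- (1 / (2 * r)))" by (simp add: E_def e0_def)
      also have "A * (\<Sum>k=1..d. min (sqrt (W / real k)) ((W / real k)\<^sup>2)) \<le> A * (4 * W)"
        using A W by (intro mult_left_mono sum_min_sqrt_square_le) auto
      finally show ?thesis by (simp add: W_def)
    qed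
    then show ?thesis using E by blast
  qed
  then show ?thesis using A by (intro exI[of _ "4 * A"]) auto
qed

text \<open>
  With \<open>\<tau> = \<eta> x powr (s - 1)\<close> the term \<open>\<tau> x\<close> equals \<open>\<eta> x\<^sup>s\<close>, and \<open>\<tau> powr (- 1/r)\<close> is a multiple of \<open>x\<^sup>s\<close> because
  \<open>(1 - s) / r = s\<close>; its coefficient is made small by taking \<open>G\<close> large after \<open>\<eta>\<close>.
\<close>
theorem EC_WT_s_lt_1_if:
  assumes lim: "(\<lambda>j. real j powr ((1 - s) / s) / \<alpha> j) \<longlonglongrightarrow> 0" and s: "0 < s" "s < 1" and t: "t > 0"
  shows "EC_st_WT X \<mu> s t"
proof (rule EC_st_WT_I)
  fix \<delta> :: real assume \<delta>: "\<delta> > 0"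
  define r where "r = (1 - s) / s"
  have r: "r > 0" using s by (simp add: r_def)
  have rs: "(1 - s) * (1 / r) = s" using s by (simp add: r_def)
  obtain D where D: "D > 0" "\<forall>G>0. \<forall>K. (\<forall>k\<ge>K. G * real k powr r \<le> \<alpha> k) \<longrightarrow>
     (\<exists>E\<ge>0. \<forall>\<tau>>0. \<forall>d. ln (Z d \<tau>) \<le> E * \<tau> powr (- (1 / (2 * r))) + D * (\<tau> * G) powr (- (1 / r)))"
    using ln_Z_le_polynomial[OF r] by (elim exE conjE) (rule that)
  define \<eta> where "\<eta> = \<delta> / 12"
  have \<eta>: "\<eta> > 0" using \<delta> by (simp add: \<eta>_def)
  define G where "G = (6 * D / \<delta>) powr r / \<eta>"
  have G: "G > 0" using D \<delta> \<eta> by (simp add: G_def)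
  have G\<eta>: "(\<eta> * G) powr (- (1 / r)) = \<delta> / (6 * D)"
    using \<eta> D \<delta> r by (simp add: G_def powr_powr powr_minus_divide)
  have "\<forall>\<^sub>F k in sequentially. real k powr r / \<alpha> k < 1 / G"
    using order_tendstoD(2)[OF lim, of "1 / G"] G by (simp add: r_def)
  then have "\<forall>\<^sub>F k in sequentially. G * real k powr r \<le> \<alpha> k"
    using eventually_ge_at_top[of 1]
  proof eventually_elim
    case (elim k)
    then show ?case using G alpha_pos[of k] by (simp add: field_simps)
  qed
  then obtain K where K: "\<And>k. k \<ge> K \<Longrightarrow> G * real k powr r \<le> \<alpha> k" unfolding eventually_sequentially by blast
  have DE: "\<exists>E\<ge>0. \<forall>\<tau>>0. \<forall>d. ln (Z d \<tau>) \<le> E * \<tau> powr (- (1 / (2 * r))) + D * (\<tau> * G) powr (- (1 / r))"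
    by (rule D(2)[rule_format, OF G]) (rule K)
  obtain E where E0: "E \<ge> 0" "\<forall>\<tau>>0. \<forall>d. ln (Z d \<tau>) \<le> E * \<tau> powr (- (1 / (2 * r))) + D * (\<tau> * G) powr (- (1 / r))"
    using DE by (elim exE conjE) (rule that)
  note E = E0(1) E0(2)[rule_format]
  define p where "p = 1 / (2 * r)"
  have p: "p > 0" "(1 - s) * p = s / 2" using r
  proof -
    have "(1 - s) * p = (1 - s) * (1 / r) / 2" by (simp add: p_def)
    then show "(1 - s) * p = s / 2" unfolding rs .
  qed (simp add: p_def)
  obtain C where C: "C \<ge> 0" "\<And>y. y \<ge> 0 \<Longrightarrow> (2 * E * \<eta> powr (- p)) * y powr (s / 2) \<le> \<delta> / 3 * y powr s + C"
    using powr_absorb[of "s / 2" s "2 * E * \<eta> powr (- p)" "\<delta> / 3"] s E \<delta> by auto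
  define C' where "C' = 2 * E * 2 powr p + 2 * D * G powr (- (1 / r)) * 2 powr (1 / r)"
  have "ln (real (N X \<epsilon> d)) \<le> \<delta> * (ln (1 / \<epsilon>) powr s + real d powr t) + (C + C')"
    if \<epsilon>: "0 < \<epsilon>" "\<epsilon> < 1" and d: "d \<ge> 1" for \<epsilon> d
  proof -
    define x where "x = ln (1 / \<epsilon>)"
    have x: "x > 0" using \<epsilon> by (simp add: x_def)
    define \<tau> where "\<tau> = min (1/2) (\<eta> * x powr (s - 1))"
    have \<tau>: "0 < \<tau>" "\<tau> \<le> 1/2" "\<tau> \<le> \<eta> * x powr (s - 1)" using \<eta> x by (auto simp: \<tau>_def)
    have tq: "\<tau> powr (- q) \<le> 2 powr q + \<eta> powr (- q) * x powr ((1 - s) * q)" if q: "q > 0" for q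
    proof (cases "1/2 \<le> \<eta> * x powr (s - 1)")
      case True
      then have "\<tau> powr (- q) = 2 powr q" by (simp add: \<tau>_def powr_divide powr_minus_divide)
      then show ?thesis by simp
    next
      case False
      have e: "(s - 1) * (- q) = (1 - s) * q" by (simp add: algebra_simps)
      have "\<tau> powr (- q) = \<eta> powr (- q) * (x powr (s - 1)) powr (- q)"
        using False \<eta> x by (simp add: \<tau>_def min_def powr_mult)
      then show ?thesis unfolding powr_powr e by simp
    qed
    have "\<tau> * x \<le> \<eta> * x powr (s - 1) * x" using \<tau> x by (intro mult_right_mono) auto
    also have "\<dots> = \<eta> * x powr s" using x by (simp add: powr_diff)
    finally have tx: "4 * (\<tau> * x) \<le> \<delta> / 3 * x powr s" by (simp add: \<eta>_def)
    have "2 * (E * \<tau> powr (- p)) \<le> 2 * (E * (2 powr p + \<eta> powr (- p) * x powr (s / 2)))"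
      using E tq[OF p(1)] p by (intro mult_left_mono) auto
    also have "\<dots> = 2 * E * 2 powr p + (2 * E * \<eta> powr (- p)) * x powr (s / 2)" by (simp add: algebra_simps)
    also have "\<dots> \<le> 2 * E * 2 powr p + (\<delta> / 3 * x powr s + C)" using C(2)[of x] x by simp
    finally have l1: "2 * (E * \<tau> powr (- p)) \<le> 2 * E * 2 powr p + (\<delta> / 3 * x powr s + C)" .
    have "2 * (D * (\<tau> * G) powr (- (1 / r))) = 2 * D * G powr (- (1 / r)) * \<tau> powr (- (1 / r))"
      using \<tau> G by (simp add: powr_mult mult_ac)
    also have "\<dots> \<le> 2 * D * G powr (- (1 / r)) * (2 powr (1 / r) + \<eta> powr (- (1 / r)) * x powr s)"
      using D G tq[of "1 / r"] r rs by (intro mult_left_mono) auto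
    also have "\<dots> = 2 * D * G powr (- (1 / r)) * 2 powr (1 / r) + 2 * D * (\<eta> * G) powr (- (1 / r)) * x powr s"
      using \<eta> G by (simp add: powr_mult algebra_simps)
    also have "2 * D * (\<eta> * G) powr (- (1 / r)) * x powr s = \<delta> / 3 * x powr s"
      unfolding G\<eta> using D by simp
    finally have l2: "2 * (D * (\<tau> * G) powr (- (1 / r))) \<le> 2 * D * G powr (- (1 / r)) * 2 powr (1 / r) + \<delta> / 3 * x powr s" .
    have "ln (real (N X \<epsilon> d)) \<le> 2 * ln (Z d \<tau>) + 4 * (\<tau> * x)"
      unfolding x_def using \<epsilon> d \<tau> by (intro ln_N_le) auto
    also have "2 * ln (Z d \<tau>) \<le> 2 * (E * \<tau> powr (- p)) + 2 * (D * (\<tau> * G) powr (- (1 / r)))"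
      using E(2)[OF \<tau>(1), of d] by (simp add: p_def)
    finally have "ln (real (N X \<epsilon> d)) \<le> \<delta> * x powr s + (C + C')"
      using l1 l2 tx by (simp add: C'_def)
    moreover have "0 \<le> \<delta> * real d powr t" using \<delta> by simp
    ultimately show ?thesis by (simp add: x_def distrib_left)
  qed
  then show "\<exists>C. \<forall>\<epsilon> d. 0 < \<epsilon> \<longrightarrow> \<epsilon> < 1 \<longrightarrow> d \<ge> 1 \<longrightarrow>
       ln (real (N X \<epsilon> d)) \<le> \<delta> * (ln (1 / \<epsilon>) powr s + real d powr t) + C" by blast
qed (use s t in auto)

text \<open>
  Suppose \<open>\<alpha>\<^sub>j\<close> is at most a constant times \<open>j powr ((1 - s) / s)\<close>. The \<open>2\<^sup>j\<close> indicators of subsets of \<open>{1..j}\<close>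
  have weights at least \<open>exp (- j \<alpha>\<^sub>j)\<close>, and \<open>(j \<alpha>\<^sub>j)\<^sup>s\<close> is at most a constant times \<open>j\<close>. For the normalised
  criterion \<open>x\<close> is increased by a bound \<open>C j\<close> on the logarithm of the trace, which changes only the constant.
\<close>
theorem EC_WT_s_lt_1_only_if:
  assumes EC: "EC_st_WT X \<mu> s t" and s: "0 < s" "s < 1" and t: "0 < t" "t \<le> 1"
  shows "(\<lambda>j. real j powr ((1 - s) / s) / \<alpha> j) \<longlonglongrightarrow> 0"
proof (rule ccontr)
  assume "\<not> (\<lambda>j. real j powr ((1 - s) / s) / \<alpha> j) \<longlonglongrightarrow> 0"
  then obtain e where e: "e > 0" "\<And>n. \<exists>j\<ge>n. \<bar>real j powr ((1 - s) / s) / \<alpha> j\<bar> \<ge> e"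
    using not_tendsto_zero_frequently by blast
  obtain C where C: "C > 0" "\<And>d. ln (Z d 1) \<le> C * (\<Sum>k=1..d. exp (- (1 * \<alpha> k)))"
    using ln_Z_le_exp_sum[of 1] by auto
  have lnT: "ln (Z d 1) \<le> C * real d" for d
  proof -
    have "(\<Sum>k=1..d. exp (- (1 * \<alpha> k))) \<le> (\<Sum>k=1..d. 1)"
      using alpha_pos by (intro sum_mono) (auto intro: less_imp_le)
    then have "C * (\<Sum>k=1..d. exp (- (1 * \<alpha> k))) \<le> C * real d" using C by (intro mult_left_mono) auto
    then show ?thesis using C(2)[of d] by linarith
  qed
  define B where "B = (1 / e + C) powr s + 1"
  have B: "B > 0" by (simp add: B_def add_nonneg_pos)
  define \<delta> where "\<delta> = ln 2 / (2 * B)"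
  have \<delta>: "\<delta> > 0" using B by (simp add: \<delta>_def)
  obtain n where n: "n \<ge> 1" "\<And>\<epsilon> d. 0 < \<epsilon> \<Longrightarrow> \<epsilon> < 1 \<Longrightarrow> d \<ge> n \<Longrightarrow>
      ln (real (N X \<epsilon> d)) \<le> \<delta> * (ln (1 / \<epsilon>) powr s + real d powr t)"
    using EC_st_WT_D[OF EC \<delta>] by blast
  obtain j where j: "j \<ge> n" "\<bar>real j powr ((1 - s) / s) / \<alpha> j\<bar> \<ge> e" using e by blast
  have j1: "j \<ge> 1" using j n by simp
  have aj: "\<alpha> j > 0" using alpha_pos[of j] j1 by simp
  define y where "y = real j * \<alpha> j"
  have y: "y > 0" using aj j1 by (simp add: y_def)
  define x where "x = y + C * real j"
  have x: "x > 0" using y C by (simp add: x_def add_pos_nonneg)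
  define H where "H = ind_freq j ` Pow {1..j}"
  have cH: "card H = 2 ^ j" unfolding H_def card_image[OF inj_ind_freq] by (simp add: card_Pow)
  have "card H \<le> N X (exp (- x)) j"
  proof (rule N_ge_card[where c="exp (- y)"])
    show "finite H" by (simp add: H_def)
    show "H \<subseteq> freqs j" using ind_freq_mem by (auto simp: H_def)
    show "exp (- y) \<le> wt j h" if h: "h \<in> H" for h
    proof -
      obtain S where S: "S \<subseteq> {1..j}" "h = ind_freq j S"
        using h unfolding H_def by blast
      have "card S \<le> j" using card_mono[OF _ S(1)] by simp
      then have "exp (- y) \<le> exp (- (real (card S) * \<alpha> j))" using aj by (simp add: y_def)
      also have "\<dots> \<le> wt j h" unfolding S(2) using S j1 by (intro wt_ind_freq)
      finally show ?thesis .
    qed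
    have "(exp (- x))\<^sup>2 * (cri X j)\<^sup>2 \<le> (exp (- x))\<^sup>2 * exp (C * real j)"
    proof (intro mult_left_mono)
      have "Z j 1 = exp (ln (Z j 1))" using Z_ge_1[of j 1] by simp
      also have "\<dots> \<le> exp (C * real j)" using lnT[of j] by simp
      finally show "(cri X j)\<^sup>2 \<le> exp (C * real j)" using cri_square_le[of X j] by linarith
    qed simp
    also have "\<dots> = exp (- y - (y + C * real j))"
      by (simp add: x_def power2_eq_square exp_add[symmetric] algebra_simps)
    also have "\<dots> < exp (- y)" using x by (simp add: x_def)
    finally show "(exp (- x))\<^sup>2 * (cri X j)\<^sup>2 < exp (- y)" .
  qed (use x j1 in auto)
  then have ge: "2 ^ j \<le> real (N X (exp (- x)) j)" using cH by (metis of_nat_le_iff of_nat_numeral of_nat_power)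
  have "real j * ln 2 = ln (2 ^ j)" by (simp add: ln_realpow)
  also have "\<dots> \<le> ln (real (N X (exp (- x)) j))"
    using ge zero_less_power[of "2::real" j] by (subst ln_le_cancel_iff) linarith+
  also have "\<dots> \<le> \<delta> * (x powr s + real j powr t)"
    using n(2)[of "exp (- x)" j] eps_of_x[OF x] j(1) by simp
  also have "\<dots> \<le> \<delta> * (B * real j)"
  proof (intro mult_left_mono)
    have "y \<le> 1 / e * real j powr (1 / s)"
    proof -
      have "\<alpha> j * e \<le> real j powr ((1 - s) / s)" using j(2) aj by (simp add: field_simps)
      then have "real j * (\<alpha> j * e) \<le> real j powr 1 * real j powr ((1 - s) / s)" using j1 by (auto intro: mult_left_mono)
      also have "\<dots> = real j powr (1 / s)"
        unfolding powr_add[symmetric] using s by (intro arg_cong[where f="\<lambda>p. real j powr p"]) (simp add: field_simps)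
      finally show ?thesis using e by (simp add: y_def field_simps)
    qed
    moreover have "C * real j \<le> C * real j powr (1 / s)"
      using C s j1 powr_mono[of 1 "1 / s" "real j"] by (intro mult_left_mono) auto
    ultimately have "x \<le> (1 / e + C) * real j powr (1 / s)" by (simp add: x_def algebra_simps)
    then have "x powr s \<le> ((1 / e + C) * real j powr (1 / s)) powr s" using x s by (intro powr_mono2) auto
    also have "\<dots> = (1 / e + C) powr s * real j" using s e C by (simp add: powr_mult powr_powr)
    finally have "x powr s \<le> (1 / e + C) powr s * real j" .
    moreover have "real j powr t \<le> real j" using t j1 powr_mono[of t 1 "real j"] by simp
    ultimately show "x powr s + real j powr t \<le> B * real j" by (simp add: B_def algebra_simps)
  qed (use \<delta> in simp)
  also have "\<dots> = real j * (ln 2 / 2)" using B by (simp add: \<delta>_def)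
  finally have "ln 2 \<le> (ln 2 / 2 :: real)" using j1 by simp
  then show False by simp
qed

section \<open>Sublinear dependence on the dimension, superlinear dependence on the digits\<close>

text \<open>
  Since \<open>\<alpha>\<^sub>k \<ge> \<alpha>\<^sub>1\<close>, the hypothesis makes \<open>k powr (1 - t) * exp (- \<alpha>\<^sub>k)\<close> at most \<open>1\<close> for large \<open>k\<close>, that is,
  \<open>\<alpha>\<^sub>k \<ge> (1 - t) ln k\<close>; this estimate is put back into the hypothesis.
\<close>
lemma exp_alpha_small:
  assumes lim: "(\<lambda>j. real j powr (1 - t) * \<alpha> j * exp (- \<alpha> j)) \<longlonglongrightarrow> 0" and t: "t < 1" and \<eta>: "\<eta> > 0"
  shows "\<exists>K\<ge>3. \<forall>k\<ge>K. exp (- \<alpha> k) \<le> \<eta> * real k powr (t - 1) / ln (real k)"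
proof -
  define e where "e = min (\<alpha> 1) (\<eta> * (1 - t))"
  have e: "e > 0" "e \<le> \<alpha> 1" "e \<le> \<eta> * (1 - t)" using alpha_1_pos \<eta> t by (auto simp: e_def)
  have "\<forall>\<^sub>F k in sequentially. real k powr (1 - t) * \<alpha> k * exp (- \<alpha> k) < e"
    using order_tendstoD(2)[OF lim] e by simp
  then obtain K where K: "\<And>k. k \<ge> K \<Longrightarrow> real k powr (1 - t) * \<alpha> k * exp (- \<alpha> k) < e"
    unfolding eventually_sequentially by blast
  have "exp (- \<alpha> k) \<le> \<eta> * real k powr (t - 1) / ln (real k)" if k: "k \<ge> max 3 K" for k
  proof -
    have k3: "k \<ge> 3" "k \<ge> K" using k by auto
    have pk: "real k powr (1 - t) > 0" using k3 by simp
    have ak: "\<alpha> k \<ge> \<alpha> 1" using alpha_ge[of k] k3 by simp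
    have lk: "ln (real k) > 0" using k3 by simp
    have small: "real k powr (1 - t) * exp (- \<alpha> k) * \<alpha> k < e" using K[OF k3(2)] by (simp add: mult_ac)
    have "real k powr (1 - t) * exp (- \<alpha> k) * \<alpha> 1 \<le> real k powr (1 - t) * exp (- \<alpha> k) * \<alpha> k"
      using ak pk by (intro mult_left_mono) auto
    also have "\<dots> \<le> 1 * \<alpha> 1" using small e by simp
    finally have "real k powr (1 - t) * exp (- \<alpha> k) \<le> 1" using alpha_1_pos by (simp only: mult_le_cancel_right_pos)
    then have "ln (real k powr (1 - t) * exp (- \<alpha> k)) \<le> 0" using pk by simp
    then have "(1 - t) * ln (real k) \<le> \<alpha> k" using k3 by (simp add: ln_mult ln_powr)
    then have "real k powr (1 - t) * exp (- \<alpha> k) * ((1 - t) * ln (real k)) \<le> real k powr (1 - t) * exp (- \<alpha> k) * \<alpha> k"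
      by (intro mult_left_mono) auto
    also have "\<dots> \<le> \<eta> * (1 - t)" using small e by simp
    finally have "real k powr (1 - t) * exp (- \<alpha> k) * ln (real k) * (1 - t) \<le> \<eta> * (1 - t)" by (simp add: mult_ac)
    then have "real k powr (1 - t) * exp (- \<alpha> k) * ln (real k) \<le> \<eta>" using t by simp
    then have "exp (- \<alpha> k) \<le> \<eta> / (real k powr (1 - t) * ln (real k))"
      using pk lk by (simp add: pos_le_divide_eq mult_ac)
    also have "real k powr (t - 1) = 1 / real k powr (1 - t)" using powr_minus_divide[of "real k" "1 - t"] by simp
    then have "\<eta> / (real k powr (1 - t) * ln (real k)) = \<eta> * real k powr (t - 1) / ln (real k)" by simp
    finally show ?thesis .
  qed
  then show ?thesis by (intro exI[of _ "max 3 K"]) auto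
qed

text \<open>
  The exponent \<open>1 - 1 / ln d\<close> loses only a bounded factor against the exponent \<open>1\<close>: the reciprocal of the
  bound on \<open>exp (- \<alpha>\<^sub>k)\<close> is at most \<open>d\<^sup>3\<close>, and \<open>(d\<^sup>3) powr (1 / ln d) = exp 3\<close>.
\<close>
lemma exp_tau_alpha_le:
  assumes t: "0 < t" "t < 1" and \<eta>: "0 < \<eta>" "\<eta> \<le> 1" and k: "3 \<le> k" "k \<le> d"
    and small: "exp (- \<alpha> k) \<le> \<eta> * real k powr (t - 1) / ln (real k)"
    and d: "ln (real d) \<ge> 2" "ln (real d) \<ge> ln (1 / \<eta>)"
  shows "ln (real d) * exp (- ((1 - 1 / ln (real d)) * \<alpha> k))
           \<le> exp 3 * \<eta> * (1 + 2 / t) * (real d powr (t / 2) * real k powr (t / 2 - 1))"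
proof -
  define l where "l = ln (real d)"
  have l: "l \<ge> 2" "l \<ge> ln (1 / \<eta>)" using d by (auto simp: l_def)
  have kd: "real k \<ge> 3" "real d \<ge> real k" using k by auto
  have lk: "ln (real k) \<ge> 1"
  proof -
    have "exp 1 \<le> real k" using exp_le kd by linarith
    then show ?thesis using kd by (subst ln_ge_iff) auto
  qed
  define q where "q = \<eta> * real k powr (t - 1) / ln (real k)"
  have q: "q > 0" using \<eta> kd lk by (simp add: q_def)
  have "exp (- ((1 - 1 / l) * \<alpha> k)) = exp (- \<alpha> k) powr (1 - 1 / l)" by (simp add: powr_def)
  also have "\<dots> \<le> q powr (1 - 1 / l)" using small l by (intro powr_mono2) (auto simp: q_def)
  also have "\<dots> = q * (1 / q) powr (1 / l)" using q by (simp add: powr_diff powr_divide)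
  also have "\<dots> \<le> q * exp 3"
  proof (intro mult_left_mono)
    have "1 / q = (1 / \<eta>) * (real k powr (1 - t) * ln (real k))"
      using powr_minus_divide[of "real k" "1 - t"] by (simp add: q_def)
    also have "\<dots> \<le> exp l * (exp l * exp l)"
    proof (intro mult_mono)
      have "1 / \<eta> = exp (ln (1 / \<eta>))" using \<eta> by simp
      also have "\<dots> \<le> exp l" using l(2) by simp
      finally show "1 / \<eta> \<le> exp l" .
      have el: "exp l = real d" using kd by (simp add: l_def)
      have "real k powr (1 - t) \<le> real k powr 1" using kd t by (intro powr_mono) auto
      then show "real k powr (1 - t) \<le> exp l" using el kd by simp
      show "ln (real k) \<le> exp l" using ln_less_self[of "real k"] el kd by linarith
    qed (use lk kd \<eta> in auto)
    finally have "1 / q \<le> exp (3 * l)" by (simp add: exp_add[symmetric])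
    then have "(1 / q) powr (1 / l) \<le> exp (3 * l) powr (1 / l)" using q l by (intro powr_mono2) auto
    also have "\<dots> = exp 3" using l by (simp add: powr_def)
    finally show "(1 / q) powr (1 / l) \<le> exp 3" .
  qed (use q in simp)
  finally have 1: "exp (- ((1 - 1 / l) * \<alpha> k)) \<le> q * exp 3" .
  \<comment> \<open>Since \<open>ln d = ln k + ln (d / k)\<close>, replacing \<open>ln d\<close> by \<open>ln k\<close> costs only a small power of \<open>d / k\<close>.\<close>
  have 2: "l \<le> (1 + 2 / t) * (real d / real k) powr (t / 2) * ln (real k)"
  proof -
    have r: "real d / real k \<ge> 1" using kd by simp
    then have rp: "(real d / real k) powr (t / 2) \<ge> 1" using t by (intro ge_one_powr_ge_zero) auto
    have "l = ln (real k) + ln (real d / real k)" using kd by (simp add: l_def ln_div)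
    also have "\<dots> \<le> (real d / real k) powr (t / 2) * ln (real k) + (real d / real k) powr (t / 2) / (t / 2) * ln (real k)"
    proof (rule add_mono)
      show "ln (real k) \<le> (real d / real k) powr (t / 2) * ln (real k)"
        using lk mult_right_mono[OF rp, of "ln (real k)"] by simp
      have "ln (real d / real k) \<le> (real d / real k) powr (t / 2) / (t / 2)"
        using r t by (intro ln_powr_bound) auto
      also have "\<dots> \<le> (real d / real k) powr (t / 2) / (t / 2) * ln (real k)"
        using lk t mult_left_mono[of 1 "ln (real k)" "(real d / real k) powr (t / 2) / (t / 2)"] by simp
      finally show "ln (real d / real k) \<le> (real d / real k) powr (t / 2) / (t / 2) * ln (real k)" .
    qed
    finally show ?thesis by (simp add: algebra_simps)
  qed
  have "l * exp (- ((1 - 1 / l) * \<alpha> k)) \<le> ((1 + 2 / t) * (real d / real k) powr (t / 2) * ln (real k)) * (q * exp 3)"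
    using 1 2 l by (intro mult_mono) auto
  also have "\<dots> = exp 3 * \<eta> * (1 + 2 / t) * ((real d / real k) powr (t / 2) * real k powr (t - 1))"
    using lk by (simp add: q_def)
  also have "(real d / real k) powr (t / 2) * real k powr (t - 1) = real d powr (t / 2) * real k powr (t / 2 - 1)"
  proof -
    have "real k powr (t - 1) = real k powr (t / 2) * real k powr (t / 2 - 1)"
      unfolding powr_add[symmetric] by simp
    then show ?thesis using kd by (simp add: powr_divide)
  qed
  finally show ?thesis by (simp add: l_def)
qed

text \<open>
  The exponent \<open>\<tau> = 1 - 1 / ln d\<close> turns the bound into \<open>ln d * ln (Z d \<tau>) + 2 ln d * x\<close>. The first part is at
  most a small multiple of \<open>d\<^sup>t\<close> by \<open>exp_tau_alpha_le\<close>; the second is negligible because \<open>s > 1\<close>.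
  Dimensions below \<open>D0\<close>, where \<open>ln d\<close> is not yet large, are treated with \<open>\<tau> = 1/2\<close>.
\<close>
theorem EC_WT_s_gt_1_if:
  assumes lim: "(\<lambda>j. real j powr (1 - t) * \<alpha> j * exp (- \<alpha> j)) \<longlonglongrightarrow> 0" and s: "s > 1" and t: "0 < t" "t < 1"
  shows "EC_st_WT X \<mu> s t"
proof (rule EC_st_WT_I)
  fix \<delta> :: real assume \<delta>: "\<delta> > 0"
  obtain C0 where C0: "C0 > 0" "\<And>\<tau> d. \<tau> \<ge> 1/2 \<Longrightarrow> ln (Z d \<tau>) \<le> C0 * (\<Sum>k=1..d. exp (- (\<tau> * \<alpha> k)))"
    using ln_Z_le_exp_sum[of "1/2"] by auto
  define ct where "ct = exp 3 * (1 + 2 / t) * (2 / t)"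
  have ct: "ct > 0" using t by (simp add: ct_def add_pos_pos)
  define \<eta> where "\<eta> = min 1 (\<delta> / (4 * C0 * ct))"
  have \<eta>: "0 < \<eta>" "\<eta> \<le> 1" "C0 * (ct * \<eta>) \<le> \<delta> / 4"
    using C0 ct \<delta> by (auto simp: \<eta>_def min_def field_simps)
  obtain K where K: "K \<ge> 3" "\<And>k. k \<ge> K \<Longrightarrow> exp (- \<alpha> k) \<le> \<eta> * real k powr (t - 1) / ln (real k)"
    using exp_alpha_small[OF lim t(2) \<eta>(1)] by blast
  define D0 where "D0 = nat \<lceil>exp (max 2 (ln (1 / \<eta>)))\<rceil> + 1"
  have D0: "ln (real d) \<ge> 2" "ln (real d) \<ge> ln (1 / \<eta>)" if "d \<ge> D0" for d
  proof -
    have "exp (max 2 (ln (1 / \<eta>))) \<le> real d" using that unfolding D0_def by linarith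
    moreover have "0 < real d" using that by (simp add: D0_def)
    ultimately have "max 2 (ln (1 / \<eta>)) \<le> ln (real d)" by (subst ln_ge_iff)
    then show "ln (real d) \<ge> 2" "ln (real d) \<ge> ln (1 / \<eta>)" by auto
  qed
  \<comment> \<open>The mixed term \<open>ln d * x\<close> is split by comparing \<open>x powr (s - 1)\<close> with \<open>ln d\<close>.\<close>
  define p where "p = 1 + 1 / (s - 1)"
  have p: "p > 1" using s by (simp add: p_def)
  define A where "A = 2 * (2 / \<delta>) powr (1 / (s - 1))"
  have A: "A > 0" using \<delta> by (simp add: A_def)
  have mixed: "2 * l * x \<le> \<delta> * x powr s + A * l powr p" if "l \<ge> 1" "x > 0" for l x :: real
  proof (cases "2 * l / \<delta> \<le> x powr (s - 1)")
    case True
    then have "2 * l \<le> \<delta> * x powr (s - 1)" using \<delta> by (simp add: field_simps)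
    then have "2 * l * x \<le> \<delta> * x powr (s - 1) * x" using that by (intro mult_right_mono) auto
    also have "\<dots> = \<delta> * x powr s" using powr_add[of x "s - 1" 1] that by simp
    finally show ?thesis using A by (simp add: add_increasing2)
  next
    case False
    then have "(x powr (s - 1)) powr (1 / (s - 1)) \<le> (2 * l / \<delta>) powr (1 / (s - 1))" using s by (intro powr_mono2) auto
    then have "x \<le> (2 / \<delta>) powr (1 / (s - 1)) * l powr (1 / (s - 1))"
      using that s \<delta> powr_mult[of "2 / \<delta>" l "1 / (s - 1)"] by (simp add: powr_powr)
    then have "2 * l * x \<le> 2 * l * ((2 / \<delta>) powr (1 / (s - 1)) * l powr (1 / (s - 1)))"
      using that by (intro mult_left_mono) auto
    also have "\<dots> = A * (l powr 1 * l powr (1 / (s - 1)))" using that by (simp add: A_def)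
    also have "\<dots> = A * l powr p" unfolding powr_add[symmetric] p_def ..
    finally show ?thesis using \<delta> by (simp add: add_increasing)
  qed
  \<comment> \<open>Powers of \<open>ln d\<close> are negligible.\<close>
  define B where "B = C0 * real K + A"
  have B: "B \<ge> 0" using C0 A by (simp add: B_def)
  define u where "u = t / (2 * p)"
  have u: "u > 0" using t p by (simp add: u_def)
  obtain C1 where C1: "C1 \<ge> 0" "\<And>y. y \<ge> 0 \<Longrightarrow> B * (1 / u) powr p * y powr (t / 2) \<le> \<delta> / 4 * y powr t + C1"
    using powr_absorb[of "t / 2" t "B * (1 / u) powr p" "\<delta> / 4"] t B \<delta> by auto
  have lnp: "B * ln (real d) powr p \<le> \<delta> / 4 * real d powr t + C1" if "d \<ge> 1" "ln (real d) \<ge> 1" for d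
  proof -
    have "ln (real d) \<le> real d powr u / u" using that u by (intro ln_powr_bound) auto
    then have "ln (real d) powr p \<le> (real d powr u / u) powr p" using that p by (intro powr_mono2) auto
    also have "\<dots> = (1 / u) powr p * real d powr (t / 2)"
    proof -
      have "u * p = t / 2" using p by (simp add: u_def)
      moreover have "(real d powr u / u) powr p = (1 / u) powr p * real d powr (u * p)"
        using u by (simp add: powr_divide powr_powr)
      ultimately show ?thesis by (simp only:)
    qed
    finally have "B * ln (real d) powr p \<le> B * ((1 / u) powr p * real d powr (t / 2))" using B by (intro mult_left_mono)
    then show ?thesis using C1(2)[of "real d"] by (simp add: mult.assoc)
  qed
  obtain C2 where C2: "C2 \<ge> 0" "\<And>y. y \<ge> 0 \<Longrightarrow> 2 * y powr 1 \<le> \<delta> * y powr s + C2"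
    using powr_absorb[of 1 s 2 \<delta>] s \<delta> by auto
  have "ln (real (N X \<epsilon> d)) \<le> \<delta> * (ln (1 / \<epsilon>) powr s + real d powr t) + (C1 + C2 + 2 * C0 * real D0)"
    if \<epsilon>: "0 < \<epsilon>" "\<epsilon> < 1" and d: "d \<ge> 1" for \<epsilon> d
  proof -
    define x where "x = ln (1 / \<epsilon>)"
    have x: "x > 0" using \<epsilon> by (simp add: x_def)
    have nonneg: "0 \<le> \<delta> * real d powr t" "0 \<le> \<delta> * x powr s" "0 \<le> C0 * real D0" using \<delta> C0 by auto
    show ?thesis
    proof (cases "d \<ge> D0")
      case False
      have "(\<Sum>k=1..d. exp (- (1/2 * \<alpha> k))) \<le> (\<Sum>k=1..d. 1)"
        using alpha_pos by (intro sum_mono) (auto intro: less_imp_le)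
      also have "\<dots> \<le> real D0" using False by simp
      finally have "C0 * (\<Sum>k=1..d. exp (- (1/2 * \<alpha> k))) \<le> C0 * real D0" using C0 by (intro mult_left_mono) auto
      then have "ln (Z d (1/2)) \<le> C0 * real D0" using C0(2)[of "1/2" d] by simp
      moreover have "ln (real (N X \<epsilon> d)) \<le> 2 * ln (Z d (1/2)) + 4 * (1/2 * x)"
        unfolding x_def using \<epsilon> d by (intro ln_N_le) auto
      ultimately have "ln (real (N X \<epsilon> d)) \<le> 2 * (C0 * real D0) + 2 * x" by simp
      moreover have "2 * x \<le> \<delta> * x powr s + C2" using C2(2)[of x] x by simp
      ultimately show ?thesis using nonneg C1(1) by (simp add: x_def[symmetric] distrib_left)
    next
      case True
      define l where "l = ln (real d)"
      have l: "l \<ge> 2" using D0[OF True] by (simp add: l_def)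
      define \<tau> where "\<tau> = 1 - 1 / l"
      have \<tau>: "1/2 \<le> \<tau>" "\<tau> < 1" "1 - \<tau> = 1 / l" using l by (auto simp: \<tau>_def field_simps)
      have "l * (\<Sum>k=1..d. exp (- (\<tau> * \<alpha> k)))
          \<le> (\<Sum>k=1..d. (if k < K then l else 0) + exp 3 * \<eta> * (1 + 2 / t) * real d powr (t / 2) * real k powr (t / 2 - 1))"
        unfolding sum_distrib_left
      proof (rule sum_mono)
        fix k assume k: "k \<in> {1..d}"
        have nn: "0 \<le> exp 3 * \<eta> * (1 + 2 / t) * real d powr (t / 2) * real k powr (t / 2 - 1)"
          using \<eta> t by simp
        show "l * exp (- (\<tau> * \<alpha> k)) \<le> (if k < K then l else 0) + exp 3 * \<eta> * (1 + 2 / t) * real d powr (t / 2) * real k powr (t / 2 - 1)"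
        proof (cases "k < K")
          case True
          have "exp (- (\<tau> * \<alpha> k)) \<le> 1" using \<tau> alpha_pos[of k] k by simp
          then have "l * exp (- (\<tau> * \<alpha> k)) \<le> l" using l by (simp add: mult_left_le)
          then show ?thesis using True nn by simp
        next
          case False
          have "ln (real d) * exp (- ((1 - 1 / ln (real d)) * \<alpha> k))
              \<le> exp 3 * \<eta> * (1 + 2 / t) * (real d powr (t / 2) * real k powr (t / 2 - 1))"
            using False K(1) k by (intro exp_tau_alpha_le t \<eta> K(2) D0 True) auto
          then show ?thesis using False by (simp add: \<tau>_def l_def mult.assoc)
        qed
      qed
      also have "\<dots> = (\<Sum>k\<in>{1..d} \<inter> {..<K}. l) + exp 3 * \<eta> * (1 + 2 / t) * real d powr (t / 2) * (\<Sum>k=1..d. real k powr (t / 2 - 1))"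
        by (simp add: sum.distrib sum.If_cases lessThan_def sum_distrib_left)
      also have "(\<Sum>k\<in>{1..d} \<inter> {..<K}. l) \<le> (\<Sum>k<K. l)" using l by (intro sum_mono2) auto
      also have "exp 3 * \<eta> * (1 + 2 / t) * real d powr (t / 2) * (\<Sum>k=1..d. real k powr (t / 2 - 1))
          \<le> exp 3 * \<eta> * (1 + 2 / t) * real d powr (t / 2) * (real d powr (t / 2) / (t / 2))"
        using \<eta> t by (intro mult_left_mono sum_powr_le) auto
      also have "\<dots> = ct * \<eta> * (real d powr (t / 2) * real d powr (t / 2))" by (simp add: ct_def)
      also have "real d powr (t / 2) * real d powr (t / 2) = real d powr t" unfolding powr_add[symmetric] by simp
      finally have sum: "l * (\<Sum>k=1..d. exp (- (\<tau> * \<alpha> k))) \<le> real K * l + ct * \<eta> * real d powr t" by simp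
      have "ln (real (N X \<epsilon> d)) \<le> (ln (Z d \<tau>) + 2 * \<tau> * x) / (1 - \<tau>)"
        unfolding x_def using \<epsilon> d \<tau> by (intro ln_info_complexity_upper) auto
      also have "\<dots> = l * ln (Z d \<tau>) + 2 * l * (\<tau> * x)" unfolding \<tau>(3) using l by (simp add: algebra_simps)
      also have "\<dots> \<le> C0 * (l * (\<Sum>k=1..d. exp (- (\<tau> * \<alpha> k)))) + 2 * l * x"
      proof (rule add_mono)
        have "l * ln (Z d \<tau>) \<le> l * (C0 * (\<Sum>k=1..d. exp (- (\<tau> * \<alpha> k))))"
          using C0(2)[OF \<tau>(1)] l by (intro mult_left_mono) auto
        then show "l * ln (Z d \<tau>) \<le> C0 * (l * (\<Sum>k=1..d. exp (- (\<tau> * \<alpha> k))))" by (simp add: mult_ac)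
        have "\<tau> * x \<le> 1 * x" using \<tau> x by (intro mult_right_mono) auto
        then show "2 * l * (\<tau> * x) \<le> 2 * l * x" using l by (intro mult_left_mono) auto
      qed
      also have "C0 * (l * (\<Sum>k=1..d. exp (- (\<tau> * \<alpha> k)))) \<le> C0 * (real K * l + ct * \<eta> * real d powr t)"
        using C0 sum by (intro mult_left_mono) auto
      also have "\<dots> = C0 * real K * l + C0 * (ct * \<eta>) * real d powr t" by (simp add: algebra_simps)
      also have "C0 * (ct * \<eta>) * real d powr t \<le> \<delta> / 4 * real d powr t" using \<eta> by (intro mult_right_mono) auto
      also have "C0 * real K * l \<le> C0 * real K * l powr p"
        using C0 l p powr_mono[of 1 p l] by (intro mult_left_mono) auto
      also have "2 * l * x \<le> \<delta> * x powr s + A * l powr p" using l x by (intro mixed) auto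
      finally have "ln (real (N X \<epsilon> d)) \<le> \<delta> * x powr s + \<delta> / 4 * real d powr t + B * l powr p"
        by (simp add: B_def algebra_simps)
      moreover have "B * l powr p \<le> \<delta> / 4 * real d powr t + C1" unfolding l_def using d l by (intro lnp) (auto simp: l_def)
      moreover have "0 \<le> \<delta> / 2 * real d powr t" using \<delta> by simp
      ultimately show ?thesis using nonneg(3) C2(1) by (simp add: x_def[symmetric] distrib_left)
    qed
  qed
  then show "\<exists>C. \<forall>\<epsilon> d. 0 < \<epsilon> \<longrightarrow> \<epsilon> < 1 \<longrightarrow> d \<ge> 1 \<longrightarrow>
       ln (real (N X \<epsilon> d)) \<le> \<delta> * (ln (1 / \<epsilon>) powr s + real d powr t) + C" by blast
qed (use s t in auto)

text \<open>
  The function \<open>v exp (- v)\<close> decreases for \<open>v \<ge> 1\<close>; for \<open>v\<close> between \<open>\<alpha> 1\<close> and \<open>1\<close> it is bounded below,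
  and everywhere it is at most \<open>1\<close>.
\<close>
lemma alpha_exp_almost_decreasing:
  assumes "1 \<le> k" "k \<le> j"
  shows "min 1 (\<alpha> 1) * exp (- 1) * (\<alpha> j * exp (- \<alpha> j)) \<le> \<alpha> k * exp (- \<alpha> k)"
proof -
  have kj: "\<alpha> k \<le> \<alpha> j" using alpha_mono assms by simp
  have ak: "\<alpha> 1 \<le> \<alpha> k" using alpha_ge assms by simp
  have m: "0 \<le> min 1 (\<alpha> 1) * exp (- 1)" "min 1 (\<alpha> 1) * exp (- 1) \<le> 1"
    using alpha_1_pos mult_mono[of "min 1 (\<alpha> 1)" 1 "exp (- 1 :: real)" 1] by auto
  have aj: "0 \<le> \<alpha> j * exp (- \<alpha> j)" using kj ak alpha_1_pos by simp
  show ?thesis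
  proof (cases "1 \<le> \<alpha> k")
    case True
    have "min 1 (\<alpha> 1) * exp (- 1) * (\<alpha> j * exp (- \<alpha> j)) \<le> 1 * (\<alpha> j * exp (- \<alpha> j))"
      using m aj by (intro mult_right_mono)
    also have "\<dots> \<le> \<alpha> k * exp (- \<alpha> k)" using xexp_decreasing[OF True kj] by simp
    finally show ?thesis .
  next
    case False
    have "\<alpha> j \<le> exp (\<alpha> j)" using exp_ge_add_one_self[of "\<alpha> j"] by linarith
    then have "\<alpha> j * exp (- \<alpha> j) \<le> exp (\<alpha> j) * exp (- \<alpha> j)" by (intro mult_right_mono) auto
    then have "\<alpha> j * exp (- \<alpha> j) \<le> 1" by (simp add: exp_minus)
    then have "min 1 (\<alpha> 1) * exp (- 1) * (\<alpha> j * exp (- \<alpha> j)) \<le> min 1 (\<alpha> 1) * exp (- 1) * 1"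
      using m by (intro mult_left_mono)
    also have "\<dots> \<le> \<alpha> k * exp (- \<alpha> k)" using ak False alpha_1_pos by (simp only: mult_1_right) (intro mult_mono, auto)
    finally show ?thesis .
  qed
qed

text \<open>
  Let \<open>\<pi> = u / (1 + u)\<close> be the probability that a frequency drawn proportionally to the weights is nonzero in
  coordinate \<open>k\<close>. The \<open>\<theta>\<close>-th moment of the weight is at most \<open>1 - \<pi> (1 - exp (- \<theta> \<alpha>\<^sub>k))\<close>, because a nonzero
  coordinate costs at least \<open>\<alpha>\<^sub>k\<close>, and \<open>\<pi>\<close> is at least \<open>2/3 exp (- \<alpha>\<^sub>k)\<close>.
\<close>
lemma Chernoff_factor_le:
  assumes k: "k \<ge> 1" and \<theta>: "\<theta> > 0" "\<theta> * \<alpha> k \<le> 1"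
  shows "1 + lattice_tail ((1 + \<theta>) * \<alpha> k) (b k)
          \<le> (1 + lattice_tail (1 * \<alpha> k) (b k)) powr (1 + \<theta>) * exp (- (\<theta> * (\<alpha> k * exp (- \<alpha> k)) / 3))"
proof -
  define u where "u = lattice_tail (\<alpha> k) (b k)"
  have a: "\<alpha> k > 0" using alpha_pos[OF k] .
  have u: "u \<ge> 2 * exp (- \<alpha> k)" unfolding u_def using a b_pos[OF k] by (rule lattice_tail_ge)
  define q where "q = exp (- \<alpha> k)"
  have q: "0 < q" "q \<le> 1" "2 * q \<le> u" using a u by (auto simp: q_def)
  define \<pi> where "\<pi> = u / (1 + u)"
  have pi: "2 / 3 * q \<le> \<pi>"
  proof -
    have "2 / 3 * q * (1 + u) \<le> u"
    proof -
      have "q * u \<le> 1 * u" using q by (intro mult_right_mono) auto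
      moreover have "2 / 3 * q * (1 + u) = 2 / 3 * q + 2 / 3 * (q * u)" by (simp add: algebra_simps)
      ultimately show ?thesis using q by linarith
    qed
    then show ?thesis using q by (simp add: \<pi>_def pos_le_divide_eq)
  qed
  have v: "\<theta> * \<alpha> k / 2 \<le> 1 - exp (- (\<theta> * \<alpha> k))" using \<theta> a by (intro one_minus_exp_ge) auto
  have "1 + lattice_tail ((1 + \<theta>) * \<alpha> k) (b k) \<le> 1 + exp (- (\<theta> * \<alpha> k)) * u"
    unfolding u_def using a b_pos[OF k] \<theta> lattice_tail_scale_le[of "\<alpha> k" "b k" \<theta>] by simp
  also have "\<dots> = (1 + u) * (1 - \<pi> * (1 - exp (- (\<theta> * \<alpha> k))))"
    using q by (simp add: \<pi>_def field_simps)
  also have "\<dots> \<le> (1 + u) powr (1 + \<theta>) * exp (- (\<theta> * (\<alpha> k * q) / 3))"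
  proof (intro mult_mono)
    have "(1 + u) powr 1 \<le> (1 + u) powr (1 + \<theta>)" using q \<theta> by (intro powr_mono) auto
    then show "1 + u \<le> (1 + u) powr (1 + \<theta>)" using q by simp
    have "(2 / 3 * q) * (\<theta> * \<alpha> k / 2) \<le> \<pi> * (1 - exp (- (\<theta> * \<alpha> k)))"
      using pi v q \<theta> a by (intro mult_mono) auto
    then have "1 - \<pi> * (1 - exp (- (\<theta> * \<alpha> k))) \<le> 1 + - (\<theta> * (\<alpha> k * q) / 3)" by (simp add: mult_ac)
    also have "\<dots> \<le> exp (- (\<theta> * (\<alpha> k * q) / 3))" by (rule exp_ge_add_one_self)
    finally show "1 - \<pi> * (1 - exp (- (\<theta> * \<alpha> k))) \<le> exp (- (\<theta> * (\<alpha> k * q) / 3))" .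
    have "\<pi> \<le> 1" "0 \<le> \<pi>" using q by (auto simp: \<pi>_def)
    moreover have "0 \<le> 1 - exp (- (\<theta> * \<alpha> k))" "1 - exp (- (\<theta> * \<alpha> k)) \<le> 1" using \<theta> a by auto
    ultimately show "0 \<le> 1 - \<pi> * (1 - exp (- (\<theta> * \<alpha> k)))" using mult_le_one[of \<pi> "1 - exp (- (\<theta> * \<alpha> k))"] by simp
  qed simp
  finally show ?thesis by (simp add: u_def q_def)
qed

text \<open>
  Chernoff's bound with \<open>\<theta> = 1/\<alpha>\<^sub>j\<close> at the threshold \<open>c = exp (- D \<alpha>\<^sub>j / 2) Z j 1\<close>: the factors of
  \<open>Chernoff_factor_le\<close> multiply to \<open>exp (- D)\<close>, of which the threshold gives back \<open>exp (D / 2)\<close>. So at least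
  half of the trace consists of weights below \<open>c\<close>, and \<open>\<epsilon> = 1/2\<close> discards only a quarter of it.
\<close>
lemma ln_N_ge_entropy:
  assumes j: "j \<ge> 1"
  defines "D \<equiv> min 1 (\<alpha> 1) * exp (- 1) / 3 * (real j * exp (- \<alpha> j))"
  assumes D: "D \<ge> 2"
  shows "D * \<alpha> j / 2 - ln 4 \<le> ln (real (N X (1/2) j))"
proof -
  define c1 where "c1 = min 1 (\<alpha> 1) * exp (- 1)"
  have aj: "\<alpha> j > 0" using alpha_pos[OF j] .
  define \<theta> where "\<theta> = 1 / \<alpha> j"
  have \<theta>: "\<theta> > 0" using aj by (simp add: \<theta>_def)
  have Zle: "Z j (1 + \<theta>) \<le> Z j 1 powr (1 + \<theta>) * exp (- D)"
  proof -
    have "Z j (1 + \<theta>) \<le> (\<Prod>k=1..j. (1 + lattice_tail (1 * \<alpha> k) (b k)) powr (1 + \<theta>) * exp (- (c1 * exp (- \<alpha> j) / 3)))"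
      unfolding Z_def
    proof (rule prod_mono)
      fix k assume k: "k \<in> {1..j}"
      then have k1: "1 \<le> k" "k \<le> j" by auto
      have "\<theta> * \<alpha> k \<le> 1" using alpha_mono[OF k1] aj by (simp add: \<theta>_def)
      from Chernoff_factor_le[OF k1(1) \<theta> this]
      have "1 + lattice_tail ((1 + \<theta>) * \<alpha> k) (b k)
          \<le> (1 + lattice_tail (1 * \<alpha> k) (b k)) powr (1 + \<theta>) * exp (- (\<theta> * (\<alpha> k * exp (- \<alpha> k)) / 3))" .
      also have "\<dots> \<le> (1 + lattice_tail (1 * \<alpha> k) (b k)) powr (1 + \<theta>) * exp (- (c1 * exp (- \<alpha> j) / 3))"
      proof (intro mult_left_mono)
        have "\<theta> * (c1 * (\<alpha> j * exp (- \<alpha> j))) \<le> \<theta> * (\<alpha> k * exp (- \<alpha> k))"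
          unfolding c1_def using alpha_exp_almost_decreasing[OF k1] \<theta> by (intro mult_left_mono) auto
        moreover have "\<theta> * (c1 * (\<alpha> j * exp (- \<alpha> j))) = c1 * exp (- \<alpha> j)" using aj by (simp add: \<theta>_def)
        ultimately show "exp (- (\<theta> * (\<alpha> k * exp (- \<alpha> k)) / 3)) \<le> exp (- (c1 * exp (- \<alpha> j) / 3))" by simp
      qed simp
      finally show "0 \<le> 1 + lattice_tail ((1 + \<theta>) * \<alpha> k) (b k) \<and> 1 + lattice_tail ((1 + \<theta>) * \<alpha> k) (b k)
         \<le> (1 + lattice_tail (1 * \<alpha> k) (b k)) powr (1 + \<theta>) * exp (- (c1 * exp (- \<alpha> j) / 3))"
        using lattice_tail_nonneg[of "(1 + \<theta>) * \<alpha> k" "b k"] by simp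
    qed
    also have "\<dots> = (\<Prod>k=1..j. (1 + lattice_tail (1 * \<alpha> k) (b k)) powr (1 + \<theta>)) * exp (- (c1 * exp (- \<alpha> j) / 3)) ^ j"
      by (simp add: prod.distrib)
    also have "exp (- (c1 * exp (- \<alpha> j) / 3)) ^ j = exp (- D)"
      unfolding exp_of_nat_mult[symmetric] by (simp add: D_def c1_def)
    also have "(\<Prod>k=1..j. (1 + lattice_tail (1 * \<alpha> k) (b k)) powr (1 + \<theta>)) = Z j 1 powr (1 + \<theta>)"
      unfolding Z_def by (rule prod_powr_distrib[symmetric])
    finally show ?thesis .
  qed
  define T where "T = Z j 1"
  have T: "T \<ge> 1" unfolding T_def by (rule Z_ge_1)
  define c where "c = exp (- (D * \<alpha> j / 2)) * T"
  have c: "c > 0" using T by (simp add: c_def)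
  have cp: "c powr (- \<theta>) * Z j (1 + \<theta>) \<le> T * (1 / 2)"
  proof -
    have "c powr (- \<theta>) = exp (D / 2) * T powr (- \<theta>)"
      using T aj by (simp add: c_def powr_mult powr_def[of "exp _"] \<theta>_def)
    then have "c powr (- \<theta>) * Z j (1 + \<theta>) \<le> exp (D / 2) * T powr (- \<theta>) * (T powr (1 + \<theta>) * exp (- D))"
      using Zle by (simp add: T_def mult_left_mono)
    also have "exp (D / 2) * T powr (- \<theta>) * (T powr (1 + \<theta>) * exp (- D))
        = (T powr (- \<theta>) * T powr (1 + \<theta>)) * (exp (D / 2) * exp (- D))" by (simp add: mult_ac)
    also have "T powr (- \<theta>) * T powr (1 + \<theta>) = T" unfolding powr_add[symmetric] using T by simp
    also have "exp (D / 2) * exp (- D) = exp (- (D / 2))" by (simp add: exp_add[symmetric])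
    also have "T * exp (- (D / 2)) \<le> T * (1 / 2)"
    proof (intro mult_left_mono)
      have "2 \<le> exp (1::real)" using exp_ge_add_one_self[of 1] by simp
      also have "\<dots> \<le> exp (D / 2)" using D by simp
      finally show "exp (- (D / 2)) \<le> 1 / 2" by (simp add: exp_minus field_simps)
    qed (use T in simp)
    finally show ?thesis .
  qed
  have "Z j 1 - c powr (- \<theta>) * Z j (1 + \<theta>) - c * real (N X (1/2) j) \<le> (1/2)\<^sup>2 * (cri X j)\<^sup>2"
    using j c \<theta> by (intro N_ge_Chernoff) auto
  also have "\<dots> \<le> (1/2)\<^sup>2 * T" unfolding T_def using cri_square_le by (intro mult_left_mono) auto
  finally have "T * (1/4) \<le> c * real (N X (1/2) j)" using cp by (simp add: T_def power2_eq_square)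
  also have "\<dots> = T * (exp (- (D * \<alpha> j / 2)) * real (N X (1/2) j))" by (simp add: c_def)
  finally have "1/4 \<le> exp (- (D * \<alpha> j / 2)) * real (N X (1/2) j)" using T by (simp only: mult_le_cancel_left_pos)
  then have ge: "exp (D * \<alpha> j / 2) / 4 \<le> real (N X (1/2) j)" by (simp add: exp_minus field_simps)
  have "ln (exp (D * \<alpha> j / 2) / 4) \<le> ln (real (N X (1/2) j))"
    using ge exp_gt_zero[of "D * \<alpha> j / 2"] by (subst ln_le_cancel_iff) linarith+
  then show ?thesis by (simp add: ln_div)
qed

text \<open>
  Suppose \<open>j \<alpha>\<^sub>j exp (- \<alpha>\<^sub>j) \<ge> e j\<^sup>t\<close>. This forces \<open>\<alpha>\<^sub>j = O(ln j)\<close>, so the quantity \<open>D\<close> of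
  \<open>ln_N_ge_entropy\<close> tends to infinity with \<open>j\<close>, and \<open>ln n\<close> is of order \<open>j\<^sup>t\<close> at \<open>\<epsilon> = 1/2\<close>.
\<close>
theorem EC_WT_s_gt_1_only_if:
  assumes EC: "EC_st_WT X \<mu> s t" and t: "0 < t" "t < 1"
  shows "(\<lambda>j. real j powr (1 - t) * \<alpha> j * exp (- \<alpha> j)) \<longlonglongrightarrow> 0"
proof (rule ccontr)
  assume "\<not> ?thesis"
  then obtain e where e: "e > 0" "\<And>n. \<exists>j\<ge>n. \<bar>real j powr (1 - t) * \<alpha> j * exp (- \<alpha> j)\<bar> \<ge> e"
    using not_tendsto_zero_frequently by blast
  define c2 where "c2 = min 1 (\<alpha> 1) * exp (- 1) / 3"
  have c2: "c2 > 0" using alpha_1_pos by (simp add: c2_def)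
  define \<delta> where "\<delta> = c2 * e / 4"
  have \<delta>: "\<delta> > 0" using c2 e by (simp add: \<delta>_def)
  obtain n where n: "n \<ge> 1" "\<And>\<epsilon> d. 0 < \<epsilon> \<Longrightarrow> \<epsilon> < 1 \<Longrightarrow> d \<ge> n \<Longrightarrow>
      ln (real (N X \<epsilon> d)) \<le> \<delta> * (ln (1 / \<epsilon>) powr s + real d powr t)"
    using EC_st_WT_D[OF EC \<delta>] by blast
  define Q where "Q = \<delta> * ln 2 powr s + ln 4"
  have ev: "\<forall>\<^sub>F j in sequentially. 2 * (2 * ln (2 / e) + 2 * ln (real j)) \<le> c2 * e * real j powr t \<and>
        Q < \<delta> * real j powr t \<and> n \<le> j"
    using c2 e(1) \<delta> t by (intro eventually_conj eventually_ge_at_top; real_asymp)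
  then obtain n' where n': "\<And>j. j \<ge> n' \<Longrightarrow> 2 * (2 * ln (2 / e) + 2 * ln (real j)) \<le> c2 * e * real j powr t \<and>
        Q < \<delta> * real j powr t \<and> n \<le> j"
    unfolding eventually_sequentially by blast
  obtain j where j: "j \<ge> max n' n" "\<bar>real j powr (1 - t) * \<alpha> j * exp (- \<alpha> j)\<bar> \<ge> e" using e(2) by blast
  have j1: "j \<ge> 1" "j \<ge> n" "j \<ge> n'" using j n by auto
  have aj: "\<alpha> j > 0" using alpha_pos[OF j1(1)] .
  have ge: "e \<le> real j powr (1 - t) * (\<alpha> j * exp (- \<alpha> j))" using j(2) aj by (simp add: abs_mult mult.assoc)
  have ge': "e * real j powr t \<le> real j * (\<alpha> j * exp (- \<alpha> j))"
  proof -
    have "e * real j powr t \<le> real j powr (1 - t) * (\<alpha> j * exp (- \<alpha> j)) * real j powr t"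
      using ge by (intro mult_right_mono) auto
    also have "\<dots> = (real j powr (1 - t) * real j powr t) * (\<alpha> j * exp (- \<alpha> j))" by (simp add: mult_ac)
    also have "real j powr (1 - t) * real j powr t = real j" unfolding powr_add[symmetric] using j1 by simp
    finally show ?thesis .
  qed
  have up: "\<alpha> j \<le> 2 * ln (2 / e) + 2 * ln (real j)"
  proof -
    have "\<alpha> j / 2 \<le> exp (\<alpha> j / 2)" using exp_ge_add_one_self[of "\<alpha> j / 2"] by linarith
    then have "\<alpha> j * exp (- \<alpha> j) \<le> (2 * exp (\<alpha> j / 2)) * exp (- \<alpha> j)" by (intro mult_right_mono) auto
    also have "\<dots> = 2 * exp (- (\<alpha> j / 2))" by (simp add: exp_add[symmetric])
    finally have "e * 1 \<le> real j * (2 * exp (- (\<alpha> j / 2)))"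
      using ge' ge_one_powr_ge_zero[of "real j" t] j1 t e(1)
      by (intro order_trans[OF mult_left_mono[of 1 "real j powr t" e]] order_trans[OF ge'] mult_left_mono) auto
    then have "exp (\<alpha> j / 2) \<le> 2 / e * real j" using e(1) by (simp add: exp_minus field_simps)
    then have "\<alpha> j / 2 \<le> ln (2 / e * real j)" using e(1) j1 by (subst ln_ge_iff) auto
    also have "\<dots> = ln (2 / e) + ln (real j)" using e(1) j1 by (intro ln_mult_pos) auto
    finally show ?thesis by simp
  qed
  define D where "D = c2 * (real j * exp (- \<alpha> j))"
  have Da: "c2 * (e * real j powr t) \<le> D * \<alpha> j"
  proof -
    have "c2 * (e * real j powr t) \<le> c2 * (real j * (\<alpha> j * exp (- \<alpha> j)))" using ge' c2 by (intro mult_left_mono) auto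
    then show ?thesis by (simp add: D_def mult_ac)
  qed
  have "2 * \<alpha> j \<le> D * \<alpha> j" using up n'[OF j1(3)] Da by (simp add: mult.assoc)
  then have D2: "D \<ge> 2" using aj by simp
  have "D * \<alpha> j / 2 - ln 4 \<le> ln (real (N X (1/2) j))"
    using ln_N_ge_entropy[OF j1(1)] D2 by (simp add: D_def c2_def)
  also have "\<dots> \<le> \<delta> * (ln (1 / (1/2)) powr s + real j powr t)" using n(2)[of "1/2" j] j1 by simp
  also have "\<dots> = \<delta> * ln 2 powr s + \<delta> * real j powr t" by (simp add: distrib_left)
  finally have "D * \<alpha> j / 2 \<le> Q + \<delta> * real j powr t" by (simp add: Q_def)
  moreover have "2 * (\<delta> * real j powr t) \<le> D * \<alpha> j / 2" using Da by (simp add: \<delta>_def mult_ac)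
  moreover have "Q < \<delta> * real j powr t" using n'[OF j1(3)] by simp
  ultimately show False by linarith
qed

section \<open>The criteria in terms of the original sequence\<close>

lemma tendsto_div_alpha_iff:
  "(\<lambda>j. g j / \<alpha> j) \<longlonglongrightarrow> 0 \<longleftrightarrow> (\<lambda>j. g j / a j) \<longlonglongrightarrow> 0"
proof -
  have l: "- ln \<omega> \<noteq> 0" using omega by simp
  have eq: "g j / \<alpha> j = inverse (- ln \<omega>) * (g j / a j)" for j by (simp add: \<alpha>_def divide_simps)
  show ?thesis unfolding eq using tendsto_mult_left_iff[of "inverse (- ln \<omega>)" "\<lambda>j. g j / a j" 0 sequentially] l by simp
qed

lemma filterlim_alpha_iff: "filterlim \<alpha> at_top sequentially \<longleftrightarrow> filterlim a at_top sequentially"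
proof -
  have l: "- ln \<omega> > 0" using omega by simp
  have "filterlim \<alpha> at_top sequentially \<longleftrightarrow> filterlim (\<lambda>k. - ln \<omega> * a k) at_top sequentially"
    by (simp add: \<alpha>_def[abs_def])
  also have "\<dots> \<longleftrightarrow> filterlim a at_top sequentially"
    using filterlim_tendsto_pos_mult_at_top_iff[OF tendsto_const l] by simp
  finally show ?thesis .
qed

lemma tendsto_alpha_exp_iff:
  "(\<lambda>j. g j * \<alpha> j * exp (- \<alpha> j)) \<longlonglongrightarrow> 0 \<longleftrightarrow> (\<lambda>j. g j * a j * \<omega> powr (a j)) \<longlonglongrightarrow> 0"
proof -
  have l: "- ln \<omega> \<noteq> 0" using omega by simp
  have eq: "g j * \<alpha> j * exp (- \<alpha> j) = - ln \<omega> * (g j * a j * \<omega> powr (a j))" for j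
    using omega by (simp add: \<alpha>_def powr_def mult_ac)
  show ?thesis unfolding eq using tendsto_mult_left_iff[of "- ln \<omega>" "\<lambda>j. g j * a j * \<omega> powr (a j)" 0 sequentially] l by simp
qed

end

section \<open>The characterisation\<close>

theorem theorem1p2:
  fixes \<omega> :: real and a b :: "nat \<Rightarrow> real"
    and \<mu> :: "nat \<Rightarrow> ((nat \<Rightarrow> real) \<Rightarrow> real) measure"
  assumes omega: "0 < \<omega>" "\<omega> < 1"
    and a_pos: "0 < a 1"
    and a_mono: "\<And>k. k \<ge> 1 \<Longrightarrow> a k \<le> a (Suc k)"
    and b_pos: "\<And>k. k \<ge> 1 \<Longrightarrow> 0 < b k"
    and b_inf: "0 < (INF k\<in>{1..}. b k)"
    and gaussian: "\<And>d. d \<ge> 1 \<Longrightarrow> centered_gaussian_measure d (\<mu> d)"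
    and covariance: "\<And>d. d \<ge> 1 \<Longrightarrow> has_covariance_kernel d (\<mu> d) (korobov_kernel \<omega> a b d)"
  shows
    "(\<forall>X\<in>{ABS, NOR}. \<forall>s t. s > 0 \<and> t > 1 \<longrightarrow> EC_st_WT X \<mu> s t) \<and>
     (\<forall>X\<in>{ABS, NOR}. \<forall>s\<ge>1.
        (EC_st_WT X \<mu> s 1 \<longleftrightarrow> EC_WT X \<mu>) \<and>
        (EC_WT X \<mu> \<longleftrightarrow> filterlim a at_top sequentially)) \<and>
     (\<forall>t. 0 < t \<and> t < 1 \<longrightarrow>
        (EC_st_WT ABS \<mu> 1 t \<longleftrightarrow> (\<lambda>j. ln (real j) / a j) \<longlonglongrightarrow> 0)) \<and>
     (\<forall>X\<in>{ABS, NOR}. \<forall>s t. 0 < s \<and> s < 1 \<and> 0 < t \<and> t \<le> 1 \<longrightarrow>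
        (EC_st_WT X \<mu> s t \<longleftrightarrow> (\<lambda>j. real j powr ((1 - s) / s) / a j) \<longlonglongrightarrow> 0)) \<and>
     (\<forall>X\<in>{ABS, NOR}. \<forall>s t. s > 1 \<and> 0 < t \<and> t < 1 \<longrightarrow>
        (EC_st_WT X \<mu> s t \<longleftrightarrow>
          (\<lambda>j. real j powr (1 - t) * a j * \<omega> powr (a j)) \<longlonglongrightarrow> 0))"
proof -
  interpret korobov_problem \<omega> a b \<mu> using assms by unfold_locales
  have t1: "EC_st_WT X \<mu> s 1 \<longleftrightarrow> filterlim a at_top sequentially" if "s \<ge> 1" for X s
    using EC_WT_t_1_if[OF _ that] EC_WT_t_1_only_if filterlim_alpha_iff by blast
  have s1: "EC_st_WT ABS \<mu> 1 t \<longleftrightarrow> (\<lambda>j. ln (real j) / a j) \<longlonglongrightarrow> 0" if "0 < t" "t < 1" for t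
    using EC_WT_s_1_if EC_WT_s_1_only_if that tendsto_div_alpha_iff[of "\<lambda>j. ln (real j)"] by blast
  have slt: "EC_st_WT X \<mu> s t \<longleftrightarrow> (\<lambda>j. real j powr ((1 - s) / s) / a j) \<longlonglongrightarrow> 0"
    if "0 < s" "s < 1" "0 < t" "t \<le> 1" for X s t
    using EC_WT_s_lt_1_if[of s t X] EC_WT_s_lt_1_only_if[of X s t] that
      tendsto_div_alpha_iff[of "\<lambda>j. real j powr ((1 - s) / s)"] by blast
  have sgt: "EC_st_WT X \<mu> s t \<longleftrightarrow> (\<lambda>j. real j powr (1 - t) * a j * \<omega> powr (a j)) \<longlonglongrightarrow> 0"
    if "s > 1" "0 < t" "t < 1" for X s t
    using EC_WT_s_gt_1_if[of t s X] EC_WT_s_gt_1_only_if[of X s t] that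
      tendsto_alpha_exp_iff[of "\<lambda>j. real j powr (1 - t)"] by blast
  show ?thesis
    using EC_WT_if_t_gt_1 t1 s1 slt sgt by (simp add: EC_WT_def)
qed

end
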